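(* Consider the discretized problem $\dot U=DU+g(t)$, $t\in[0,t^*]$, in the setting described in the context. Assume that there is a constant $C$ (independent of the spatial grid) such that $$\|U^{(j)}(t)\|_\infty\le C,\quad \|g^{(i)}(t)\|_\infty\le C,\qquad i=0,\ldots,3,\ j=0,\ldots,4,\ t\in[0,t^*],$$ that $\dot g_j(t)=0$ for $j=2,\ldots,m$, and that, with $\varphi_j(t):=D_jU(t)+g_j(t)$, for all indices $i_1<i_2<\cdots<i_r<j$ (with $r\ge 1$) one has $$D_{i_1}D_{i_2}\cdots D_{i_r}\dot\varphi_j(t)=\beta_{i_1}\cdots\beta_{i_r}\beta_j\,\frac{\partial^{2r+2}\,\dot u(t,\vec{x}_G)}{\partial x_{i_1}^2\cdots\partial x_{i_r}^2\,\partial x_j^2}+\mathcal{O}\big((\Delta x_{i_1})^2+\cdots+(\Delta x_{i_r})^2+(\Delta x_j)^2\big),$$ $$D_{i_1}D_{i_2}\cdots D_{i_r}\ddot\varphi_j(t)=\beta_{i_1}\cdots\beta_{i_r}\beta_j\,\frac{\partial^{2r+2}\,\ddot u(t,\vec{x}_G)}{\partial x_{i_1}^2\cdots\partial x_{i_r}^2\,\partial x_j^2}+\mathcal{O}\big((\Delta x_{i_1})^2+\cdots+(\Delta x_{i_r})^2+(\Delta x_j)^2\big).$$ Let $U_n$ be the numerical solution at $t_n=n\tau$ given by the one-stage AMF-W-method with $\theta=1/2$: $$K_1^{(0)}=\tau D U_n+\tau g(t_n),\qquad (I-\theta\tau D_j)K_1^{(j)}=K_1^{(j-1)}+\theta\tau^2\dot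 g_j(t_n)\ (j=1,\ldots,m),\qquad U_{n+1}=U_n+K_1^{(m)}.$$ If the global errors $E_n:=U_n-U(t_n)$ satisfy $DE_0=\mathcal{O}(\tau^2)$ in the maximum norm, then $$\|E_n\|_\infty\le C'\tau^2,\qquad n=1,\ldots,n^*=t^*/\tau,$$ where the constant $C'$ depends only on $m$ and $C$ (the fixed data listed in the context being regarded as given); in particular $C'$ is independent of $n$, of $\tau>0$ and of the spatial resolution $N_1,\ldots,N_m$.
   Context: PDE: $m\geq 1$ is an integer, $\beta_1,\ldots,\beta_m>0$ are constants, and $u(t,\vec{x})$ is the solution of $\partial_t u=\sum_{j=1}^m\beta_j\partial_{x_jx_j}u+c(t,\vec{x})$ for $t\in[0,t^*]$, $\vec{x}\in(0,1)^m$, with an initial condition $u(0,\vec{x})=u_0(\vec{x})$ and Dirichlet boundary conditions, which are assumed time-independent. $u$ is assumed to be a smooth function (with as many bounded derivatives as required) on $[0,t^*]\times[0,1]^m$. Spatial discretization: for positive integers $N_1,\ldots,N_m$ let $\Delta x_j=1/(N_j+1)$, let $I_j$ be the identity of dimension $N_j$, $L_j=\frac{1}{\Delta x_j^2}\mathrm{tridiag}(1,-2,1)$ of dimension $N_j$, $D_j=\beta_j(I_m\otimes\cdots\otimes I_{j+1}\otimes L_j\otimes I_{j-1}\otimes\cdots\otimes I_1)$ and $D=\sum_{j=1}^mD_j$ (second-order central differences on the uniform grid $G$ of interior points $\vec{x}_G$). The semidiscrete system is $\dot U=DU+g(t)$, $g(t)=\sum_{j=1}^mg_j(t)$, where the discretization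 of $c$ is included entirely in $g_1$, and $g_j$ for $j\ge 2$ consists only of contributions from the boundary conditions in the $j$-direction. Spatial truncation errors are disregarded: $U(t)=u(t,\vec{x}_G)$ is assumed to be at the same time the exact solution of the ODE system and the restriction of the PDE solution to the grid. The vectors $\varphi_i(t)=D_iU(t)+g_i(t)$ satisfy $\sum_{i=1}^m\varphi_i(t)=\dot U(t)$ and are smooth, i.e. they have first and second time derivatives bounded in the maximum norm independently of the spatial resolution. Conventions: dots and superscripts in parentheses on $U,g,g_j,\varphi_j,u$ denote time derivatives; $I$ is the identity matrix of dimension $N_1\cdots N_m$; $\|\cdot\|_\infty$ is the maximum norm; all $\mathcal{O}$-constants are independent of $\tau$, $t$ and the spatial resolution; $\tau>0$ is the time step with $t^*/\tau$ an integer. The data $t^*$, $\beta_1,\ldots,\beta_m$, $u$, and the constants implied by the $\mathcal{O}$-terms and smoothness assumptions are regarded as fixed. *)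

theory Defs
  imports "HOL-Analysis.Analysis"
begin

text \<open>
  Coordinate directions are numbered 1, ..., m. A point of m-dimensional space is an extensional
  function on \<open>{1..m}\<close>, and continuity refers to the product topology of \<^typ>\<open>nat \<Rightarrow> real\<close>.
\<close>

section \<open>The continuous problem\<close>

definition cube :: "nat \<Rightarrow> (nat \<Rightarrow> real) set" where
  "cube m = {1..m} \<rightarrow>\<^sub>E {0..1}"

definition open_cube :: "nat \<Rightarrow> (nat \<Rightarrow> real) set" where
  "open_cube m = {1..m} \<rightarrow>\<^sub>E {0<..<1}"

definition cube_boundary :: "nat \<Rightarrow> (nat \<Rightarrow> real) set" where
  "cube_boundary m = {x \<in> cube m. \<exists>j\<in>{1..m}. x j = 0 \<or> x j = 1}"

text \<open>
  Derivatives are one-sided at the ends of \<open>[0, T]\<close> and \<open>[0, 1]\<close>. The time derivative is used both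
  for functions of space and for grid functions, whence the polymorphic second argument.
\<close>

definition tderiv :: "real \<Rightarrow> (real \<Rightarrow> 'x \<Rightarrow> real) \<Rightarrow> real \<Rightarrow> 'x \<Rightarrow> real" where
  "tderiv T F = (\<lambda>t x. vector_derivative (\<lambda>s. F s x) (at t within {0..T}))"

definition xderiv :: "nat \<Rightarrow> ((nat \<Rightarrow> real) \<Rightarrow> real) \<Rightarrow> (nat \<Rightarrow> real) \<Rightarrow> real" where
  "xderiv j f = (\<lambda>x. vector_derivative (\<lambda>s. f (x(j := s))) (at (x j) within {0..1}))"

text \<open>Here index 0 stands for time and index \<open>i \<ge> 1\<close> for the i-th space coordinate.\<close>

definition pderivative ::
  "real \<Rightarrow> nat \<Rightarrow> (real \<Rightarrow> (nat \<Rightarrow> real) \<Rightarrow> real) \<Rightarrow> real \<Rightarrow> (nat \<Rightarrow> real) \<Rightarrow> real" where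
  "pderivative T i F = (if i = 0 then tderiv T F else (\<lambda>t. xderiv i (F t)))"

definition partially_differentiable ::
  "nat \<Rightarrow> real \<Rightarrow> nat \<Rightarrow> (real \<Rightarrow> (nat \<Rightarrow> real) \<Rightarrow> real) \<Rightarrow> bool" where
  "partially_differentiable m T i F \<longleftrightarrow>
     (\<forall>t\<in>{0..T}. \<forall>x\<in>cube m.
        if i = 0 then (\<lambda>s. F s x) differentiable (at t within {0..T})
        else (\<lambda>s. F t (x(i := s))) differentiable (at (x i) within {0..1}))"

text \<open>All mixed partial derivatives up to total order p exist, are bounded and jointly continuous
  on the closed cylinder.\<close>

definition smooth_upto ::
  "nat \<Rightarrow> nat \<Rightarrow> real \<Rightarrow> (real \<Rightarrow> (nat \<Rightarrow> real) \<Rightarrow> real) \<Rightarrow> bool" where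
  "smooth_upto p m T u \<longleftrightarrow>
     (\<forall>js. set js \<subseteq> {0..m} \<and> length js \<le> p \<longrightarrow>
        (let v = foldr (pderivative T) js u in
           continuous_on ({0..T} \<times> cube m) (\<lambda>(t, x). v t x) \<and>
           bounded ((\<lambda>(t, x). v t x) ` ({0..T} \<times> cube m)) \<and>
           (length js < p \<longrightarrow> (\<forall>i\<in>{0..m}. partially_differentiable m T i v))))"

definition solves_pde ::
  "nat \<Rightarrow> (nat \<Rightarrow> real) \<Rightarrow> real \<Rightarrow> (real \<Rightarrow> (nat \<Rightarrow> real) \<Rightarrow> real) \<Rightarrow>
   ((nat \<Rightarrow> real) \<Rightarrow> real) \<Rightarrow> ((nat \<Rightarrow> real) \<Rightarrow> real) \<Rightarrow> (real \<Rightarrow> (nat \<Rightarrow> real) \<Rightarrow> real) \<Rightarrow> bool" where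
  "solves_pde m \<beta> T c u0 b u \<longleftrightarrow>
     (\<forall>t\<in>{0..T}. \<forall>x\<in>open_cube m.
        tderiv T u t x = (\<Sum>j=1..m. \<beta> j * xderiv j (xderiv j (u t)) x) + c t x) \<and>
     (\<forall>x\<in>cube m. u 0 x = u0 x) \<and>
     (\<forall>t\<in>{0..T}. \<forall>x\<in>cube_boundary m. u t x = b x)"

section \<open>Spatial discretization\<close>

text \<open>
  Vectors of dimension \<open>N 1 * ... * N m\<close> are represented as functions of the multi-index of a grid
  point, and matrices have multi-indices as row and column labels; values off the index set are
  irrelevant.
\<close>

definition mindices :: "nat \<Rightarrow> (nat \<Rightarrow> nat) \<Rightarrow> (nat \<Rightarrow> nat) set" where
  "mindices m N = (\<Pi>\<^sub>E j\<in>{1..m}. {1..N j})"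

definition dx :: "(nat \<Rightarrow> nat) \<Rightarrow> nat \<Rightarrow> real" where
  "dx N j = 1 / (real (N j) + 1)"

definition grid_point :: "nat \<Rightarrow> (nat \<Rightarrow> nat) \<Rightarrow> (nat \<Rightarrow> nat) \<Rightarrow> (nat \<Rightarrow> real)" where
  "grid_point m N k = (\<lambda>j\<in>{1..m}. real (k j) * dx N j)"

definition max_norm :: "nat \<Rightarrow> (nat \<Rightarrow> nat) \<Rightarrow> ((nat \<Rightarrow> nat) \<Rightarrow> real) \<Rightarrow> real" where
  "max_norm m N v = Max ((\<lambda>k. \<bar>v k\<bar>) ` mindices m N)"

definition mat_vec ::
  "nat \<Rightarrow> (nat \<Rightarrow> nat) \<Rightarrow> ((nat \<Rightarrow> nat) \<Rightarrow> (nat \<Rightarrow> nat) \<Rightarrow> real) \<Rightarrow>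
   ((nat \<Rightarrow> nat) \<Rightarrow> real) \<Rightarrow> (nat \<Rightarrow> nat) \<Rightarrow> real" where
  "mat_vec m N A v = (\<lambda>k. \<Sum>l\<in>mindices m N. A k l * v l)"

definition id_mat :: "'i \<Rightarrow> 'i \<Rightarrow> real" where
  "id_mat p q = (if p = q then 1 else 0)"

text \<open>The Kronecker product of \<open>M m, ..., M 1\<close>, with rows and columns labelled by multi-indices.\<close>

definition kronecker ::
  "nat \<Rightarrow> (nat \<Rightarrow> nat \<Rightarrow> nat \<Rightarrow> real) \<Rightarrow> (nat \<Rightarrow> nat) \<Rightarrow> (nat \<Rightarrow> nat) \<Rightarrow> real" where
  "kronecker m M = (\<lambda>k l. \<Prod>i=1..m. M i (k i) (l i))"

definition L_mat :: "(nat \<Rightarrow> nat) \<Rightarrow> nat \<Rightarrow> nat \<Rightarrow> nat \<Rightarrow> real" where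
  "L_mat N j p q =
     (if p = q then - 2 else if p = q + 1 \<or> q = p + 1 then 1 else 0) / (dx N j)\<^sup>2"

definition D_dir ::
  "nat \<Rightarrow> (nat \<Rightarrow> real) \<Rightarrow> (nat \<Rightarrow> nat) \<Rightarrow> nat \<Rightarrow> (nat \<Rightarrow> nat) \<Rightarrow> (nat \<Rightarrow> nat) \<Rightarrow> real" where
  "D_dir m \<beta> N j = (\<lambda>k l. \<beta> j * kronecker m (\<lambda>i. if i = j then L_mat N j else id_mat) k l)"

definition D_mat ::
  "nat \<Rightarrow> (nat \<Rightarrow> real) \<Rightarrow> (nat \<Rightarrow> nat) \<Rightarrow> (nat \<Rightarrow> nat) \<Rightarrow> (nat \<Rightarrow> nat) \<Rightarrow> real" where
  "D_mat m \<beta> N = (\<lambda>k l. \<Sum>j=1..m. D_dir m \<beta> N j k l)"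

definition on_grid ::
  "nat \<Rightarrow> (nat \<Rightarrow> nat) \<Rightarrow> (real \<Rightarrow> (nat \<Rightarrow> real) \<Rightarrow> real) \<Rightarrow> real \<Rightarrow> (nat \<Rightarrow> nat) \<Rightarrow> real" where
  "on_grid m N u = (\<lambda>t k. u t (grid_point m N k))"

text \<open>Contribution of the boundary values b to the central differences in direction j; both
  terms are present if \<open>N j = 1\<close>.\<close>

definition boundary_part ::
  "nat \<Rightarrow> (nat \<Rightarrow> real) \<Rightarrow> (nat \<Rightarrow> nat) \<Rightarrow> ((nat \<Rightarrow> real) \<Rightarrow> real) \<Rightarrow> nat \<Rightarrow> (nat \<Rightarrow> nat) \<Rightarrow> real" where
  "boundary_part m \<beta> N b j k = \<beta> j / (dx N j)\<^sup>2 *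
     ((if k j = 1 then b ((grid_point m N k)(j := 0)) else 0) +
      (if k j = N j then b ((grid_point m N k)(j := 1)) else 0))"

text \<open>
  The grid function \<open>ch\<close> is a discretization of the source term c. It is only required to
  be second order consistent and not to be the restriction of c to the grid, since the restriction of
  u to the grid is required to solve the semidiscrete system exactly.
\<close>

definition semidiscretization ::
  "nat \<Rightarrow> (nat \<Rightarrow> real) \<Rightarrow> real \<Rightarrow> (nat \<Rightarrow> nat) \<Rightarrow> real \<Rightarrow> (real \<Rightarrow> (nat \<Rightarrow> real) \<Rightarrow> real) \<Rightarrow>
   ((nat \<Rightarrow> real) \<Rightarrow> real) \<Rightarrow> (real \<Rightarrow> (nat \<Rightarrow> real) \<Rightarrow> real) \<Rightarrow>
   (nat \<Rightarrow> real \<Rightarrow> (nat \<Rightarrow> nat) \<Rightarrow> real) \<Rightarrow> bool" where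
  "semidiscretization m \<beta> T N Kc c b u g \<longleftrightarrow>
     (\<exists>ch. \<forall>t\<in>{0..T}. \<forall>k\<in>mindices m N.
        \<bar>ch t k - c t (grid_point m N k)\<bar> \<le> Kc * (\<Sum>j=1..m. (dx N j)\<^sup>2) \<and>
        g 1 t k = ch t k + boundary_part m \<beta> N b 1 k \<and>
        (\<forall>j\<in>{2..m}. g j t k = boundary_part m \<beta> N b j k)) \<and>
     (\<forall>t\<in>{0..T}. \<forall>k\<in>mindices m N.
        tderiv T (on_grid m N u) t k =
          mat_vec m N (D_mat m \<beta> N) (on_grid m N u t) k + (\<Sum>j=1..m. g j t k))"

definition \<phi> ::
  "nat \<Rightarrow> (nat \<Rightarrow> real) \<Rightarrow> (nat \<Rightarrow> nat) \<Rightarrow> (real \<Rightarrow> (nat \<Rightarrow> real) \<Rightarrow> real) \<Rightarrow>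
   (nat \<Rightarrow> real \<Rightarrow> (nat \<Rightarrow> nat) \<Rightarrow> real) \<Rightarrow> nat \<Rightarrow> real \<Rightarrow> (nat \<Rightarrow> nat) \<Rightarrow> real" where
  "\<phi> m \<beta> N u g j = (\<lambda>t k. mat_vec m N (D_dir m \<beta> N j) (on_grid m N u t) k + g j t k)"

text \<open>For \<open>js = [i1, ..., ir]\<close> the operator of direction \<open>ir\<close> is applied first, that of direction
  \<open>i1\<close> last.\<close>

definition D_prod ::
  "nat \<Rightarrow> (nat \<Rightarrow> real) \<Rightarrow> (nat \<Rightarrow> nat) \<Rightarrow> nat list \<Rightarrow> ((nat \<Rightarrow> nat) \<Rightarrow> real) \<Rightarrow> (nat \<Rightarrow> nat) \<Rightarrow> real" where
  "D_prod m \<beta> N js v = foldr (\<lambda>i. mat_vec m N (D_dir m \<beta> N i)) js v"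

definition xderiv2_prod :: "nat list \<Rightarrow> ((nat \<Rightarrow> real) \<Rightarrow> real) \<Rightarrow> (nat \<Rightarrow> real) \<Rightarrow> real" where
  "xderiv2_prod js f = foldr (\<lambda>i h. xderiv i (xderiv i h)) js f"

section \<open>The one-stage AMF-W-method\<close>

definition amf_w_step ::
  "nat \<Rightarrow> (nat \<Rightarrow> real) \<Rightarrow> real \<Rightarrow> (nat \<Rightarrow> nat) \<Rightarrow> (nat \<Rightarrow> real \<Rightarrow> (nat \<Rightarrow> nat) \<Rightarrow> real) \<Rightarrow>
   real \<Rightarrow> real \<Rightarrow> real \<Rightarrow> ((nat \<Rightarrow> nat) \<Rightarrow> real) \<Rightarrow> ((nat \<Rightarrow> nat) \<Rightarrow> real) \<Rightarrow> bool" where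
  "amf_w_step m \<beta> T N g \<theta> \<tau> t v w \<longleftrightarrow>
     (\<exists>K. \<forall>k\<in>mindices m N.
        K 0 k = \<tau> * mat_vec m N (D_mat m \<beta> N) v k + \<tau> * (\<Sum>j=1..m. g j t k) \<and>
        (\<forall>j\<in>{1..m}.
           mat_vec m N (\<lambda>k l. id_mat k l - \<theta> * \<tau> * D_dir m \<beta> N j k l) (K j) k =
             K (j - 1) k + \<theta> * \<tau>\<^sup>2 * tderiv T (g j) t k) \<and>
        w k = v k + K m k)"

end

theory Submission
  imports Defs "HOL-Complex_Analysis.Complex_Analysis"
begin

text \<open>Put \<open>A\<^sub>j = -(\<tau>/2) D\<^sub>j\<close>. The directional operators are simultaneously diagonal in the products of discrete
  sine modes, so on each mode the method is scalar: with the eigenvalues \<open>\<lambda>\<^sub>j \<ge> 0\<close> of \<open>A\<^sub>j\<close>,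
  \<open>Q = \<Prod>\<^sub>j (1 + \<lambda>\<^sub>j)\<close> and \<open>r = 1 - 2 (\<Sum>\<^sub>j \<lambda>\<^sub>j) / Q\<close>, the global error satisfies
  \<open>E\<^sub>n\<^sub>+\<^sub>1 = r E\<^sub>n + Q\<^sup>-\<^sup>1 d\<^sub>n\<close> with \<open>d\<^sub>n = \<tau> U' + (\<tau>\<^sup>2/2) g\<^sub>1' - Q (U(t\<^sub>n + \<tau>) - U(t\<^sub>n))\<close>.

  The defect \<open>d\<^sub>n\<close> is of size \<open>\<tau>\<^sup>3\<close> in the maximum norm (\<open>local_defect\<close>). In the expansion of \<open>Q\<close> into
  products of the \<open>A\<^sub>j\<close>, the terms with at most one factor are handled by Taylor expansion, because
  \<open>D U = U' - g\<close>. A product of \<open>s \<ge> 2\<close> factors contributes \<open>\<tau>\<^sup>s\<close> times a mixed difference operator applied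
  to an increment of \<open>U\<close> over one step; the mixed operators are bounded on \<open>U'\<close> by assumption, whence
  \<open>\<tau>\<^sup>s\<^sup>+\<^sup>1\<close>.

  Unrolling the recursion gives terms \<open>r\<^sup>k Q\<^sup>-\<^sup>1 d\<^sub>i\<close>. The initial error fits into the same scheme: since
  \<open>r\<^sup>n - 1 = (r - 1) (\<Sum>k<n. r\<^sup>k)\<close>, the powers applied to \<open>E\<^sub>0\<close> give \<open>E\<^sub>0 + \<tau> (\<Sum>k<n. r\<^sup>k Q\<^sup>-\<^sup>1 D E\<^sub>0)\<close>, and
  \<open>E\<^sub>0\<close> is controlled by \<open>D E\<^sub>0\<close> through the discrete maximum principle (\<open>D_mat_inverse_bound\<close>). So
  the theorem reduces to one stability estimate (\<open>multiplier_bound_amf\<close>): the operators with symbol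
  \<open>r\<^sup>k Q\<^sup>-\<^sup>1\<close> are bounded in the maximum norm, uniformly in \<open>k\<close>, \<open>\<tau>\<close> and the grid. The smoothing factor
  \<open>Q\<^sup>-\<^sup>1\<close> supplies the decay at high frequencies that the argument below uses.

  For the stability estimate write the symbol as a polynomial in \<open>b\<^sub>j = 1 / (1 + \<lambda>\<^sub>j) \<in> (0, 1)\<close>, namely
  \<open>r(b)\<^sup>k \<Prod>\<^sub>j b\<^sub>j\<close>. Cauchy's formula replaces one variable after the other by a complex number \<open>w\<close> on a
  contour around \<open>(0, 1)\<close>, at the price of one resolvent \<open>(w - B\<^sub>j)\<^sup>-\<^sup>1\<close> of \<open>B\<^sub>j = (I + A\<^sub>j)\<^sup>-\<^sup>1\<close>
  (\<open>multiplier_bound_cauchy\<close>). These resolvents act in one direction only, and a one-dimensional argument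
  bounds them off a sector around the spectrum with constants that do not depend on the mesh. The contour is a thin
  rhombus with corners 0 and 1, dilated by the factor \<open>1 + 1/(k+1)\<close>. On the undilated rhombus both \<open>b\<^sub>j\<close>
  and \<open>1 - b\<^sub>j\<close> are nearly positive, so the inequality \<open>\<bar>r\<bar> \<le> 1\<close> of the real case persists in a
  quantitative form (\<open>norm_stability_symbol\<close>), and the symbol is dominated by a product of one-variable weights
  which are integrable against the resolvent bound along the contour.\<close>

section \<open>The discrete sine transform and its multipliers\<close>

lemma cos_sum_multiples:
  "2 * sin (x / 2) * (\<Sum>p=1..n. cos (real p * x)) = sin ((real n + 1/2) * x) - sin (x / 2)"
proof (induction n)
  case 0
  show ?case by simp
next
  case (Suc n)
  have "2 * sin (x / 2) * cos (real (Suc n) * x)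
      = sin (real (Suc n) * x + x / 2) - sin (real (Suc n) * x - x / 2)"
    by (simp add: sin_add sin_diff)
  also have "\<dots> = sin ((real (Suc n) + 1/2) * x) - sin ((real n + 1/2) * x)"
    by (simp add: algebra_simps add_divide_distrib)
  finally show ?case
    using Suc by (simp add: distrib_left)
qed

text \<open>The only input to the orthogonality of the sine modes: the right-hand side depends on \<open>j\<close> through its
  parity alone, so the sums for \<open>p - q\<close> and \<open>p + q\<close> cancel when \<open>p \<noteq> q\<close>.\<close>

lemma cos_sum_nodes:
  fixes j :: int
  assumes "j \<noteq> 0" and "\<bar>j\<bar> < 2 * (int n + 1)"
  shows "(\<Sum>p=1..n. cos (real p * (pi * j / (real n + 1)))) = - (1 + cos (pi * j)) / 2"
proof -
  define x where "x = pi * j / (real n + 1)"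
  have "\<bar>real_of_int j\<bar> < 2 * (real n + 1)"
    using assms(2) of_int_less_iff[of "\<bar>j\<bar>" "2 * (int n + 1)", where 'a = real] by simp
  then have "\<bar>x / 2\<bar> < pi"
    using mult_strict_left_mono[OF _ pi_gt_zero] by (simp add: x_def abs_mult divide_less_eq)
  moreover have "x \<noteq> 0"
    using assms(1) by (simp add: x_def)
  ultimately have s: "sin (x / 2) \<noteq> 0"
    using sin_eq_0_pi[of "x / 2"] by (auto simp: abs_less_iff)
  have "(real n + 1/2) * x = pi * j - x / 2"
    by (simp add: x_def field_simps)
  moreover have "sin (pi * j) = 0"
    by (simp add: mult.commute sin_integer_2pi sin_npi_int)
  ultimately have "sin ((real n + 1/2) * x) = - cos (pi * j) * sin (x / 2)"
    by (simp only: sin_diff)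
  then have "2 * sin (x / 2) * (\<Sum>p=1..n. cos (real p * x))
      = sin (x / 2) * - (1 + cos (pi * j))"
    unfolding cos_sum_multiples by (simp only: ring_distribs) simp
  then have "sin (x / 2) * (2 * (\<Sum>p=1..n. cos (real p * x))) = sin (x / 2) * - (1 + cos (pi * j))"
    by (simp add: ac_simps)
  then have "2 * (\<Sum>p=1..n. cos (real p * x)) = - (1 + cos (pi * j))"
    using s mult_left_cancel by blast
  then show ?thesis
    by (simp add: x_def)
qed

text \<open>The normalization makes the matrix of modes symmetric and orthogonal, so that the transform below is its own inverse.\<close>

definition sine_mode :: "nat \<Rightarrow> nat \<Rightarrow> nat \<Rightarrow> real" where
  "sine_mode n p k = sqrt (2 / (real n + 1)) * sin (pi * real p * real k / (real n + 1))"

lemma sine_mode_commute: "sine_mode n p k = sine_mode n k p"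
  by (simp add: sine_mode_def ac_simps)

lemma sine_mode_orthonormal:
  assumes "p \<in> {1..n}" and "q \<in> {1..n}"
  shows "(\<Sum>k=1..n. sine_mode n p k * sine_mode n k q) = (if p = q then 1 else 0)"
proof -
  have "sine_mode n p k * sine_mode n k q =
      (cos (real k * (pi * (int p - int q) / (real n + 1)))
       - cos (real k * (pi * (int p + int q) / (real n + 1)))) / (real n + 1)" for k
  proof -
    have "sine_mode n p k * sine_mode n k q = sqrt (2 / (real n + 1)) * sqrt (2 / (real n + 1)) *
        (sin (pi * real p * real k / (real n + 1)) * sin (pi * real q * real k / (real n + 1)))"
      by (simp only: sine_mode_def ac_simps)
    then have eq: "sine_mode n p k * sine_mode n k q = 2 / (real n + 1) *
        (sin (pi * real p * real k / (real n + 1)) * sin (pi * real q * real k / (real n + 1)))"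
      by simp
    have "pi * real p * real k / (real n + 1) - pi * real q * real k / (real n + 1)
        = real k * (pi * (int p - int q) / (real n + 1))"
      and "pi * real p * real k / (real n + 1) + pi * real q * real k / (real n + 1)
        = real k * (pi * (int p + int q) / (real n + 1))"
      by (simp_all add: algebra_simps diff_divide_distrib add_divide_distrib)
    moreover have "2 / c * (x / 2) = x / c" for c x :: real
      by simp
    ultimately show ?thesis
      unfolding eq sin_times_sin by (simp only:)
  qed
  then have eq: "(\<Sum>k=1..n. sine_mode n p k * sine_mode n k q) =
      ((\<Sum>k=1..n. cos (real k * (pi * (int p - int q) / (real n + 1))))
       - (\<Sum>k=1..n. cos (real k * (pi * (int p + int q) / (real n + 1))))) / (real n + 1)"
    by (simp only: sum_divide_distrib[symmetric] sum_subtractf)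
  have plus: "(\<Sum>k=1..n. cos (real k * (pi * (int p + int q) / (real n + 1))))
      = - (1 + cos (pi * (int p + int q))) / 2"
    using cos_sum_nodes[of "int p + int q" n] assms by simp
  show ?thesis
  proof (cases "p = q")
    case True
    have "cos (pi * (int p + int q)) = 1"
      using True cos_int_2pin[of "int p"] by (simp add: ac_simps flip: mult_2)
    then show ?thesis
      unfolding eq plus using True by simp
  next
    case False
    have "pi * (int p + int q) = pi * (int p - int q) + 2 * pi * int q"
      by (simp add: algebra_simps)
    then have "cos (pi * (int p + int q)) = cos (pi * (int p - int q))"
      using sin_cos_eq_iff cos_int_2pin[of "int q"] sin_int_2pin[of "int q"] by (simp add: cos_add)
    moreover have "(\<Sum>k=1..n. cos (real k * (pi * (int p - int q) / (real n + 1))))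
      = - (1 + cos (pi * (int p - int q))) / 2"
      by (rule cos_sum_nodes) (use assms False in auto)
    ultimately show ?thesis
      unfolding eq plus using False by simp
  qed
qed

lemma L_mat_apply:
  assumes "k \<in> {1..N j}"
  shows "(\<Sum>l=1..N j. L_mat N j k l * f l) =
    ((if k < N j then f (k + 1) else 0) + (if 1 < k then f (k - 1) else 0) - 2 * f k) / (dx N j)\<^sup>2"
proof -
  have "(\<Sum>l=1..N j. L_mat N j k l * f l) = (\<Sum>l=1..N j.
      (if l = k + 1 then f l else 0) / (dx N j)\<^sup>2 + (if l = k - 1 then f l else 0) / (dx N j)\<^sup>2
      - (if l = k then 2 * f l else 0) / (dx N j)\<^sup>2)"
    by (rule sum.cong) (use assms in \<open>auto simp: L_mat_def\<close>)
  also have "\<dots> = ((\<Sum>l=1..N j. if l = k + 1 then f l else 0) + (\<Sum>l=1..N j. if l = k - 1 then f l else 0)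
      - (\<Sum>l=1..N j. if l = k then 2 * f l else 0)) / (dx N j)\<^sup>2"
    unfolding sum.distrib sum_subtractf add_divide_distrib diff_divide_distrib sum_divide_distrib ..
  also have "\<dots> = ((if k < N j then f (k + 1) else 0) + (if 1 < k then f (k - 1) else 0) - 2 * f k) / (dx N j)\<^sup>2"
    using assms by (auto simp: sum.delta Suc_le_eq simp flip: One_nat_def)
  finally show ?thesis .
qed

definition dirichlet_eig :: "(nat \<Rightarrow> nat) \<Rightarrow> nat \<Rightarrow> nat \<Rightarrow> real" where
  "dirichlet_eig N j p = 2 * (1 - cos (pi * real p / (real (N j) + 1))) / (dx N j)\<^sup>2"

text \<open>A sine mode vanishes at the nodes \<open>0\<close> and \<open>N j + 1\<close>. Hence the truncated first and last row of the matrix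
  act on it like the full three-term stencil, and the addition theorem gives the eigenvalue.\<close>

lemma L_mat_sine_mode:
  assumes "k \<in> {1..N j}"
  shows "(\<Sum>l=1..N j. L_mat N j k l * sine_mode (N j) p l) = - dirichlet_eig N j p * sine_mode (N j) p k"
proof -
  define \<theta> where "\<theta> = pi * real p / (real (N j) + 1)"
  define s where "s x = sqrt (2 / (real (N j) + 1)) * sin (\<theta> * x)" for x
  have mode: "sine_mode (N j) p l = s (real l)" for l
    by (simp add: sine_mode_def s_def \<theta>_def ac_simps)
  have up: "(if k < N j then s (real (k + 1)) else 0) = s (real k + 1)"
  proof (cases "k < N j")
    case False
    then have "real k + 1 = real (N j) + 1"
      using assms by simp
    then have "\<theta> * (real k + 1) = real p * pi"
      by (simp add: \<theta>_def ac_simps)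
    then show ?thesis
      using False by (simp add: s_def)
  qed (simp add: algebra_simps)
  have down: "(if 1 < k then s (real (k - 1)) else 0) = s (real k - 1)"
  proof (cases "1 < k")
    case False
    then have "real k = 1"
      using assms by simp
    then show ?thesis
      using False by (simp add: s_def)
  qed (simp add: of_nat_diff)
  have "s (real k + 1) + s (real k - 1) - 2 * s (real k) = - 2 * (1 - cos \<theta>) * s (real k)"
    by (simp add: s_def algebra_simps sin_add sin_diff)
  then show ?thesis
    unfolding mode L_mat_apply[where j = j and N = N and k = k, OF assms] up down dirichlet_eig_def \<theta>_def[symmetric]
    by (simp add: divide_inverse algebra_simps)
qed

definition mode :: "nat \<Rightarrow> (nat \<Rightarrow> nat) \<Rightarrow> (nat \<Rightarrow> nat) \<Rightarrow> (nat \<Rightarrow> nat) \<Rightarrow> real" where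
  "mode m N p k = (\<Prod>j=1..m. sine_mode (N j) (p j) (k j))"

lemma finite_mindices [simp]: "finite (mindices m N)"
  by (simp add: mindices_def finite_PiE)

lemma mindices_component: "k \<in> mindices m N \<Longrightarrow> j \<in> {1..m} \<Longrightarrow> k j \<in> {1..N j}"
  by (auto simp: mindices_def)

lemma mindices_eq_iff:
  assumes "k \<in> mindices m N" and "l \<in> mindices m N"
  shows "k = l \<longleftrightarrow> (\<forall>j\<in>{1..m}. k j = l j)"
  using assms PiE_ext unfolding mindices_def by blast

lemma sum_mindices_prod:
  fixes f :: "nat \<Rightarrow> nat \<Rightarrow> real"
  shows "(\<Sum>l\<in>mindices m N. \<Prod>j=1..m. f j (l j)) = (\<Prod>j=1..m. \<Sum>l=1..N j. f j l)"
  unfolding mindices_def by (rule prod_sum_PiE[symmetric]) auto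

lemma mode_commute: "mode m N p k = mode m N k p"
  unfolding mode_def by (intro prod.cong refl sine_mode_commute)

lemma mode_orthonormal:
  assumes "p \<in> mindices m N" and "q \<in> mindices m N"
  shows "(\<Sum>k\<in>mindices m N. mode m N p k * mode m N k q) = (if p = q then 1 else 0)"
proof -
  have "(\<Sum>k\<in>mindices m N. mode m N p k * mode m N k q) =
      (\<Prod>j=1..m. \<Sum>k=1..N j. sine_mode (N j) (p j) k * sine_mode (N j) k (q j))"
    unfolding mode_def prod.distrib[symmetric] by (rule sum_mindices_prod)
  also have "\<dots> = (\<Prod>j=1..m. if p j = q j then 1 else 0)"
    by (intro prod.cong refl sine_mode_orthonormal) (use assms mindices_component in blast)+
  also have "\<dots> = (if p = q then 1 else 0)"
    using mindices_eq_iff[OF assms] by (auto intro!: prod.neutral)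
  finally show ?thesis .
qed

text \<open>On functions that factorize over the directions, the Kronecker product acts factor by factor.\<close>

lemma D_dir_prod:
  assumes "j \<in> {1..m}"
  shows "(\<Sum>l\<in>mindices m N. D_dir m \<beta> N j k l * (\<Prod>i=1..m. f i (l i))) =
    \<beta> j * (\<Prod>i=1..m. if i = j then (\<Sum>l=1..N j. L_mat N j (k j) l * f j l)
                  else (\<Sum>l=1..N i. id_mat (k i) l * f i l))"
proof -
  have "(\<Sum>l\<in>mindices m N. D_dir m \<beta> N j k l * (\<Prod>i=1..m. f i (l i))) =
     \<beta> j * (\<Sum>l\<in>mindices m N. \<Prod>i=1..m. (if i = j then L_mat N j else id_mat) (k i) (l i) * f i (l i))"
    by (simp add: D_dir_def kronecker_def sum_distrib_left prod.distrib mult.assoc)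
  also have "\<dots> = \<beta> j * (\<Prod>i=1..m. \<Sum>l=1..N i. (if i = j then L_mat N j else id_mat) (k i) l * f i l)"
    by (rule arg_cong[OF sum_mindices_prod])
  also have "\<dots> = \<beta> j * (\<Prod>i=1..m. if i = j then (\<Sum>l=1..N j. L_mat N j (k j) l * f j l)
                  else (\<Sum>l=1..N i. id_mat (k i) l * f i l))"
    by (intro arg_cong[of _ _ "(*) (\<beta> j)"] prod.cong) auto
  finally show ?thesis .
qed

lemma id_mat_apply: "(k::nat) \<in> {1..n} \<Longrightarrow> (\<Sum>l=1..n. id_mat k l * f l) = (f k :: real)"
  by (simp add: id_mat_def if_distrib[of "\<lambda>x. x * _"] sum.delta cong: if_cong)

lemma D_dir_mode:
  assumes "j \<in> {1..m}" and "k \<in> mindices m N"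
  shows "(\<Sum>l\<in>mindices m N. D_dir m \<beta> N j k l * mode m N p l) =
    - \<beta> j * dirichlet_eig N j (p j) * mode m N p k"
proof -
  have "(if i = j then \<Sum>l=1..N j. L_mat N j (k j) l * sine_mode (N j) (p j) l
        else \<Sum>l=1..N i. id_mat (k i) l * sine_mode (N i) (p i) l)
      = (if i = j then - dirichlet_eig N j (p j) else 1) * sine_mode (N i) (p i) (k i)"
    if "i \<in> {1..m}" for i
    using mindices_component[OF assms(2) that] by (cases "i = j") (simp_all only: L_mat_sine_mode id_mat_apply if_True if_False simp_thms mult_1)
  then have "(\<Sum>l\<in>mindices m N. D_dir m \<beta> N j k l * mode m N p l) =
     \<beta> j * (\<Prod>i=1..m. (if i = j then - dirichlet_eig N j (p j) else 1) * sine_mode (N i) (p i) (k i))"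
    unfolding mode_def D_dir_prod[OF assms(1), where f = "\<lambda>i. sine_mode (N i) (p i)"]
    by (intro arg_cong[of _ _ "(*) (\<beta> j)"] prod.cong refl)
  also have "\<dots> = - \<beta> j * dirichlet_eig N j (p j) * mode m N p k"
    using assms(1) by (simp add: prod.distrib mode_def)
  finally show ?thesis .
qed

lemma D_dir_symmetric: "D_dir m \<beta> N j k l = D_dir m \<beta> N j l k"
  unfolding D_dir_def kronecker_def
  by (intro arg_cong[of _ _ "(*) (\<beta> j)"] prod.cong) (auto simp: L_mat_def id_mat_def)

definition dst :: "nat \<Rightarrow> (nat \<Rightarrow> nat) \<Rightarrow> ((nat \<Rightarrow> nat) \<Rightarrow> complex) \<Rightarrow> (nat \<Rightarrow> nat) \<Rightarrow> complex" where
  "dst m N v p = (\<Sum>k\<in>mindices m N. of_real (mode m N p k) * v k)"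

lemma dst_cong: "(\<And>k. k \<in> mindices m N \<Longrightarrow> v k = w k) \<Longrightarrow> dst m N v p = dst m N w p"
  by (simp add: dst_def)

lemma dst_add: "dst m N (\<lambda>k. v k + w k) p = dst m N v p + dst m N w p"
  by (simp add: dst_def distrib_left sum.distrib)

lemma dst_diff: "dst m N (\<lambda>k. v k - w k) p = dst m N v p - dst m N w p"
  by (simp add: dst_def right_diff_distrib sum_subtractf)

lemma dst_scale: "dst m N (\<lambda>k. c * v k) p = c * dst m N v p"
  by (simp add: dst_def sum_distrib_left ac_simps)

lemma dst_sum: "dst m N (\<lambda>k. \<Sum>i\<in>I. v i k) p = (\<Sum>i\<in>I. dst m N (v i) p)"
  unfolding dst_def sum_distrib_left by (rule sum.swap)

lemma dst_dst:
  assumes "k \<in> mindices m N"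
  shows "dst m N (dst m N v) k = v k"
proof -
  have "dst m N (dst m N v) k =
      (\<Sum>p\<in>mindices m N. \<Sum>l\<in>mindices m N. of_real (mode m N k p * mode m N p l) * v l)"
    by (simp add: dst_def sum_distrib_left mult.assoc)
  also have "\<dots> = (\<Sum>l\<in>mindices m N. of_real (\<Sum>p\<in>mindices m N. mode m N k p * mode m N p l) * v l)"
    by (subst sum.swap) (simp add: sum_distrib_right)
  also have "\<dots> = (\<Sum>l\<in>mindices m N. if k = l then v l else 0)"
    by (rule sum.cong) (auto simp: mode_orthonormal assms)
  finally show ?thesis
    using assms by simp
qed

lemma dst_D_dir:
  assumes "j \<in> {1..m}" and "p \<in> mindices m N"
  shows "dst m N (\<lambda>k. of_real (mat_vec m N (D_dir m \<beta> N j) v k)) p =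
    - of_real (\<beta> j * dirichlet_eig N j (p j)) * dst m N (\<lambda>k. of_real (v k)) p"
proof -
  have "(\<Sum>k\<in>mindices m N. mode m N p k * mat_vec m N (D_dir m \<beta> N j) v k) =
      (\<Sum>l\<in>mindices m N. (\<Sum>k\<in>mindices m N. D_dir m \<beta> N j l k * mode m N p k) * v l)"
    unfolding mat_vec_def sum_distrib_left sum_distrib_right
    by (subst sum.swap) (simp add: D_dir_symmetric[of m \<beta> N j] ac_simps)
  also have "\<dots> = - \<beta> j * dirichlet_eig N j (p j) * (\<Sum>l\<in>mindices m N. mode m N p l * v l)"
    by (simp only: D_dir_mode[OF assms(1)] sum_distrib_left mult.assoc cong: sum.cong)
  finally have "complex_of_real (\<Sum>k\<in>mindices m N. mode m N p k * mat_vec m N (D_dir m \<beta> N j) v k) =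
      of_real (- \<beta> j * dirichlet_eig N j (p j) * (\<Sum>l\<in>mindices m N. mode m N p l * v l))"
    by (rule arg_cong)
  then show ?thesis
    by (simp add: dst_def)
qed

text \<open>The operator norm, with respect to the maximum norm, of the operator that multiplies the mode \<open>p\<close> by
  \<open>f p\<close> is at most \<open>M\<close>. Every function of the commuting matrices \<open>D_dir\<close> is of this kind, and
  composition of operators becomes pointwise multiplication of symbols.\<close>

definition multiplier_bound ::
  "nat \<Rightarrow> (nat \<Rightarrow> nat) \<Rightarrow> ((nat \<Rightarrow> nat) \<Rightarrow> complex) \<Rightarrow> real \<Rightarrow> bool" where
  "multiplier_bound m N f M \<longleftrightarrow> (\<forall>d \<delta>. (\<forall>k\<in>mindices m N. cmod (d k) \<le> \<delta>) \<longrightarrow>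
     (\<forall>k\<in>mindices m N. cmod (dst m N (\<lambda>p. f p * dst m N d p) k) \<le> M * \<delta>))"

lemma multiplier_bound_cong:
  assumes "\<And>p. p \<in> mindices m N \<Longrightarrow> f p = g p"
  shows "multiplier_bound m N f M \<longleftrightarrow> multiplier_bound m N g M"
  unfolding multiplier_bound_def using assms by (simp cong: dst_cong)

lemma multiplier_bound_const: "multiplier_bound m N (\<lambda>p. c) (cmod c)"
  by (auto simp: multiplier_bound_def dst_scale dst_dst norm_mult mult_left_mono)

lemma multiplier_bound_add:
  assumes "multiplier_bound m N f M" and "multiplier_bound m N g L"
  shows "multiplier_bound m N (\<lambda>p. f p + g p) (M + L)"
  unfolding multiplier_bound_def
proof (intro allI impI ballI)
  fix d \<delta> k assume "\<forall>k\<in>mindices m N. cmod (d k) \<le> \<delta>" and "k \<in> mindices m N"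
  then have "cmod (dst m N (\<lambda>p. f p * dst m N d p) k) \<le> M * \<delta>"
    and "cmod (dst m N (\<lambda>p. g p * dst m N d p) k) \<le> L * \<delta>"
    using assms unfolding multiplier_bound_def by blast+
  then show "cmod (dst m N (\<lambda>p. (f p + g p) * dst m N d p) k) \<le> (M + L) * \<delta>"
    by (simp add: distrib_right dst_add norm_triangle_le)
qed

lemma multiplier_bound_mult:
  assumes "multiplier_bound m N f M" and "multiplier_bound m N g L"
  shows "multiplier_bound m N (\<lambda>p. f p * g p) (M * L)"
  unfolding multiplier_bound_def
proof (intro allI impI ballI)
  fix d \<delta> k assume d: "\<forall>k\<in>mindices m N. cmod (d k) \<le> \<delta>" and k: "k \<in> mindices m N"
  let ?w = "dst m N (\<lambda>p. g p * dst m N d p)"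
  have "\<forall>k\<in>mindices m N. cmod (?w k) \<le> L * \<delta>"
    using assms(2) d unfolding multiplier_bound_def by blast
  then have "cmod (dst m N (\<lambda>p. f p * dst m N ?w p) k) \<le> M * (L * \<delta>)"
    using assms(1) k unfolding multiplier_bound_def by blast
  then show "cmod (dst m N (\<lambda>p. f p * g p * dst m N d p) k) \<le> M * L * \<delta>"
    by (simp add: dst_dst mult.assoc cong: dst_cong)
qed

lemma multiplier_bound_mono:
  assumes "multiplier_bound m N f M" and "M \<le> L"
  shows "multiplier_bound m N f L"
  unfolding multiplier_bound_def
proof (intro allI impI ballI)
  fix d \<delta> k assume d: "\<forall>k\<in>mindices m N. cmod (d k) \<le> \<delta>" and k: "k \<in> mindices m N"
  have "0 \<le> \<delta>"
    using d k norm_ge_zero order_trans by blast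
  then have "M * \<delta> \<le> L * \<delta>"
    using assms(2) by (simp add: mult_right_mono)
  then show "cmod (dst m N (\<lambda>p. f p * dst m N d p) k) \<le> L * \<delta>"
    using assms(1) d k unfolding multiplier_bound_def by (meson order_trans)
qed

section \<open>Resolvents of the one-dimensional difference operator\<close>

text \<open>The condition \<open>Re Z \<le> \<kappa> * cmod Z\<close> says that \<open>Z\<close> lies outside the open sector around the positive
  half-line whose half-angle has cosine \<open>\<kappa>\<close>. Moving such a point to the left keeps it outside; by
  \<open>norm_diff_sector\<close>, the new modulus is comparable to the sum of the old one and the shift, because nothing cancels.
  Inversion preserves the condition, too. All geometric claims about resolvent points are combinations of these facts.\<close>

lemma shift_left_sector:
  fixes Z :: complex
  assumes "Re Z \<le> \<kappa> * cmod Z" and "0 \<le> x" and "0 \<le> \<kappa>" and "\<kappa> \<le> 1"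
  shows "Re (Z - of_real x) \<le> \<kappa> * cmod (Z - of_real x)"
proof (cases "Re Z \<le> x")
  case True
  then show ?thesis
    using assms(3) by (smt (verit) Re_complex_of_real minus_complex.simps(1) mult_nonneg_nonneg norm_ge_zero)
next
  case False
  have "(Re Z)\<^sup>2 \<le> (\<kappa> * cmod Z)\<^sup>2"
    using assms False by (intro power_mono) auto
  then have "(1 - \<kappa>\<^sup>2) * (Re Z)\<^sup>2 \<le> \<kappa>\<^sup>2 * (Im Z)\<^sup>2"
    by (simp add: power_mult_distrib cmod_power2 algebra_simps)
  moreover have "(1 - \<kappa>\<^sup>2) * (Re Z - x)\<^sup>2 \<le> (1 - \<kappa>\<^sup>2) * (Re Z)\<^sup>2"
    using assms False by (intro mult_left_mono power_mono) (auto simp: power_le_one)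
  ultimately have "(Re Z - x)\<^sup>2 \<le> (\<kappa> * cmod (Z - of_real x))\<^sup>2"
    by (simp add: power_mult_distrib cmod_power2 algebra_simps)
  then have "Re Z - x \<le> \<kappa> * cmod (Z - of_real x)"
    by (rule power2_le_imp_le) (use assms(3) in simp)
  then show ?thesis
    by simp
qed

lemma norm_diff_sector:
  fixes Z :: complex
  assumes "Re Z \<le> \<kappa> * cmod Z" and "0 \<le> x" and "0 \<le> \<kappa>" and "\<kappa> < 1"
  shows "(1 - \<kappa>) / 2 * (cmod Z + x) \<le> cmod (Z - of_real x)"
proof -
  have "(cmod (Z - of_real x))\<^sup>2 = (cmod Z)\<^sup>2 - 2 * x * Re Z + x\<^sup>2"
    by (simp only: cmod_power2) (simp add: power2_eq_square algebra_simps)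
  moreover have "x * Re Z \<le> x * (\<kappa> * cmod Z)"
    using assms by (intro mult_left_mono) auto
  ultimately have "(cmod (Z - of_real x))\<^sup>2 \<ge> (cmod Z)\<^sup>2 - 2 * \<kappa> * (x * cmod Z) + x\<^sup>2"
    by (simp add: algebra_simps)
  moreover have "0 \<le> (cmod Z - x)\<^sup>2 * ((1 + \<kappa>) / 2)"
    using assms by simp
  moreover have "(1 - \<kappa>) / 2 * (cmod Z + x)\<^sup>2 =
      (cmod Z)\<^sup>2 - 2 * \<kappa> * (x * cmod Z) + x\<^sup>2 - (cmod Z - x)\<^sup>2 * ((1 + \<kappa>) / 2)"
    by (simp add: power2_eq_square field_simps)
  ultimately have "(1 - \<kappa>) / 2 * (cmod Z + x)\<^sup>2 \<le> (cmod (Z - of_real x))\<^sup>2"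
    by linarith
  moreover have "((1 - \<kappa>) / 2)\<^sup>2 \<le> (1 - \<kappa>) / 2"
    using assms unfolding power2_eq_square by (intro mult_left_le) auto
  then have "((1 - \<kappa>) / 2)\<^sup>2 * (cmod Z + x)\<^sup>2 \<le> (1 - \<kappa>) / 2 * (cmod Z + x)\<^sup>2"
    by (rule mult_right_mono) simp
  ultimately have "((1 - \<kappa>) / 2 * (cmod Z + x))\<^sup>2 \<le> (cmod (Z - of_real x))\<^sup>2"
    unfolding power_mult_distrib by linarith
  then show ?thesis
    by (rule power2_le_imp_le) simp
qed

lemma sector_inverse:
  "Re (1 / z) \<le> \<kappa> * cmod (1 / z) \<longleftrightarrow> Re z \<le> \<kappa> * cmod z"
proof (cases "z = 0")
  case False
  have "Re (1 / z) = Re z / (cmod z)\<^sup>2"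
    by (simp add: Re_divide cmod_power2)
  moreover have "\<kappa> * cmod (1 / z) = \<kappa> * cmod z / (cmod z)\<^sup>2"
    using False by (simp add: norm_divide power2_eq_square)
  ultimately show ?thesis
    using False by (simp only:) (simp add: divide_le_cancel)
qed simp

definition resolvent_const :: "real \<Rightarrow> real" where
  "resolvent_const \<kappa> = (8 / (1 - \<kappa>)\<^sup>2)\<^sup>2"

text \<open>The roots of the three-term recursion satisfy \<open>(1 - q)\<^sup>2 = 2 q \<zeta>\<close>. With the Cayley transform
  \<open>q = (1 - t) / (1 + t)\<close> this reads \<open>t\<^sup>2 = \<zeta> / (\<zeta> + 2)\<close>, and for the principal root \<open>t\<close>, the disc
  \<open>cmod q < 1\<close> corresponds to \<open>Re t > 0\<close>. Since \<open>\<zeta>\<close> avoids a sector around the negative half-line, so does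
  \<open>t\<^sup>2\<close>; hence \<open>t\<close> stays away from the imaginary axis, and \<open>1 - cmod q\<close> is comparable to
  \<open>cmod (1 - q)\<close>.\<close>

lemma characteristic_root:
  fixes \<zeta> :: complex
  assumes "\<zeta> \<noteq> 0" and "- Re \<zeta> \<le> \<kappa> * cmod \<zeta>" and "0 \<le> \<kappa>" and "\<kappa> < 1"
  obtains q where "cmod q < 1" and "2 * q * \<zeta> = (1 - q)\<^sup>2"
    and "(cmod (1 - q))\<^sup>2 \<le> resolvent_const \<kappa> * (1 - cmod q)\<^sup>2" and "q \<noteq> 0"
proof -
  \<comment> \<open>The number Z - 1 is the negative reciprocal of t squared, so the sector lemmas apply to it.\<close>
  define Z where "Z = - 2 / \<zeta>"
  have "Re (1 / Z) \<le> \<kappa> * cmod (1 / Z)"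
    using assms(2) by (simp add: Z_def)
  then have Z: "Re Z \<le> \<kappa> * cmod Z"
    using sector_inverse by blast
  have "Re (Z - 1) \<le> \<kappa> * cmod (Z - 1)"
    using shift_left_sector[OF Z, of 1] assms by simp
  moreover have far: "(1 - \<kappa>) / 2 * (cmod Z + 1) \<le> cmod (Z - 1)"
    using norm_diff_sector[OF Z, of 1] assms by simp
  define \<tau> where "\<tau> = 1 / (1 - Z)"
  have "0 < (1 - \<kappa>) / 2 * (cmod Z + 1)"
    using assms by (intro mult_pos_pos add_nonneg_pos) auto
  then have Z1: "Z \<noteq> 1"
    using far by auto
  have "1 / \<tau> = - (Z - 1)"
    by (simp add: \<tau>_def)
  ultimately have "Re (1 / - \<tau>) \<le> \<kappa> * cmod (1 / - \<tau>)"
    by (simp add: norm_minus_commute)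
  then have \<tau>: "- Re \<tau> \<le> \<kappa> * cmod \<tau>"
    using sector_inverse[of "- \<tau>" \<kappa>] by simp
  define t where "t = csqrt \<tau>"
  have t2: "t\<^sup>2 = \<tau>"
    by (simp add: t_def)
  have "\<tau> \<noteq> 0"
    using Z1 by (simp add: \<tau>_def)
  then have t0: "0 < cmod t"
    by (simp add: t_def)
  define c where "c = (1 - \<kappa>) / 2"
  have c: "0 < c" "c \<le> 1"
    using assms by (auto simp: c_def)
  have "c * 1 \<le> c * (cmod Z + 1)"
    using c by (intro mult_left_mono) auto
  then have "c \<le> cmod (Z - 1)"
    using far by (simp add: c_def)
  then have "cmod \<tau> \<le> 1 / c"
    using c Z1 by (simp add: \<tau>_def norm_divide norm_minus_commute field_simps)
  moreover have "1 / c \<le> (1 / c)\<^sup>2"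
    using c by (simp add: power2_eq_square field_simps)
  ultimately have "(cmod t)\<^sup>2 \<le> (1 / c)\<^sup>2"
    by (simp add: norm_power[symmetric] t2)
  then have tc: "cmod t \<le> 1 / c"
    by (rule power2_le_imp_le) (use c in simp)
  have "(cmod t)\<^sup>2 = (Re t)\<^sup>2 + (Im t)\<^sup>2" and "Re \<tau> = (Re t)\<^sup>2 - (Im t)\<^sup>2"
    by (simp_all add: cmod_power2 flip: t2) (simp add: power2_eq_square)
  moreover have "cmod \<tau> = (cmod t)\<^sup>2"
    by (simp add: norm_power[symmetric] t2)
  ultimately have "(1 - \<kappa>) * (cmod t)\<^sup>2 \<le> 2 * (Re t)\<^sup>2"
    using \<tau> by (simp add: algebra_simps)
  then have "c * (cmod t)\<^sup>2 \<le> (Re t)\<^sup>2"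
    by (simp add: c_def)
  moreover have "c\<^sup>2 * (cmod t)\<^sup>2 \<le> c * (cmod t)\<^sup>2"
    using c by (intro mult_right_mono) (auto simp: power2_eq_square mult_left_le)
  ultimately have "(c * cmod t)\<^sup>2 \<le> (Re t)\<^sup>2"
    by (simp add: power_mult_distrib)
  then have Ret: "c * cmod t \<le> Re t"
    by (rule power2_le_imp_le) (simp only: t_def Re_csqrt)
  then have pos: "0 < Re t"
    using mult_pos_pos[OF c(1) t0] by linarith
  define q where "q = (1 - t) / (1 + t)"
  have t1: "1 + t \<noteq> 0"
    using pos by (auto simp: complex_eq_iff)
  have n1: "0 < cmod (1 + t)"
    using t1 by simp
  have diff: "(cmod (1 + t))\<^sup>2 - (cmod (1 - t))\<^sup>2 = 4 * Re t"
    unfolding cmod_power2 by (simp add: power2_eq_square algebra_simps)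
  then have "(cmod (1 - t))\<^sup>2 < (cmod (1 + t))\<^sup>2"
    using pos by linarith
  then have lt: "cmod (1 - t) < cmod (1 + t)"
    by (rule power2_less_imp_less) simp
  then have q1: "cmod q < 1"
    using n1 by (simp add: q_def norm_divide)
  have q': "1 - q = 2 * t / (1 + t)"
    using t1 by (simp add: q_def field_simps)
  have "\<zeta> + 2 \<noteq> 0"
    using assms(1) Z1 by (auto simp: Z_def add_eq_0_iff2)
  then have "t\<^sup>2 * (\<zeta> + 2) = \<zeta>"
    using assms(1) Z1 unfolding t2 \<tau>_def Z_def by (simp add: divide_simps)
  then have "\<zeta> - t\<^sup>2 * \<zeta> = t\<^sup>2 * 2"
    by (metis add_diff_cancel_left' distrib_left)
  moreover have "2 * (1 - t) * (1 + t) * \<zeta> = 2 * (\<zeta> - t\<^sup>2 * \<zeta>)"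
    by (simp add: power2_eq_square algebra_simps)
  ultimately have "2 * (1 - t) * (1 + t) * \<zeta> = (2 * t)\<^sup>2"
    by (simp only:) (simp add: power2_eq_square)
  moreover have "2 * ((1 - t) / (1 + t)) * \<zeta> = 2 * (1 - t) * (1 + t) * \<zeta> / (1 + t)\<^sup>2"
    using t1 by (simp add: power2_eq_square)
  ultimately have "2 * ((1 - t) / (1 + t)) * \<zeta> = (2 * t)\<^sup>2 / (1 + t)\<^sup>2"
    by (simp only:)
  then have "2 * q * \<zeta> = (2 * t / (1 + t))\<^sup>2"
    by (simp add: q_def power_divide)
  then have eq: "2 * q * \<zeta> = (1 - q)\<^sup>2"
    by (simp only: q')
  have "(4 * Re t) \<le> (cmod (1 + t) - cmod (1 - t)) * (2 * cmod (1 + t))"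
    using mult_left_mono[of "cmod (1 + t) + cmod (1 - t)" "2 * cmod (1 + t)" "cmod (1 + t) - cmod (1 - t)"] lt diff
    by (simp add: power2_eq_square algebra_simps)
  moreover have "(1 - cmod q) * (cmod (1 + t))\<^sup>2 = (cmod (1 + t) - cmod (1 - t)) * cmod (1 + t)"
    using n1 by (simp add: q_def norm_divide power2_eq_square left_diff_distrib)
  ultimately have "2 * (c * cmod t) \<le> (1 - cmod q) * (cmod (1 + t))\<^sup>2"
    using Ret by linarith
  then have "2 * (c * cmod t) / cmod (1 + t) \<le> (1 - cmod q) * cmod (1 + t)"
    using n1 by (simp only: pos_divide_le_eq power2_eq_square mult.assoc)
  moreover have "cmod (1 - q) = 2 * cmod t / cmod (1 + t)"
    using q' by (simp add: norm_divide norm_mult)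
  then have "2 * (c * cmod t) / cmod (1 + t) = c * cmod (1 - q)"
    by simp
  moreover have "1 \<le> 1 / c"
    using c by simp
  then have "cmod (1 + t) \<le> 2 / c"
    using norm_triangle_ineq[of 1 t] tc by simp
  then have "(1 - cmod q) * cmod (1 + t) \<le> (1 - cmod q) * (2 / c)"
    using q1 by (intro mult_left_mono) auto
  moreover have "(1 - cmod q) * (2 / c) = c * (2 / c\<^sup>2 * (1 - cmod q))"
    using c by (simp add: power2_eq_square)
  ultimately have "c * cmod (1 - q) \<le> c * (2 / c\<^sup>2 * (1 - cmod q))"
    by linarith
  then have "cmod (1 - q) \<le> 2 / c\<^sup>2 * (1 - cmod q)"
    using c(1) by (rule mult_left_le_imp_le)
  then have "(cmod (1 - q))\<^sup>2 \<le> (2 / c\<^sup>2 * (1 - cmod q))\<^sup>2"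
    by (intro power_mono) auto
  moreover have "(2 / c\<^sup>2)\<^sup>2 = resolvent_const \<kappa>"
    by (simp add: c_def resolvent_const_def power_divide)
  ultimately have "(cmod (1 - q))\<^sup>2 \<le> resolvent_const \<kappa> * (1 - cmod q)\<^sup>2"
    by (simp only: power_mult_distrib)
  moreover have "q \<noteq> 0"
  proof
    assume "q = 0"
    then show False
      using eq by simp
  qed
  ultimately show ?thesis
    using that q1 eq by metis
qed

text \<open>On the whole line a bounded solution needs no boundary values: the supremum satisfies \<open>S \<le> \<delta> + cmod q * S\<close>.\<close>

lemma bounded_one_sided_recursion:
  fixes Y :: "int \<Rightarrow> complex" and s :: int
  assumes "bounded (range Y)" and "\<And>n. cmod (Y n - q * Y (n + s)) \<le> \<delta>" and "cmod q < 1"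
  shows "cmod (Y n) \<le> \<delta> / (1 - cmod q)"
proof -
  define S where "S = (SUP n. cmod (Y n))"
  have bdd: "bdd_above (range (\<lambda>n. cmod (Y n)))"
    using assms(1) by (auto simp: bounded_iff bdd_above_def)
  have le: "cmod (Y n) \<le> S" for n
    unfolding S_def by (rule cSUP_upper[OF _ bdd]) simp
  have "cmod (Y n) \<le> \<delta> + cmod q * S" for n
  proof -
    have "cmod (Y n) \<le> cmod (Y n - q * Y (n + s)) + cmod (q * Y (n + s))"
      by (metis diff_add_cancel norm_triangle_ineq)
    also have "\<dots> \<le> \<delta> + cmod q * S"
      using assms(2) le[of "n + s"] by (intro add_mono) (auto simp: norm_mult mult_left_mono)
    finally show ?thesis .
  qed
  then have "S \<le> \<delta> + cmod q * S"
    unfolding S_def by (intro cSUP_least) auto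
  then have "S \<le> \<delta> / (1 - cmod q)"
    using assms(3) by (simp add: field_simps)
  then show ?thesis
    using le order_trans by blast
qed

text \<open>The second-order recursion factors into two first-order ones, \<open>y n = Y n - q * Y (n + 1)\<close> and
  \<open>y n - q * y (n - 1)\<close>, to which the one-sided estimate applies in opposite directions. This loses
  \<open>(1 - cmod q)\<^sup>-\<^sup>2\<close>, which by the choice of \<open>q\<close> is exactly what the factor \<open>1 / cmod z\<close> allows.\<close>

lemma three_term_recursion_bound:
  fixes Y :: "int \<Rightarrow> complex"
  assumes "bounded (range Y)" and "0 < a" and "z \<noteq> 0"
    and "Re z \<le> \<kappa> * cmod z" and "0 \<le> \<kappa>" and "\<kappa> < 1"
    and F: "\<And>n. cmod ((of_real a - z) * Y n - of_real (a / 2) * (Y (n - 1) + Y (n + 1))) \<le> \<delta>"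
  shows "cmod (Y n) \<le> resolvent_const \<kappa> / cmod z * \<delta>"
proof -
  define \<zeta> where "\<zeta> = - z / of_real a"
  have "Re z / a \<le> \<kappa> * cmod z / a"
    using assms(2,4) by (rule divide_right_mono[rotated, OF less_imp_le])
  then have "\<zeta> \<noteq> 0" and "- Re \<zeta> \<le> \<kappa> * cmod \<zeta>"
    using assms(2,3) by (simp_all add: \<zeta>_def norm_divide)
  then obtain q where q: "cmod q < 1" "2 * q * \<zeta> = (1 - q)\<^sup>2"
    "(cmod (1 - q))\<^sup>2 \<le> resolvent_const \<kappa> * (1 - cmod q)\<^sup>2" "q \<noteq> 0"
    using characteristic_root assms(5,6) by blast
  have z: "z = - of_real a * \<zeta>"
    using assms(2) by (simp add: \<zeta>_def)
  \<comment> \<open>The choice of q turns the three-term operator into a product of two first-order ones.\<close>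
  define y where "y n = Y n - q * Y (n + 1)" for n
  have step: "cmod (y n - q * y (n + (-1))) \<le> 2 * cmod q / a * \<delta>" for n
  proof -
    have "y n - q * y (n + (-1)) = (1 + q\<^sup>2) * Y n - q * (Y (n - 1) + Y (n + 1))"
      by (simp add: y_def algebra_simps power2_eq_square)
    also have "1 + q\<^sup>2 = 2 * q * (1 + \<zeta>)"
      using q(2) by (simp add: power2_eq_square algebra_simps)
    also have "2 * q * (1 + \<zeta>) * Y n - q * (Y (n - 1) + Y (n + 1)) = 2 * q / of_real a *
        ((of_real a - z) * Y n - of_real (a / 2) * (Y (n - 1) + Y (n + 1)))"
      using assms(2) by (simp add: z field_simps)
    also have "cmod \<dots> \<le> 2 * cmod q / a * \<delta>"
      using F[of n] assms(2) unfolding norm_mult by (intro mult_mono) (auto simp: norm_divide norm_mult)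
    finally show ?thesis .
  qed
  obtain B where "\<And>n. cmod (Y n) \<le> B"
    using assms(1) by (auto simp: bounded_iff)
  then have "cmod (y n) \<le> B + cmod q * B" for n
    unfolding y_def by (intro order_trans[OF norm_triangle_ineq4] add_mono)
      (auto simp: norm_mult mult_left_mono)
  then have "bounded (range y)"
    by (auto simp: bounded_iff)
  then have "cmod (y n) \<le> 2 * cmod q / a * \<delta> / (1 - cmod q)" for n
    using bounded_one_sided_recursion step q(1) by blast
  then have Yn: "cmod (Y n) \<le> 2 * cmod q / a * \<delta> / (1 - cmod q) / (1 - cmod q)"
    unfolding y_def using bounded_one_sided_recursion assms(1) q(1) by blast
  have "2 * cmod q / a / (1 - cmod q)\<^sup>2 \<le> resolvent_const \<kappa> / cmod z"
  proof -
    have "(cmod (1 - q))\<^sup>2 = 2 * cmod q * cmod z / a"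
      using arg_cong[OF q(2), of cmod] assms(2) by (simp add: norm_mult norm_power z)
    then have "2 * cmod q * cmod z / a \<le> resolvent_const \<kappa> * (1 - cmod q)\<^sup>2"
      using q(3) by simp
    then show ?thesis
      using q(1) assms(2,3) by (simp add: field_simps)
  qed
  moreover have "0 \<le> \<delta>"
    using F norm_ge_zero order_trans by blast
  ultimately have "2 * cmod q / a / (1 - cmod q)\<^sup>2 * \<delta> \<le> resolvent_const \<kappa> / cmod z * \<delta>"
    by (rule mult_right_mono)
  moreover have "2 * cmod q / a * \<delta> / (1 - cmod q) / (1 - cmod q) = 2 * cmod q / a / (1 - cmod q)\<^sup>2 * \<delta>"
    by (simp add: power2_eq_square)
  ultimately show ?thesis
    using Yn by linarith
qed

text \<open>Sine sums extend from the grid to all integers as odd functions of period \<open>2 (N + 1)\<close>, so their size on the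
  whole line is already attained on the grid.\<close>

lemma sine_reflection:
  fixes n :: int
  obtains r :: nat and \<sigma> :: real where "r \<le> N + 1" and "\<bar>\<sigma>\<bar> = 1"
    and "\<And>e::nat. sin (pi * real e * of_int n / (real N + 1)) = \<sigma> * sin (pi * real e * real r / (real N + 1))"
proof -
  define P where "P = 2 * (int N + 1)"
  define s where "s = n mod P"
  have "0 < P"
    by (simp add: P_def)
  then have s: "0 \<le> s" "s < P"
    by (simp_all add: s_def)
  have n: "n = s + P * (n div P)"
    by (simp add: s_def)
  have sin_s: "sin (pi * real e * of_int n / (real N + 1)) = sin (pi * real e * of_int s / (real N + 1))" for e :: nat
  proof -
    have "pi * real e * of_int n / (real N + 1)
        = pi * real e * of_int s / (real N + 1) + 2 * pi * of_int (int e * (n div P))"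
      by (subst n) (simp add: P_def field_simps)
    then show ?thesis
      using sin_int_2pin cos_int_2pin by (simp only: sin_add)
  qed
  show thesis
  proof (cases "s \<le> int N + 1")
    case True
    show thesis
      by (rule that[of "nat s" 1]) (use True s sin_s in auto)
  next
    case False
    have "sin (pi * real e * of_int s / (real N + 1)) = - sin (pi * real e * real (nat (P - s)) / (real N + 1))" for e :: nat
    proof -
      have "pi * real e * of_int s / (real N + 1)
        = 2 * pi * of_int (int e) - pi * real e * real (nat (P - s)) / (real N + 1)"
        using s by (simp add: P_def field_simps)
      then show ?thesis
        using sin_int_2pin[of "int e"] cos_int_2pin[of "int e"] by (simp only: sin_diff)
    qed
    then show thesis
      by (intro that[of "nat (P - s)" "-1"]) (use False s sin_s in \<open>auto simp: P_def\<close>)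
  qed
qed

text \<open>The boundary value problem on the grid becomes a problem on the whole line for the sine extension; the boundary
  conditions hold automatically. The sum may run over an arbitrary index set, since in several dimensions many
  modes share the frequency in the direction considered.\<close>

lemma sine_sum_resolvent_bound:
  fixes c :: "'p \<Rightarrow> complex" and e :: "'p \<Rightarrow> nat" and N :: nat and a :: real and z :: complex and P :: "'p set"
  defines "F \<equiv> \<lambda>n::nat. \<Sum>p\<in>P. (of_real (a * (1 - cos (pi * real (e p) / (real N + 1)))) - z) * c p *
      of_real (sin (pi * real (e p) * real n / (real N + 1)))"
  assumes "finite P" and "0 < a" and "z \<noteq> 0"
    and "Re z \<le> \<kappa> * cmod z" and "0 \<le> \<kappa>" and "\<kappa> < 1"
    and F: "\<And>n. n \<in> {1..N} \<Longrightarrow> cmod (F n) \<le> \<delta>" and "0 \<le> \<delta>"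
  shows "cmod (\<Sum>p\<in>P. c p * of_real (sin (pi * real (e p) * real n / (real N + 1)))) \<le>
    resolvent_const \<kappa> / cmod z * \<delta>"
proof -
  define Y where "Y n = (\<Sum>p\<in>P. c p * of_real (sin (pi * real (e p) * of_int n / (real N + 1))))" for n :: int
  define G where "G n = (\<Sum>p\<in>P. (of_real (a * (1 - cos (pi * real (e p) / (real N + 1)))) - z) * c p *
      of_real (sin (pi * real (e p) * of_int n / (real N + 1))))" for n :: int
  have "cmod (Y n) \<le> (\<Sum>p\<in>P. cmod (c p))" for n
    unfolding Y_def by (intro order_trans[OF norm_sum] sum_mono)
      (simp add: norm_mult mult_left_le abs_sin_le_one)
  then have "bounded (range Y)"
    by (auto simp: bounded_iff)
  have "cmod (G n) \<le> \<delta>" for n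
  proof -
    obtain r \<sigma> where r: "r \<le> N + 1" "\<bar>\<sigma>\<bar> = 1"
      "\<And>e::nat. sin (pi * real e * of_int n / (real N + 1)) = \<sigma> * sin (pi * real e * real r / (real N + 1))"
      using sine_reflection by blast
    have "G n = of_real \<sigma> * F r"
      unfolding G_def F_def r(3) sum_distrib_left by (rule sum.cong) simp_all
    moreover have "F r = 0" if "r \<notin> {1..N}"
    proof -
      have "r = 0 \<or> r = N + 1"
        using that r(1) by auto
      then have "sin (pi * real e * real r / (real N + 1)) = 0" for e :: nat
        by (auto simp: add.commute)
      then show ?thesis
        by (simp add: F_def)
    qed
    ultimately show ?thesis
      using F[of r] r(2) assms(9) by (cases "r \<in> {1..N}") (auto simp: norm_mult)
  qed
  moreover have "(of_real a - z) * Y n - of_real (a / 2) * (Y (n - 1) + Y (n + 1)) = G n" for n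
  proof -
    have "of_real (sin (pi * real e * of_int (n - 1) / (real N + 1)))
        + complex_of_real (sin (pi * real e * of_int (n + 1) / (real N + 1)))
      = of_real (2 * cos (pi * real e / (real N + 1)) * sin (pi * real e * of_int n / (real N + 1)))"
      for e :: nat
    proof -
      have "pi * real e * of_int (n - 1) / (real N + 1)
          = pi * real e * of_int n / (real N + 1) - pi * real e / (real N + 1)"
        and "pi * real e * of_int (n + 1) / (real N + 1)
          = pi * real e * of_int n / (real N + 1) + pi * real e / (real N + 1)"
        by (simp_all add: algebra_simps add_divide_distrib diff_divide_distrib)
      then show ?thesis
        by (simp only: sin_add sin_diff) simp
    qed
    then have "Y (n - 1) + Y (n + 1) = (\<Sum>p\<in>P. c p * of_real (2 * cos (pi * real (e p) / (real N + 1))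
        * sin (pi * real (e p) * of_int n / (real N + 1))))"
      unfolding Y_def sum.distrib[symmetric] distrib_left[symmetric] by (simp only:)
    then show ?thesis
      unfolding Y_def G_def
      by (simp only: sum_distrib_left sum_subtractf[symmetric]) (rule sum.cong; simp add: algebra_simps)
  qed
  ultimately have "cmod (Y (int n)) \<le> resolvent_const \<kappa> / cmod z * \<delta>"
    using three_term_recursion_bound[of Y a z \<kappa> \<delta>] \<open>bounded (range Y)\<close> assms by simp
  then show ?thesis
    by (simp add: Y_def)
qed

lemma multiplier_bound_resolvent:
  assumes "j \<in> {1..m}" and "0 < a" and "z \<noteq> 0"
    and "Re z \<le> \<kappa> * cmod z" and "0 \<le> \<kappa>" and "\<kappa> < 1"
    and "\<And>p. p \<in> mindices m N \<Longrightarrow> \<mu> p = a * (1 - cos (pi * real (p j) / (real (N j) + 1)))"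
  shows "multiplier_bound m N (\<lambda>p. 1 / (of_real (\<mu> p) - z)) (resolvent_const \<kappa> / cmod z)"
  unfolding multiplier_bound_def
proof (intro allI impI ballI)
  fix d \<delta> k assume d: "\<forall>k\<in>mindices m N. cmod (d k) \<le> \<delta>" and k: "k \<in> mindices m N"
  have "of_real (\<mu> p) \<noteq> z" if p: "p \<in> mindices m N" for p
  proof
    assume eq: "of_real (\<mu> p) = z"
    have "0 \<le> \<mu> p"
      using assms(2,7) p by simp
    then have "\<mu> p \<le> \<kappa> * \<mu> p"
      using assms(4) unfolding eq[symmetric] by simp
    then have "\<mu> p = 0"
      using \<open>0 \<le> \<mu> p\<close> assms(6) by (smt (verit) mult_le_cancel_right1)
    then show False
      using eq assms(3) by simp
  qed
  then have ne: "of_real (a * (1 - cos (pi * real (p j) / (real (N j) + 1)))) - z \<noteq> 0"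
    if "p \<in> mindices m N" for p
    using assms(7) that by fastforce
  define rest where "rest p = (\<Prod>i\<in>{1..m} - {j}. sine_mode (N i) (p i) (k i))" for p
  define c where "c p = 1 / (of_real (\<mu> p) - z) * dst m N d p * of_real (rest p * sqrt (2 / (real (N j) + 1)))" for p
  have mode: "mode m N (k(j := n)) p = rest p * sqrt (2 / (real (N j) + 1)) *
      sin (pi * real (p j) * real n / (real (N j) + 1))" for n p
  proof -
    have "mode m N p (k(j := n)) = sine_mode (N j) (p j) n * rest p"
      unfolding mode_def rest_def by (subst prod.remove[OF _ assms(1)]) (auto intro!: prod.cong)
    then show ?thesis
      by (simp add: mode_commute[of m N "k(j := n)"] sine_mode_def)
  qed
  have dst_c: "dst m N (\<lambda>p. g p * (1 / (of_real (\<mu> p) - z) * dst m N d p)) (k(j := n)) =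
     (\<Sum>p\<in>mindices m N. g p * c p * of_real (sin (pi * real (p j) * real n / (real (N j) + 1))))" for g n
    unfolding dst_def[of m N "\<lambda>p. g p * (1 / (of_real (\<mu> p) - z) * dst m N d p)"] mode c_def
    by (rule sum.cong) simp_all
  have "cmod (\<Sum>p\<in>mindices m N. c p * of_real (sin (pi * real (p j) * real (k j) / (real (N j) + 1))))
     \<le> resolvent_const \<kappa> / cmod z * \<delta>"
  proof (rule sine_sum_resolvent_bound[OF _ assms(2-6)])
    fix n assume n: "n \<in> {1..N j}"
    have kn: "k(j := n) \<in> mindices m N"
      using k n assms(1) by (auto simp: mindices_def PiE_iff extensional_def)
    have "(\<Sum>p\<in>mindices m N. (of_real (a * (1 - cos (pi * real (p j) / (real (N j) + 1)))) - z) * c p *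
        of_real (sin (pi * real (p j) * real n / (real (N j) + 1)))) =
      dst m N (\<lambda>p. (of_real (\<mu> p) - z) * (1 / (of_real (\<mu> p) - z) * dst m N d p)) (k(j := n))"
      unfolding dst_c by (rule sum.cong) (simp_all add: assms(7))
    also have "\<dots> = dst m N (dst m N d) (k(j := n))"
      by (rule dst_cong) (use ne assms(7) in simp)
    also have "\<dots> = d (k(j := n))"
      using dst_dst kn by blast
    finally show "cmod (\<Sum>p\<in>mindices m N. (of_real (a * (1 - cos (pi * real (p j) / (real (N j) + 1)))) - z) * c p *
        of_real (sin (pi * real (p j) * real n / (real (N j) + 1)))) \<le> \<delta>"
      using d kn by simp
  next
    show "0 \<le> \<delta>"
      using d k norm_ge_zero order_trans by blast
  qed simp
  moreover have "dst m N (\<lambda>p. 1 / (of_real (\<mu> p) - z) * dst m N d p) k =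
     (\<Sum>p\<in>mindices m N. c p * of_real (sin (pi * real (p j) * real (k j) / (real (N j) + 1))))"
    using dst_c[of "\<lambda>p. 1" "k j"] by simp
  ultimately show "cmod (dst m N (\<lambda>p. 1 / (of_real (\<mu> p) - z) * dst m N d p) k)
      \<le> resolvent_const \<kappa> / cmod z * \<delta>"
    by simp
qed

text \<open>With \<open>b = 1 / (1 + \<mu>)\<close> and \<open>z = (1 - w) / w\<close> one has
  \<open>1 / (w - b) = (1 + (1 / w) / (\<mu> - z)) / w\<close>, which reduces the resolvent of the bounded operator to
  that of the difference operator.\<close>

lemma multiplier_bound_inverse_shift:
  assumes "j \<in> {1..m}" and "0 < a" and "w \<noteq> 0" and "w \<noteq> 1"
    and "Re ((1 - w) / w) \<le> \<kappa> * cmod ((1 - w) / w)" and "0 \<le> \<kappa>" and "\<kappa> < 1"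
    and "\<And>p. p \<in> mindices m N \<Longrightarrow> b p = 1 / (1 + a * (1 - cos (pi * real (p j) / (real (N j) + 1))))"
  shows "multiplier_bound m N (\<lambda>p. 1 / (w - of_real (b p))) ((1 + resolvent_const \<kappa> / cmod (1 - w)) / cmod w)"
proof -
  define \<mu> where "\<mu> p = a * (1 - cos (pi * real (p j) / (real (N j) + 1)))" for p :: "nat \<Rightarrow> nat"
  define z where "z = (1 - w) / w"
  have "multiplier_bound m N (\<lambda>p. 1 / (of_real (\<mu> p) - z)) (resolvent_const \<kappa> / cmod z)"
    by (rule multiplier_bound_resolvent[OF assms(1,2)]) (use assms in \<open>auto simp: \<mu>_def z_def\<close>)
  then have "multiplier_bound m N (\<lambda>p. 1 / w * (1 + 1 / w * (1 / (of_real (\<mu> p) - z))))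
    (cmod (1 / w) * (cmod 1 + cmod (1 / w) * (resolvent_const \<kappa> / cmod z)))"
    by (intro multiplier_bound_mult multiplier_bound_add multiplier_bound_const)
  moreover have "cmod (1 / w) * (cmod 1 + cmod (1 / w) * (resolvent_const \<kappa> / cmod z)) =
    (1 + resolvent_const \<kappa> / cmod (1 - w)) / cmod w"
    using assms(3,4) by (simp add: z_def norm_divide)
  moreover have "1 / w * (1 + 1 / w * (1 / (of_real (\<mu> p) - z))) = 1 / (w - of_real (b p))"
    if p: "p \<in> mindices m N" for p
  proof -
    have nn: "0 \<le> \<mu> p"
      using assms(2) by (simp add: \<mu>_def)
    have b: "of_real (b p) = 1 / (1 + complex_of_real (\<mu> p))"
      using assms(8)[OF p] by (simp add: \<mu>_def)
    have l1: "1 + complex_of_real (\<mu> p) \<noteq> 0"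
      using nn by (metis add_nonneg_eq_0_iff of_real_1 of_real_add of_real_eq_0_iff zero_le_one zero_neq_one)
    have lz: "of_real (\<mu> p) \<noteq> z"
    proof
      assume eq: "of_real (\<mu> p) = z"
      then have "\<mu> p \<le> \<kappa> * \<mu> p"
        using assms(5) nn unfolding z_def[symmetric] by (metis Re_complex_of_real norm_of_real abs_of_nonneg)
      then have "\<mu> p = 0"
        using nn assms(7) by (smt (verit) mult_le_cancel_right1)
      then show False
        using eq assms(3,4) by (simp add: z_def)
    qed
    have "w * of_real (\<mu> p) - (1 - w) \<noteq> 0"
      using lz assms(3) by (simp add: z_def field_simps)
    then have "w * (1 + of_real (\<mu> p)) - 1 \<noteq> 0"
      by (simp add: algebra_simps)
    moreover define X where "X = w * (1 + of_real (\<mu> p)) - 1"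
    ultimately have X: "X \<noteq> 0"
      by simp
    have "of_real (\<mu> p) - z = X / w" and "w - of_real (b p) = X / (1 + of_real (\<mu> p))"
      using assms(3) l1 by (simp_all add: z_def b X_def field_simps)
    moreover have "1 / w * (1 + 1 / w * (1 / (X / w))) = (X + 1) / (w * X)"
      using assms(3) X by (simp add: field_simps)
    moreover have "(X + 1) / (w * X) = 1 / (X / (1 + of_real (\<mu> p)))"
      using assms(3) by (simp add: X_def)
    ultimately show ?thesis
      by simp
  qed
  ultimately show ?thesis
    using multiplier_bound_cong[of m N "\<lambda>p. 1 / w * (1 + 1 / w * (1 / (of_real (\<mu> p) - z)))"] by simp
qed

section \<open>The stability function near the real cube\<close>

text \<open>Zero belongs to every sector, so the corners of the rhombus below need no separate treatment.\<close>

definition sector :: "real \<Rightarrow> complex set" where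
  "sector \<alpha> = {z. \<exists>\<eta>. \<bar>\<eta>\<bar> \<le> \<alpha> \<and> z = of_real (cmod z) * cis \<eta>}"

lemma sectorI: "\<bar>\<eta>\<bar> \<le> \<alpha> \<Longrightarrow> 0 \<le> r \<Longrightarrow> of_real r * cis \<eta> \<in> sector \<alpha>"
  unfolding sector_def by (auto simp: norm_mult)

lemma sector_mult:
  assumes "z \<in> sector \<alpha>" and "w \<in> sector \<beta>"
  shows "z * w \<in> sector (\<alpha> + \<beta>)"
proof -
  obtain \<eta> \<psi> where "\<bar>\<eta>\<bar> \<le> \<alpha>" "z = of_real (cmod z) * cis \<eta>" "\<bar>\<psi>\<bar> \<le> \<beta>" "w = of_real (cmod w) * cis \<psi>"
    using assms by (auto simp: sector_def)
  then have "z * w = of_real (cmod (z * w)) * cis (\<eta> + \<psi>)" and "\<bar>\<eta> + \<psi>\<bar> \<le> \<alpha> + \<beta>"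
    by (auto simp: norm_mult simp flip: cis_mult) (metis mult.assoc mult.left_commute)
  then show ?thesis
    unfolding sector_def by blast
qed

lemma sector_prod:
  assumes "finite S" and "\<And>i. i \<in> S \<Longrightarrow> v i \<in> sector \<alpha>"
  shows "(\<Prod>i\<in>S. v i) \<in> sector (real (card S) * \<alpha>)"
  using assms
proof (induction S rule: finite_induct)
  case empty
  show ?case
    using sectorI[of 0 0 1] by simp
next
  case (insert i S)
  then have "v i * (\<Prod>i\<in>S. v i) \<in> sector (\<alpha> + real (card S) * \<alpha>)"
    by (intro sector_mult) auto
  then show ?case
    using insert by (simp add: distrib_right)
qed

lemma Re_sector_cnj:
  assumes "z \<in> sector \<gamma>" and "w \<in> sector \<gamma>" and "2 * \<gamma> \<le> pi / 3"
  shows "cmod z * cmod w / 2 \<le> Re (z * cnj w)"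
proof -
  obtain \<eta> \<psi> where *: "\<bar>\<eta>\<bar> \<le> \<gamma>" "z = of_real (cmod z) * cis \<eta>" "\<bar>\<psi>\<bar> \<le> \<gamma>" "w = of_real (cmod w) * cis \<psi>"
    using assms by (auto simp: sector_def)
  have "z * cnj w = of_real (cmod z * cmod w) * cis (\<eta> - \<psi>)"
    by (subst *(2), subst *(4)) (simp add: cis_mult cis_cnj)
  then have "Re (z * cnj w) = cmod z * cmod w * cos (\<eta> - \<psi>)"
    by simp
  moreover have "\<bar>\<eta> - \<psi>\<bar> \<le> pi / 3"
    using *(1,3) assms(3) by linarith
  then have "cos (pi / 3) \<le> cos \<bar>\<eta> - \<psi>\<bar>"
    by (intro cos_monotone_0_pi_le) auto
  then have "1 / 2 \<le> cos (\<eta> - \<psi>)"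
    by (simp add: cos_60)
  then have "cmod z * cmod w * (1 / 2) \<le> cmod z * cmod w * cos (\<eta> - \<psi>)"
    by (intro mult_left_mono) auto
  ultimately show ?thesis
    by simp
qed

text \<open>The symbol \<open>r\<close> of the stability matrix in terms of the variables \<open>b\<^sub>j = 1 / (1 + \<lambda>\<^sub>j)\<close>, for which
  \<open>\<lambda>\<^sub>j b\<^sub>j = 1 - b\<^sub>j\<close>.\<close>

definition stability_symbol :: "nat set \<Rightarrow> (nat \<Rightarrow> complex) \<Rightarrow> complex" where
  "stability_symbol I v = 1 - 2 * (\<Sum>j\<in>I. (1 - v j) * (\<Prod>i\<in>I - {j}. v i))"

text \<open>Expanding \<open>1 = \<Prod>\<^sub>i ((1 - v i) + v i)\<close> splits 1 into products indexed by subsets of \<open>I\<close>. Let \<open>p\<close> be the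
  sum over the singletons and \<open>q\<close> the sum over all other subsets, so that \<open>p + q = 1\<close> and the symbol is
  \<open>q - p\<close>. Therefore \<open>\<bar>q - p\<bar>\<^sup>2 = 1 - 4 Re (p * cnj q)\<close>. All products have nearly the same argument,
  so every pair contributes positively to the real part, and keeping the pair of \<open>{j}\<close> and the empty set gives the claim.\<close>

lemma norm_stability_symbol:
  assumes "finite I" and "j \<in> I" and v: "\<And>i. i \<in> I \<Longrightarrow> v i \<in> sector \<alpha>"
    and v': "\<And>i. i \<in> I \<Longrightarrow> 1 - v i \<in> sector \<alpha>" and \<alpha>: "real (card I) * \<alpha> \<le> pi / 6"
  shows "(cmod (stability_symbol I v))\<^sup>2 \<le>
    1 - 2 * (cmod (1 - v j) * (\<Prod>i\<in>I - {j}. cmod (v i)) * (\<Prod>i\<in>I. cmod (v i)))"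
proof -
  define T where "T S = (\<Prod>i\<in>S. 1 - v i) * (\<Prod>i\<in>I - S. v i)" for S
  define A where "A = (\<lambda>j. {j}) ` I"
  define B where "B = Pow I - A"
  define p where "p = sum T A"
  define q where "q = sum T B"
  have A: "A \<subseteq> Pow I" "{j} \<in> A" "finite A"
    using assms(1,2) by (auto simp: A_def)
  have B: "B \<subseteq> Pow I" "{} \<in> B" "finite B"
    using assms(1) by (auto simp: A_def B_def)
  have "p + q = sum T (Pow I)"
    using A assms(1) unfolding p_def q_def B_def by (metis add.commute finite_Pow_iff sum.subset_diff)
  also have "\<dots> = (\<Prod>i\<in>I. (1 - v i) + v i)"
    unfolding T_def by (rule prod_add[OF assms(1), symmetric])
  finally have pq: "p + q = 1"
    by simp
  have "p = (\<Sum>j\<in>I. (1 - v j) * (\<Prod>i\<in>I - {j}. v i))"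
    unfolding p_def A_def by (subst sum.reindex) (auto simp: T_def)
  then have r: "stability_symbol I v = q - p"
    using pq by (simp add: stability_symbol_def algebra_simps)
  have T: "T S \<in> sector (real (card I) * \<alpha>)" if "S \<subseteq> I" for S
  proof -
    have fin: "finite S"
      using that assms(1) finite_subset by blast
    have "T S \<in> sector (real (card S) * \<alpha> + real (card (I - S)) * \<alpha>)"
      unfolding T_def by (intro sector_mult sector_prod) (use that assms(1) fin v v' in auto)
    moreover have "card I = card S + card (I - S)"
      using that assms(1) fin by (simp add: card_Diff_subset card_mono)
    ultimately show ?thesis
      by (simp add: distrib_right)
  qed
  have "cmod (T {j}) * cmod (T {}) / 2 \<le> (\<Sum>S\<in>A. \<Sum>S'\<in>B. cmod (T S) * cmod (T S') / 2)"
  proof -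
    have "cmod (T {j}) * cmod (T {}) / 2 \<le> (\<Sum>S'\<in>B. cmod (T {j}) * cmod (T S') / 2)"
      by (rule member_le_sum) (use B in auto)
    also have "\<dots> \<le> (\<Sum>S\<in>A. \<Sum>S'\<in>B. cmod (T S) * cmod (T S') / 2)"
      by (rule member_le_sum) (use A in \<open>auto intro!: sum_nonneg\<close>)
    finally show ?thesis .
  qed
  also have "\<dots> \<le> (\<Sum>S\<in>A. \<Sum>S'\<in>B. Re (T S * cnj (T S')))"
    by (intro sum_mono Re_sector_cnj[OF T T]) (use A B \<alpha> in auto)
  also have "\<dots> = Re (p * cnj q)"
    by (simp add: p_def q_def sum_product Re_sum cnj_sum)
  finally have pq_lower: "cmod (T {j}) * cmod (T {}) / 2 \<le> Re (p * cnj q)" .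
  have "(cmod (q - p))\<^sup>2 = (cmod (p + q))\<^sup>2 - 4 * Re (p * cnj q)"
    unfolding cmod_power2 by (simp add: power2_eq_square algebra_simps)
  then have "(cmod (stability_symbol I v))\<^sup>2 = 1 - 4 * Re (p * cnj q)"
    by (simp add: r pq)
  also have "\<dots> \<le> 1 - 2 * (cmod (T {j}) * cmod (T {}))"
    using pq_lower by simp
  also have "cmod (T {j}) * cmod (T {}) = cmod (1 - v j) * (\<Prod>i\<in>I - {j}. cmod (v i)) * (\<Prod>i\<in>I. cmod (v i))"
    by (simp add: T_def norm_mult prod_norm)
  finally show ?thesis .
qed

text \<open>The bounds for the individual \<open>j\<close> are combined by their geometric mean, which makes the estimate factorize over the
  directions.\<close>

lemma norm_stability_symbol_exp:
  assumes "finite I" and "I \<noteq> {}" and v: "\<And>i. i \<in> I \<Longrightarrow> v i \<in> sector \<alpha>"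
    and v': "\<And>i. i \<in> I \<Longrightarrow> 1 - v i \<in> sector \<alpha>" and \<alpha>: "real (card I) * \<alpha> \<le> pi / 6"
    and v1: "\<And>i. i \<in> I \<Longrightarrow> cmod (v i) \<le> 1"
  shows "cmod (stability_symbol I v) \<le>
    exp (- (\<Sum>j\<in>I. cmod (1 - v j)) * (\<Prod>i\<in>I. cmod (v i))\<^sup>2 / real (card I))"
proof -
  define Y where "Y = (\<Prod>i\<in>I. cmod (v i))"
  have each: "cmod (stability_symbol I v) \<le> exp (- (cmod (1 - v j) * Y\<^sup>2))" if j: "j \<in> I" for j
  proof -
    have "Y = cmod (v j) * (\<Prod>i\<in>I - {j}. cmod (v i))"
      unfolding Y_def using assms(1) j by (rule prod.remove)
    also have "\<dots> \<le> 1 * (\<Prod>i\<in>I - {j}. cmod (v i))"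
      using v1[OF j] by (intro mult_right_mono prod_nonneg) auto
    finally have "cmod (1 - v j) * Y * Y \<le> cmod (1 - v j) * (\<Prod>i\<in>I - {j}. cmod (v i)) * Y"
      by (intro mult_right_mono mult_left_mono) (auto simp: Y_def intro!: prod_nonneg)
    then have "(cmod (stability_symbol I v))\<^sup>2 \<le> 1 - 2 * (cmod (1 - v j) * Y\<^sup>2)"
      using norm_stability_symbol[where v = v, OF assms(1) j v v' \<alpha>] by (simp add: Y_def power2_eq_square mult.assoc)
    also have "\<dots> \<le> exp (- (2 * (cmod (1 - v j) * Y\<^sup>2)))"
      using exp_ge_add_one_self[of "- (2 * (cmod (1 - v j) * Y\<^sup>2))"] by simp
    also have "\<dots> = (exp (- (cmod (1 - v j) * Y\<^sup>2)))\<^sup>2"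
      by (simp add: exp_double[symmetric])
    finally show ?thesis
      by (rule power2_le_imp_le) simp
  qed
  define r where "r = cmod (stability_symbol I v)"
  have card: "0 < real (card I)"
    using assms(1,2) by (simp add: card_gt_0_iff)
  show ?thesis
  proof (cases "r = 0")
    case False
    then have pos: "0 < r"
      by (simp add: r_def)
    have "real (card I) * ln r \<le> (\<Sum>j\<in>I. - (cmod (1 - v j) * Y\<^sup>2))"
    proof -
      have "ln r \<le> - (cmod (1 - v j) * Y\<^sup>2)" if "j \<in> I" for j
        using each[OF that] pos ln_le_cancel_iff[of r "exp (- (cmod (1 - v j) * Y\<^sup>2))"] by (simp add: r_def)
      then have "(\<Sum>j\<in>I. ln r) \<le> (\<Sum>j\<in>I. - (cmod (1 - v j) * Y\<^sup>2))"
        by (rule sum_mono)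
      then show ?thesis
        by simp
    qed
    then have "ln r \<le> - (\<Sum>j\<in>I. cmod (1 - v j)) * Y\<^sup>2 / real (card I)"
      using card by (simp add: field_simps sum_negf sum_distrib_left)
    then have "r \<le> exp (- (\<Sum>j\<in>I. cmod (1 - v j)) * Y\<^sup>2 / real (card I))"
      using pos by (metis exp_le_cancel_iff exp_ln)
    then show ?thesis
      by (simp add: r_def Y_def)
  qed (simp add: r_def)
qed

text \<open>The contour has to pass the point 1 at distance \<open>1/k\<close>. Instead of estimating the symbol there directly, one
  uses that a dilation by \<open>1 + \<delta>\<close> changes it by \<open>O(\<delta>)\<close>, which is harmless in the \<open>k\<close>-th power when
  \<open>\<delta> \<approx> 1/k\<close>.\<close>

lemma stability_symbol_dilation:
  assumes "finite I" and v1: "\<And>i. i \<in> I \<Longrightarrow> cmod (v i) \<le> 1" and v2: "\<And>i. i \<in> I \<Longrightarrow> cmod (1 - v i) \<le> 1"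
    and "0 \<le> \<delta>" and "\<delta> \<le> 1"
  shows "cmod (stability_symbol I (\<lambda>i. of_real (1 + \<delta>) * v i)) \<le>
    cmod (stability_symbol I v) + 4 * real (card I) * 2 ^ card I * \<delta>"
proof (cases "I = {}")
  case True
  then show ?thesis
    by (simp add: stability_symbol_def)
next
  case False
  define n where "n = card I - 1"
  have n: "card I = Suc n"
    using False assms(1) by (simp add: n_def card_gt_0_iff)
  define c where "c = complex_of_real (1 + \<delta>)"
  define P where "P j = (\<Prod>i\<in>I - {j}. v i)" for j
  have P: "cmod (P j) \<le> 1" for j
    unfolding P_def prod_norm[symmetric] by (rule prod_le_1) (use v1 in auto)
  have "(1 + \<delta>) ^ n \<le> 1 + (2 ^ n - 1) * \<delta>"
  proof (induction n)
    case (Suc n)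
    have "(1 + \<delta>) ^ Suc n \<le> (1 + \<delta>) * (1 + (2 ^ n - 1) * \<delta>)"
      using Suc assms(4) by (simp add: mult_left_mono)
    also have "\<dots> = 1 + \<delta> + (2 ^ n - 1) * \<delta> + (2 ^ n - 1) * (\<delta> * \<delta>)"
      by (simp add: algebra_simps)
    also have "\<dots> \<le> 1 + \<delta> + (2 ^ n - 1) * \<delta> + (2 ^ n - 1) * \<delta>"
      using assms(4,5) by (intro add_left_mono mult_left_mono) (auto simp: mult_left_le)
    also have "\<dots> = 1 + (2 ^ Suc n - 1) * \<delta>"
      by (simp add: algebra_simps)
    finally show ?case .
  qed simp
  moreover have "(2 ^ n - 1) * \<delta> \<le> 2 ^ n * \<delta>"
    using assms(4) by (intro mult_right_mono) auto
  ultimately have "(1 + \<delta>) ^ n - 1 \<le> 2 ^ n * \<delta>"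
    by linarith
  moreover have "1 \<le> (1 + \<delta>) ^ n"
    using assms(4) by simp
  moreover have "c ^ n - 1 = of_real ((1 + \<delta>) ^ n - 1)"
    by (simp add: c_def)
  ultimately have pow: "cmod (c ^ n - 1) \<le> 2 ^ n * \<delta>"
    by (simp only: norm_of_real)
  have pow': "cmod (c ^ n) \<le> 2 ^ n"
    using assms(4,5) unfolding norm_power c_def norm_of_real by (intro power_mono) auto
  have w: "(\<Prod>i\<in>I - {j}. c * v i) = c ^ n * P j" if "j \<in> I" for j
    using that assms(1) by (simp add: prod.distrib P_def n_def)
  have diff: "stability_symbol I (\<lambda>i. c * v i) - stability_symbol I v
      = - 2 * (\<Sum>j\<in>I. (c ^ n - 1) * ((1 - v j) * P j) - c ^ n * (of_real \<delta> * (v j * P j)))"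
  proof -
    have "(\<Sum>j\<in>I. (1 - c * v j) * (\<Prod>i\<in>I - {j}. c * v i)) - (\<Sum>j\<in>I. (1 - v j) * P j)
       = (\<Sum>j\<in>I. (c ^ n - 1) * ((1 - v j) * P j) - c ^ n * (of_real \<delta> * (v j * P j)))"
      unfolding sum_subtractf[symmetric]
    proof (rule sum.cong)
      fix j assume "j \<in> I"
      then show "(1 - c * v j) * (\<Prod>i\<in>I - {j}. c * v i) - (1 - v j) * P j =
          (c ^ n - 1) * ((1 - v j) * P j) - c ^ n * (of_real \<delta> * (v j * P j))"
        by (simp only: w) (simp add: c_def algebra_simps)
    qed simp
    then show ?thesis
      by (simp add: stability_symbol_def P_def algebra_simps)
  qed
  have "cmod (- 2 * (\<Sum>j\<in>I. (c ^ n - 1) * ((1 - v j) * P j) - c ^ n * (of_real \<delta> * (v j * P j))))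
      \<le> 2 * (\<Sum>j\<in>I. 2 ^ n * \<delta> * 1 + 2 ^ n * (\<delta> * 1))"
  proof -
    have "cmod ((c ^ n - 1) * ((1 - v j) * P j) - c ^ n * (of_real \<delta> * (v j * P j)))
        \<le> 2 ^ n * \<delta> * 1 + 2 ^ n * (\<delta> * 1)" if "j \<in> I" for j
    proof (intro order_trans[OF norm_triangle_ineq4] add_mono)
      show "cmod ((c ^ n - 1) * ((1 - v j) * P j)) \<le> 2 ^ n * \<delta> * 1"
        using pow v2[OF that] P[of j] assms(4) unfolding norm_mult by (intro mult_mono mult_le_one) auto
      show "cmod (c ^ n * (of_real \<delta> * (v j * P j))) \<le> 2 ^ n * (\<delta> * 1)"
        using pow' v1[OF that] P[of j] assms(4) unfolding norm_mult by (intro mult_mono mult_le_one) auto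
    qed
    then show ?thesis
      unfolding norm_mult by (intro mult_mono order_trans[OF norm_sum] sum_mono) auto
  qed
  moreover have "2 * (\<Sum>j\<in>I. 2 ^ n * \<delta> * 1 + 2 ^ n * (\<delta> * 1)) = 2 * real (card I) * 2 ^ card I * \<delta>"
    by (simp add: n)
  moreover have "2 * real (card I) * 2 ^ card I * \<delta> \<le> 4 * real (card I) * 2 ^ card I * \<delta>"
    using assms(4) by (intro mult_right_mono) auto
  ultimately show ?thesis
    using norm_triangle_sub[of "stability_symbol I (\<lambda>i. c * v i)" "stability_symbol I v"]
    unfolding diff unfolding c_def by linarith
qed

lemma exp_minus_le_powr:
  fixes t \<epsilon> :: real
  assumes "0 \<le> t" and "0 \<le> \<epsilon>" and "\<epsilon> \<le> 1"
  shows "exp (- t) \<le> (1 + t) powr (- \<epsilon>)"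
proof -
  have "(1 + t) powr \<epsilon> \<le> (1 + t) powr 1"
    using assms by (intro powr_mono) auto
  also have "\<dots> \<le> exp t"
    using assms(1) exp_ge_add_one_self[of t] by simp
  finally have "1 / exp t \<le> 1 / (1 + t) powr \<epsilon>"
    using assms(1) by (intro divide_left_mono) auto
  then show ?thesis
    by (simp add: exp_minus powr_minus inverse_eq_divide)
qed

text \<open>The weight of one variable on the contour. Its first factor makes \<open>1 / cmod v\<close> integrable at 0, the second
  one makes \<open>K / (1 + K * cmod (1 - v))\<close> integrable near 1 uniformly in \<open>K\<close>. The second
  exponent is small enough to leave half of the available power of \<open>cmod v\<close> for the first factor.\<close>

definition edge_weight :: "nat \<Rightarrow> nat \<Rightarrow> complex \<Rightarrow> real" where
  "edge_weight m K v = cmod v powr (1/2) * (1 + real K * cmod (1 - v)) powr (- (1 / (4 * real m)))"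

definition symbol_const :: "nat \<Rightarrow> real" where
  "symbol_const m = exp (1 + exp 1 * (4 * real m * 2 ^ m)) * 2 ^ m * real m powr (1/4)"

lemma symbol_const_nonneg: "0 \<le> symbol_const m"
  by (simp add: symbol_const_def)

text \<open>Write \<open>Y\<close> for the product of the \<open>cmod (v i)\<close>. Each factor of the exponential is traded for the power
  \<open>-1 / (4 m)\<close>, which costs \<open>Y\<close> to the power \<open>-1 / (2 m)\<close>. Over all \<open>m\<close> directions this amounts to
  \<open>Y\<close> to the power \<open>-1/2\<close>, and the factor \<open>Y\<close> on the left pays for it.\<close>

lemma exp_decay_le_edge_weight:
  assumes "finite I" and "I \<noteq> {}"
    and v1: "\<And>i. i \<in> I \<Longrightarrow> cmod (v i) \<le> 1"
  shows "exp (- (real K * ((\<Sum>j\<in>I. cmod (1 - v j)) * (\<Prod>i\<in>I. cmod (v i))\<^sup>2 / real (card I)))) * (\<Prod>i\<in>I. cmod (v i)) \<le>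
    real (card I) powr (1/4) * (\<Prod>i\<in>I. edge_weight (card I) K (v i))"
proof (cases "(\<Prod>i\<in>I. cmod (v i)) = 0")
  case True
  then show ?thesis
    by (auto simp: edge_weight_def intro!: mult_nonneg_nonneg prod_nonneg)
next
  case False
  define m where "m = card I"
  define Y where "Y = (\<Prod>i\<in>I. cmod (v i))"
  define \<epsilon> where "\<epsilon> = 1 / (4 * real m)"
  have m: "1 \<le> real m"
    using assms(1,2) by (simp add: m_def Suc_le_eq card_gt_0_iff)
  have \<epsilon>: "0 \<le> \<epsilon>" "\<epsilon> \<le> 1" "\<epsilon> * real m = 1/4"
    using m by (auto simp: \<epsilon>_def)
  have Y: "0 < Y" "Y \<le> 1"
    using False v1 by (auto simp: Y_def less_le intro!: prod_nonneg prod_le_1)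
  have c: "0 < Y\<^sup>2 / real m" "Y\<^sup>2 / real m \<le> 1"
    using Y m power_le_one[of Y 2] by (auto simp: divide_le_eq)
  have step: "exp (- (real K * cmod (1 - v i) * (Y\<^sup>2 / real m))) \<le>
      (Y\<^sup>2 / real m) powr (- \<epsilon>) * (1 + real K * cmod (1 - v i)) powr (- \<epsilon>)" for i
  proof -
    let ?t = "real K * cmod (1 - v i)"
    have "exp (- (?t * (Y\<^sup>2 / real m))) \<le> (1 + ?t * (Y\<^sup>2 / real m)) powr (- \<epsilon>)"
      using c \<epsilon> by (intro exp_minus_le_powr mult_nonneg_nonneg) auto
    also have "\<dots> \<le> (Y\<^sup>2 / real m * (1 + ?t)) powr (- \<epsilon>)"
    proof (rule powr_mono2')
      show "Y\<^sup>2 / real m * (1 + ?t) \<le> 1 + ?t * (Y\<^sup>2 / real m)"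
        unfolding distrib_left using c(2) by (simp add: mult.commute)
      show "0 < Y\<^sup>2 / real m * (1 + ?t)"
        using c(1) by (intro mult_pos_pos add_pos_nonneg) auto
    qed (use \<epsilon> in auto)
    also have "\<dots> = (Y\<^sup>2 / real m) powr (- \<epsilon>) * (1 + ?t) powr (- \<epsilon>)"
      using c(1) by (intro powr_mult)
    finally show ?thesis .
  qed
  have "exp (- (real K * ((\<Sum>j\<in>I. cmod (1 - v j)) * Y\<^sup>2 / real m)))
      = (\<Prod>i\<in>I. exp (- (real K * cmod (1 - v i) * (Y\<^sup>2 / real m))))"
    using assms(1) by (simp add: exp_sum[symmetric] sum_negf sum_distrib_left sum_distrib_right sum_divide_distrib mult.assoc)
  also have "\<dots> \<le> (\<Prod>i\<in>I. (Y\<^sup>2 / real m) powr (- \<epsilon>) * (1 + real K * cmod (1 - v i)) powr (- \<epsilon>))"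
    by (intro prod_mono conjI step) auto
  also have "\<dots> = ((Y\<^sup>2 / real m) powr (- \<epsilon>)) ^ m * (\<Prod>i\<in>I. (1 + real K * cmod (1 - v i)) powr (- \<epsilon>))"
    by (simp add: prod.distrib m_def)
  also have "((Y\<^sup>2 / real m) powr (- \<epsilon>)) ^ m = (Y\<^sup>2 / real m) powr (real m * - \<epsilon>)"
    using c(1) by (intro powr_power disjI1 less_imp_neq[THEN not_sym])
  also have "real m * - \<epsilon> = - (1/4)"
    using \<epsilon>(3) by (metis mult.commute mult_minus_right)
  also have "(Y\<^sup>2 / real m) powr (- (1/4)) = real m powr (1/4) * Y powr (- (1/2))"
    using Y(1) m by (simp add: powr_divide powr_minus_divide powr_powr flip: powr_numeral)
  finally have "exp (- (real K * ((\<Sum>j\<in>I. cmod (1 - v j)) * Y\<^sup>2 / real m))) * Y \<le>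
      real m powr (1/4) * Y powr (- (1/2)) * (\<Prod>i\<in>I. (1 + real K * cmod (1 - v i)) powr (- \<epsilon>)) * Y"
    using Y(1) by (intro mult_right_mono) auto
  also have "\<dots> = real m powr (1/4) * (Y powr (- (1/2)) * Y powr 1) * (\<Prod>i\<in>I. (1 + real K * cmod (1 - v i)) powr (- \<epsilon>))"
    using Y(1) by simp
  also have "Y powr (- (1/2)) * Y powr 1 = Y powr (1/2)"
    by (simp only: powr_add[symmetric]) simp
  also have "\<dots> = (\<Prod>i\<in>I. cmod (v i) powr (1/2))"
    unfolding Y_def by (rule prod_powr_distrib)
  finally show ?thesis
    by (simp add: Y_def m_def \<epsilon>_def edge_weight_def prod.distrib mult.assoc)
qed

text \<open>Using \<open>k + 1\<close> in place of \<open>k\<close> in the dilation covers the case \<open>k = 0\<close>.\<close>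

lemma symbol_le_edge_weights:
  fixes k :: nat
  defines "K \<equiv> k + 1"
  assumes "finite I" and "I \<noteq> {}" and v: "\<And>i. i \<in> I \<Longrightarrow> v i \<in> sector \<alpha>"
    and v': "\<And>i. i \<in> I \<Longrightarrow> 1 - v i \<in> sector \<alpha>" and \<alpha>: "real (card I) * \<alpha> \<le> pi / 6"
    and v1: "\<And>i. i \<in> I \<Longrightarrow> cmod (v i) \<le> 1" and v2: "\<And>i. i \<in> I \<Longrightarrow> cmod (1 - v i) \<le> 1"
    and w: "\<And>i. i \<in> I \<Longrightarrow> w i = of_real (1 + 1 / real K) * v i"
  shows "cmod (stability_symbol I w ^ k * (\<Prod>i\<in>I. w i)) \<le>
    symbol_const (card I) * (\<Prod>i\<in>I. edge_weight (card I) K (v i))"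
proof -
  define m where "m = card I"
  define \<delta> where "\<delta> = 1 / real K"
  \<comment> \<open>The dilation error per step, in units of 1 / K.\<close>
  define D where "D = 4 * real m * 2 ^ m"
  define Y where "Y = (\<Prod>i\<in>I. cmod (v i))"
  define q where "q = (\<Sum>j\<in>I. cmod (1 - v j)) * Y\<^sup>2 / real m"
  have m: "1 \<le> real m"
    using assms(2,3) by (simp add: m_def Suc_le_eq card_gt_0_iff)
  have \<delta>: "0 \<le> \<delta>" "\<delta> \<le> 1"
    by (simp_all add: \<delta>_def K_def)
  have Y: "0 \<le> Y" "Y \<le> 1"
    using v1 by (auto simp: Y_def intro!: prod_nonneg prod_le_1)
  have "(\<Sum>j\<in>I. cmod (1 - v j)) \<le> real m * 1"
    unfolding m_def by (intro sum_bounded_above v2)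
  then have "(\<Sum>j\<in>I. cmod (1 - v j)) * Y\<^sup>2 \<le> real m * 1"
    using Y by (intro mult_mono power_le_one) auto
  then have q: "0 \<le> q" "q \<le> 1"
    using m by (auto simp: q_def divide_le_eq intro!: divide_nonneg_nonneg mult_nonneg_nonneg sum_nonneg)
  have D: "0 \<le> D"
    by (simp add: D_def)
  have "stability_symbol I w = stability_symbol I (\<lambda>i. of_real (1 + \<delta>) * v i)"
  proof -
    have "(\<Prod>i\<in>I - {j}. w i) = (\<Prod>i\<in>I - {j}. of_real (1 + \<delta>) * v i)" for j
      by (rule prod.cong) (use w in \<open>auto simp: \<delta>_def\<close>)
    then show ?thesis
      unfolding stability_symbol_def using w by (simp only: \<delta>_def cong: sum.cong)
  qed
  then have "cmod (stability_symbol I w) \<le> cmod (stability_symbol I v) + D * \<delta>"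
    using stability_symbol_dilation[of I v \<delta>] assms(2) v1 v2 \<delta> by (simp add: D_def m_def)
  also have "cmod (stability_symbol I v) \<le> exp (- q)"
    using norm_stability_symbol_exp[where v = v, OF assms(2,3) v v' \<alpha> v1] by (simp add: q_def Y_def m_def)
  also have "exp (- q) + D * \<delta> \<le> exp (- q) * (1 + exp 1 * D * \<delta>)"
  proof -
    have "1 \<le> exp (- q) * exp 1"
      using q by (simp add: exp_add[symmetric])
    then have "1 * (D * \<delta>) \<le> exp (- q) * exp 1 * (D * \<delta>)"
      using D \<delta> by (intro mult_right_mono) auto
    then show ?thesis
      by (simp add: distrib_left mult.assoc)
  qed
  also have "\<dots> \<le> exp (- q) * exp (exp 1 * D * \<delta>)"
    by (intro mult_left_mono exp_ge_add_one_self) auto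
  finally have "cmod (stability_symbol I w) ^ k \<le> (exp (- q) * exp (exp 1 * D * \<delta>)) ^ k"
    by (intro power_mono) auto
  also have "\<dots> = exp (- (real k * q) + exp 1 * D * (real k * \<delta>))"
    by (simp add: exp_add[symmetric] exp_of_nat_mult[symmetric] algebra_simps)
  also have "\<dots> \<le> exp (1 + exp 1 * D + - (real K * q))"
  proof -
    have "real k * \<delta> \<le> 1"
      by (simp add: \<delta>_def K_def)
    then have "exp 1 * D * (real k * \<delta>) \<le> exp 1 * D * 1"
      using D by (intro mult_left_mono) auto
    then have "- (real k * q) + exp 1 * D * (real k * \<delta>) \<le> 1 + exp 1 * D + - (real K * q)"
      using q by (simp only: K_def of_nat_add of_nat_1 distrib_right mult_1 mult_1_right)
    then show ?thesis
      by (simp only: exp_le_cancel_iff)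
  qed
  finally have r: "cmod (stability_symbol I w) ^ k \<le> exp (1 + exp 1 * D) * exp (- (real K * q))"
    by (simp only: exp_add)
  have "(\<Prod>i\<in>I. cmod (w i)) = (1 + \<delta>) ^ m * Y"
    using w \<delta> by (simp add: norm_mult \<delta>_def[symmetric] prod.distrib Y_def m_def del: of_real_add cong: prod.cong)
  also have "\<dots> \<le> 2 ^ m * Y"
    using \<delta> Y by (intro mult_right_mono power_mono) auto
  finally have "cmod (stability_symbol I w ^ k * (\<Prod>i\<in>I. w i)) \<le>
      exp (1 + exp 1 * D) * exp (- (real K * q)) * (2 ^ m * Y)"
    using r unfolding norm_mult norm_power prod_norm[symmetric] by (intro mult_mono) (auto intro: prod_nonneg)
  also have "\<dots> = exp (1 + exp 1 * D) * 2 ^ m * (exp (- (real K * q)) * Y)"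
    by simp
  also have "\<dots> \<le> exp (1 + exp 1 * D) * 2 ^ m * (real m powr (1/4) * (\<Prod>i\<in>I. edge_weight m K (v i)))"
    using exp_decay_le_edge_weight[where v = v and K = K, OF assms(2,3) v1]
    by (intro mult_left_mono) (auto simp: q_def Y_def m_def)
  also have "\<dots> = symbol_const m * (\<Prod>i\<in>I. edge_weight m K (v i))"
    by (simp add: symbol_const_def D_def)
  finally show ?thesis
    by (simp add: m_def)
qed

section \<open>Cauchy integrals over a rhombus\<close>

text \<open>One of the two non-real corners of the rhombus; the other one is its conjugate.\<close>

definition apex :: "real \<Rightarrow> complex" where
  "apex \<alpha> = Complex (1/2) (tan \<alpha> / 2)"

text \<open>Only the boundary: the two edges at 0 and the two edges at 1.\<close>

definition rhombus :: "real \<Rightarrow> complex set" where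
  "rhombus \<alpha> = {v. \<exists>s\<in>{0..1}. \<exists>Q\<in>{apex \<alpha>, cnj (apex \<alpha>)}. v = of_real s * Q \<or> v = 1 - of_real s * Q}"

lemma apex_cnj: "1 - apex \<alpha> = cnj (apex \<alpha>)" "1 - cnj (apex \<alpha>) = apex \<alpha>"
  by (simp_all add: complex_eq_iff apex_def)

lemma apex_polar:
  assumes "0 < \<alpha>" and "\<alpha> \<le> pi / 6"
  shows "apex \<alpha> = of_real (cmod (apex \<alpha>)) * cis \<alpha>" and "1/2 \<le> cmod (apex \<alpha>)" and "cmod (apex \<alpha>) \<le> 1"
    and "cos \<alpha> * cmod (apex \<alpha>) = 1/2"
proof -
  have "cos (pi / 3) \<le> cos \<alpha>"
    by (rule cos_monotone_0_pi_le) (use assms in auto)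
  then have c: "1/2 \<le> cos \<alpha>"
    by (simp add: cos_60)
  have eq: "apex \<alpha> = of_real (1 / (2 * cos \<alpha>)) * cis \<alpha>"
    using c by (simp add: complex_eq_iff apex_def tan_def)
  then have n: "cmod (apex \<alpha>) = 1 / (2 * cos \<alpha>)"
    using c by (subst eq) (simp add: norm_mult norm_divide)
  show "apex \<alpha> = of_real (cmod (apex \<alpha>)) * cis \<alpha>" "cos \<alpha> * cmod (apex \<alpha>) = 1/2"
    using eq c unfolding n by simp_all
  show "1/2 \<le> cmod (apex \<alpha>)" "cmod (apex \<alpha>) \<le> 1"
    using c cos_le_one[of \<alpha>] unfolding n by (simp_all add: field_simps)
qed

lemma sector_if_slope:
  assumes "0 < Re z" and "\<bar>Im z\<bar> \<le> tan \<alpha> * Re z" and "0 < \<alpha>" and "\<alpha> < pi / 2"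
  shows "z \<in> sector \<alpha>"
proof -
  have "\<bar>Im z / Re z\<bar> \<le> tan \<alpha>"
    using assms(1,2) by (simp add: divide_le_eq)
  then have "- tan \<alpha> \<le> Im z / Re z" and "Im z / Re z \<le> tan \<alpha>"
    unfolding abs_le_iff by linarith+
  then have "arctan (tan (- \<alpha>)) \<le> arctan (Im z / Re z)" and "arctan (Im z / Re z) \<le> arctan (tan \<alpha>)"
    by (simp_all add: arctan_le_iff)
  then have "\<bar>Arg z\<bar> \<le> \<alpha>"
    using assms arctan_tan[of \<alpha>] arctan_tan[of "- \<alpha>"] by (simp add: arg_conv_arctan abs_le_iff)
  moreover have "z = of_real (cmod z) * cis (Arg z)"
    using rcis_cmod_Arg[of z] by (simp add: rcis_def)
  ultimately show ?thesis
    unfolding sector_def by blast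
qed

lemma rhombus_edge_sector:
  assumes "0 < \<alpha>" and "\<alpha> \<le> pi / 6" and "0 \<le> s" and "s \<le> 1" and Q: "Q = apex \<alpha> \<or> Q = cnj (apex \<alpha>)"
  shows "of_real s * Q \<in> sector \<alpha>" and "1 - of_real s * Q \<in> sector \<alpha>"
    and "cmod (of_real s * Q) \<le> 1" and "cmod (1 - of_real s * Q) \<le> 1" and "1/2 \<le> Re (1 - of_real s * Q)"
proof -
  note P = apex_polar[OF assms(1,2)]
  have normQ: "cmod Q = cmod (apex \<alpha>)"
    using Q by auto
  have "Q = of_real (cmod (apex \<alpha>)) * cis \<alpha> \<or> Q = of_real (cmod (apex \<alpha>)) * cis (- \<alpha>)"
    using Q P(1) by (metis cis_cnj complex_cnj_complex_of_real complex_cnj_mult)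
  then have "of_real s * Q = of_real (s * cmod (apex \<alpha>)) * cis \<alpha> \<or>
      of_real s * Q = of_real (s * cmod (apex \<alpha>)) * cis (- \<alpha>)"
    by (auto simp: mult.assoc)
  moreover have "of_real (s * cmod (apex \<alpha>)) * cis \<alpha> \<in> sector \<alpha>"
    and "of_real (s * cmod (apex \<alpha>)) * cis (- \<alpha>) \<in> sector \<alpha>"
    using assms(1,3) by (auto intro!: sectorI simp del: of_real_mult)
  ultimately show "of_real s * Q \<in> sector \<alpha>"
    by metis
  have le: "s * cmod Q \<le> 1"
    using assms(3,4) P(3) normQ by (simp add: mult_le_one)
  then show "cmod (of_real s * Q) \<le> 1"
    using assms(3) by (simp add: norm_mult)
  have Re: "Re Q = 1/2" and Im: "\<bar>Im Q\<bar> = tan \<alpha> / 2"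
    using Q tan_gt_zero[of \<alpha>] assms(1,2) pi_gt_zero by (auto simp: apex_def)
  show half: "1/2 \<le> Re (1 - of_real s * Q)"
    using assms(4) by (simp add: Re)
  have t: "0 < tan \<alpha>"
    by (rule tan_gt_zero) (use assms(1,2) pi_gt_zero in auto)
  have "s * (tan \<alpha> / 2) \<le> tan \<alpha> * (1 - s / 2)"
    using assms(3,4) t by (simp add: field_simps)
  then have "\<bar>Im (1 - of_real s * Q)\<bar> \<le> tan \<alpha> * Re (1 - of_real s * Q)"
    using assms(3) by (simp add: abs_mult Re Im)
  then show "1 - of_real s * Q \<in> sector \<alpha>"
    by (rule sector_if_slope[rotated]) (use half assms(1,2) pi_gt_zero in auto)
  have "(cmod (1 - of_real s * Q))\<^sup>2 = 1 - s + (s * cmod Q)\<^sup>2"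
    unfolding power_mult_distrib cmod_power2 using Re by (simp add: power2_eq_square algebra_simps)
  also have "(s * cmod Q)\<^sup>2 \<le> s"
  proof -
    have "(s * cmod Q) * (s * cmod Q) \<le> (s * 1) * 1"
      using le assms(3) P(3) normQ by (intro mult_mono mult_left_mono) auto
    then show ?thesis
      by (simp add: power2_eq_square)
  qed
  finally have "(cmod (1 - of_real s * Q))\<^sup>2 \<le> 1\<^sup>2"
    by simp
  then show "cmod (1 - of_real s * Q) \<le> 1"
    by (rule power2_le_imp_le) simp
qed

lemma rhombus_sector:
  assumes "0 < \<alpha>" and "\<alpha> \<le> pi / 6" and "v \<in> rhombus \<alpha>"
  shows "v \<in> sector \<alpha>" and "1 - v \<in> sector \<alpha>" and "cmod v \<le> 1" and "cmod (1 - v) \<le> 1"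
proof -
  obtain s Q where sQ: "s \<in> {0..1}" "Q \<in> {apex \<alpha>, cnj (apex \<alpha>)}"
    and v: "v = of_real s * Q \<or> v = 1 - of_real s * Q"
    using assms(3) unfolding rhombus_def by blast
  then have *: "0 \<le> s" "s \<le> 1" "Q = apex \<alpha> \<or> Q = cnj (apex \<alpha>)"
    by auto
  note e = rhombus_edge_sector[OF assms(1,2) *]
  show "v \<in> sector \<alpha>" "1 - v \<in> sector \<alpha>" "cmod v \<le> 1" "cmod (1 - v) \<le> 1"
    using v e by auto
qed

lemma norm_contour_integral_linepath_le:
  assumes "f contour_integrable_on linepath a e"
    and "\<And>s. 0 < s \<Longrightarrow> s \<le> 1 \<Longrightarrow> cmod (f (linepath a e s)) \<le> h s"
    and "(h has_integral I) {0..1}"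
  shows "cmod (contour_integral (linepath a e) f) \<le> I * cmod (e - a)"
proof -
  let ?g = "\<lambda>s. f (linepath a e s) * (e - a)"
  \<comment> \<open>At the starting point no bound is assumed: the resolvent bound fails at w = 0.\<close>
  let ?g' = "\<lambda>s. if s = 0 then 0 else ?g s"
  let ?h' = "\<lambda>s. if s = 0 then 0 else h s * cmod (e - a)"
  have "(?g has_integral contour_integral (linepath a e) f) {0..1}"
    using has_contour_integral_integral[OF assms(1)] by (simp add: has_contour_integral_linepath)
  then have g': "(?g' has_integral contour_integral (linepath a e) f) {0..1}"
    by (rule has_integral_spike_finite[of "{0}", rotated 2]) auto
  have "((\<lambda>s. h s * cmod (e - a)) has_integral I * cmod (e - a)) {0..1}"
    using assms(3) by (rule has_integral_mult_left)
  then have h': "(?h' has_integral I * cmod (e - a)) {0..1}"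
    by (rule has_integral_spike_finite[of "{0}", rotated 2]) auto
  have "norm (integral {0..1} ?g') \<le> integral {0..1} ?h'"
    by (rule Henstock_Kurzweil_Integration.integral_norm_bound_integral)
      (use g' h' assms(2) in \<open>auto simp: norm_mult mult_right_mono\<close>)
  then show ?thesis
    using integral_unique[OF g'] integral_unique[OF h'] by simp
qed

lemma closed_segment_Im_sign:
  fixes \<sigma> :: real
  assumes "0 < \<sigma> * Im e" and "w \<in> closed_segment (of_real x) e"
  shows "0 \<le> \<sigma> * Im w" and "Im w = 0 \<Longrightarrow> w = of_real x"
proof -
  obtain t where t: "0 \<le> t" "w = of_real x + of_real t * (e - of_real x)"
    using assms(2) by (auto simp: in_segment algebra_simps scaleR_conv_of_real)
  then have eq: "\<sigma> * Im w = t * (\<sigma> * Im e)"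
    by simp
  show "0 \<le> \<sigma> * Im w"
    unfolding eq by (rule mult_nonneg_nonneg[OF t(1) less_imp_le[OF assms(1)]])
  show "Im w = 0 \<Longrightarrow> w = of_real x"
    using t assms(1) by auto
qed

text \<open>The two halves of the rhombus are treated separately because a branch of the logarithm of \<open>w - b\<close> exists on each
  closed half-plane without \<open>b\<close>. Together they show that the winding number is 1.\<close>

lemma contour_integral_half_plane:
  assumes \<sigma>: "\<sigma> \<in> {1, - 1}" "0 < \<sigma> * Im P" and "0 < b" and "b < c"
  shows "((\<lambda>w. 1 / (w - of_real b)) has_contour_integral (of_real (ln b - ln (c - b)) + of_real (\<sigma> * pi) * \<i>))
    (linepath (of_real c) P +++ linepath P 0)"
proof -
  let ?S = "{w. 0 \<le> \<sigma> * Im w} - {complex_of_real b}"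
  let ?g = "linepath (of_real c) P +++ linepath P 0"
  let ?a = "- of_real \<sigma> * \<i>"
  have deriv: "((\<lambda>w. Ln (?a * (w - of_real b))) has_field_derivative 1 / (w - of_real b)) (at w within ?S)"
    if w: "w \<in> ?S" for w
  proof -
    have "?a * (w - of_real b) \<notin> \<real>\<^sub>\<le>\<^sub>0"
      using w \<sigma>(1) by (auto simp: complex_nonpos_Reals_iff complex_eq_iff)
    then show ?thesis
      using w \<sigma>(1) by (auto intro!: derivative_eq_intros simp: divide_simps)
  qed
  have "closed_segment (of_real x) P \<subseteq> ?S" if "x \<noteq> b" for x
    using closed_segment_Im_sign[OF \<sigma>(2), of _ x] that by fastforce
  from this[of c] this[of 0] have "path_image ?g \<subseteq> ?S"
    using assms(3,4) by (simp add: path_image_join closed_segment_commute[of P 0])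
  then have "((\<lambda>w. 1 / (w - of_real b)) has_contour_integral
      (Ln (?a * (pathfinish ?g - of_real b)) - Ln (?a * (pathstart ?g - of_real b)))) ?g"
    using deriv by (intro contour_integral_primitive) auto
  moreover have "Ln (?a * (0 - of_real b)) = of_real (ln b) + of_real (\<sigma> * pi / 2) * \<i>"
    using Ln_times_of_real[of b "\<i>"] Ln_times_of_real[of b "- \<i>"] \<sigma>(1) assms(3) by (auto simp: Ln_of_real algebra_simps)
  moreover have "Ln (?a * (of_real c - of_real b)) = of_real (ln (c - b)) - of_real (\<sigma> * pi / 2) * \<i>"
    using Ln_times_of_real[of "c - b" "\<i>"] Ln_times_of_real[of "c - b" "- \<i>"] Ln_of_real[of "c - b"] \<sigma>(1) assms(4)
    by (auto simp: algebra_simps)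
  ultimately have "((\<lambda>w. 1 / (w - of_real b)) has_contour_integral
      (of_real (ln b) + of_real (\<sigma> * pi / 2) * \<i> - (of_real (ln (c - b)) - of_real (\<sigma> * pi / 2) * \<i>))) ?g"
    by (simp only: pathstart_join pathfinish_join pathstart_linepath pathfinish_linepath)
  then show ?thesis
    by (simp add: algebra_simps)
qed

text \<open>The contour passes through 0. That is harmless, since the spectrum is finite and \<open>b\<close> is positive; the integrals are
  oriented such that each edge starts on the real line.\<close>

lemma cauchy_rhombus:
  fixes b c :: real and F :: "complex \<Rightarrow> complex"
  assumes "0 < Im P" and "0 < b" and "b < c" and "F holomorphic_on UNIV"
  defines "f \<equiv> \<lambda>w. F w / (w - of_real b)"
  shows "2 * of_real pi * \<i> * F (of_real b) =
      contour_integral (linepath 0 (cnj P)) f - contour_integral (linepath (of_real c) (cnj P)) f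
      + contour_integral (linepath (of_real c) P) f - contour_integral (linepath 0 P) f"
    and "a \<in> {0, of_real c} \<Longrightarrow> Q \<in> {P, cnj P} \<Longrightarrow> f contour_integrable_on linepath a Q"
proof -
  let ?u = "\<lambda>Q. linepath (of_real c) Q +++ linepath Q 0"
  let ?\<gamma> = "?u P +++ reversepath (?u (cnj P))"
  have off: "of_real b \<notin> closed_segment a Q"
    if "a \<in> {0, of_real c}" "Q \<in> {P, cnj P}" for a Q
  proof -
    obtain \<sigma> :: real where "0 < \<sigma> * Im Q"
      using assms(1) \<open>Q \<in> {P, cnj P}\<close> that[of 1] that[of "- 1"] by auto
    then show ?thesis
      using closed_segment_Im_sign(2)[of \<sigma> Q "of_real b" 0] closed_segment_Im_sign(2)[of \<sigma> Q "of_real b" c]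
        that(1) assms(2,3) by auto
  qed
  have off': "of_real b \<notin> closed_segment Q a" if "a \<in> {0, of_real c}" "Q \<in> {P, cnj P}" for a Q
    unfolding closed_segment_commute[of Q a] by (rule off[OF that])
  have cont: "continuous_on S f" if "of_real b \<notin> S" for S
    unfolding f_def using that assms(4)
    by (intro continuous_on_divide continuous_intros holomorphic_on_imp_continuous_on)
      (auto intro: holomorphic_on_subset)
  have int: "f contour_integrable_on linepath a Q" "f contour_integrable_on linepath Q a"
    if "a \<in> {0, of_real c}" "Q \<in> {P, cnj P}" for a Q
    using off[OF that] off'[OF that] by (auto intro!: contour_integrable_continuous_linepath cont)
  show "a \<in> {0, of_real c} \<Longrightarrow> Q \<in> {P, cnj P} \<Longrightarrow> f contour_integrable_on linepath a Q"
    using int by blast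
  have valid: "valid_path ?\<gamma>" "pathfinish ?\<gamma> = pathstart ?\<gamma>"
    by (auto intro!: valid_path_join simp: valid_path_reversepath)
  have image: "of_real b \<notin> path_image ?\<gamma>"
    using off off' by (simp add: path_image_join)
  have "((\<lambda>w. 1 / (w - of_real b)) has_contour_integral
      (of_real (ln b - ln (c - b)) + of_real (1 * pi) * \<i>) + - (of_real (ln b - ln (c - b)) + of_real (- 1 * pi) * \<i>)) ?\<gamma>"
    by (intro has_contour_integral_join has_contour_integral_reversepath contour_integral_half_plane valid_path_join
        valid_path_reversepath[THEN iffD2]) (use assms in auto)
  then have "contour_integral ?\<gamma> (\<lambda>w. 1 / (w - of_real b)) = 2 * of_real pi * \<i>"
    by (simp add: contour_integral_unique)
  then have "winding_number ?\<gamma> (of_real b) = 1"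
    using winding_number_valid_path[OF valid(1) image] by simp
  moreover have "path_image ?\<gamma> \<subseteq> UNIV - {of_real b}"
    using image by blast
  ultimately have "(f has_contour_integral (2 * of_real pi * \<i> * 1 * F (of_real b))) ?\<gamma>"
    using Cauchy_integral_formula_convex_simple[of UNIV F "of_real b" ?\<gamma>] assms(4) valid by (simp add: f_def)
  moreover have "(f has_contour_integral
      (contour_integral (linepath (of_real c) P) f + contour_integral (linepath P 0) f) +
      - (contour_integral (linepath (of_real c) (cnj P)) f + contour_integral (linepath (cnj P) 0) f)) ?\<gamma>"
    by (intro has_contour_integral_join has_contour_integral_reversepath has_contour_integral_integral int valid_path_join
        valid_path_reversepath[THEN iffD2]) auto
  moreover have "contour_integral (linepath Q 0) f = - contour_integral (linepath 0 Q) f" for Q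
    using contour_integral_reversepath[of "linepath 0 Q" f] by simp
  ultimately show "2 * of_real pi * \<i> * F (of_real b) =
      contour_integral (linepath 0 (cnj P)) f - contour_integral (linepath (of_real c) (cnj P)) f
      + contour_integral (linepath (of_real c) P) f - contour_integral (linepath 0 P) f"
    using has_contour_integral_unique by fastforce
qed

text \<open>This is where the dependence on \<open>K\<close> disappears.\<close>

lemma has_integral_edge_weight:
  fixes K :: nat and \<epsilon> :: real
  assumes "0 < \<epsilon>" and "1 \<le> K"
  obtains I where "((\<lambda>s. real K * (1 + real K * s / 2) powr (- \<epsilon> - 1)) has_integral I) {0..1}" and "I \<le> 2 / \<epsilon>"
proof -
  let ?G = "\<lambda>s. - (2 / \<epsilon>) * (1 + real K * s / 2) powr (- \<epsilon>)"
  have "((\<lambda>s. real K * (1 + real K * s / 2) powr (- \<epsilon> - 1)) has_integral ?G 1 - ?G 0) {0..1}"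
  proof (rule fundamental_theorem_of_calculus)
    fix s :: real assume s: "s \<in> {0..1}"
    then have pos: "0 < 1 + real K * s / 2"
      by (intro add_pos_nonneg) auto
    have "(?G has_real_derivative - (2 / \<epsilon>) * ((- \<epsilon>) * (1 + real K * s / 2) powr (- \<epsilon> - 1) * (real K / 2))) (at s within {0..1})"
      using pos by (auto intro!: derivative_eq_intros)
    moreover have "- (2 / \<epsilon>) * ((- \<epsilon>) * (1 + real K * s / 2) powr (- \<epsilon> - 1) * (real K / 2))
        = real K * (1 + real K * s / 2) powr (- \<epsilon> - 1)"
      using assms(1) by simp
    ultimately show "(?G has_vector_derivative real K * (1 + real K * s / 2) powr (- \<epsilon> - 1)) (at s within {0..1})"
      by (simp only: has_real_derivative_iff_has_vector_derivative)
  qed simp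
  moreover have "?G 1 - ?G 0 \<le> 2 / \<epsilon>"
    using assms(1) by simp
  ultimately show thesis
    by (rule that)
qed

definition edge_const :: "real \<Rightarrow> real" where
  "edge_const \<alpha> = 1 + 2 * resolvent_const (cos \<alpha>) / (1 - cos \<alpha>)"

text \<open>The bound of \<open>multiplier_bound_inverse_shift\<close>.\<close>

definition resolvent_weight :: "real \<Rightarrow> complex \<Rightarrow> real" where
  "resolvent_weight \<alpha> w = (1 + resolvent_const (cos \<alpha>) / cmod (1 - w)) / cmod w"

lemma resolvent_weight_nonneg: "0 \<le> resolvent_weight \<alpha> w"
  by (simp add: resolvent_weight_def resolvent_const_def)

context
  fixes \<alpha> :: real
  assumes \<alpha>: "0 < \<alpha>" "\<alpha> \<le> pi / 6"
begin

lemma cos_apex: "0 \<le> cos \<alpha>" "cos \<alpha> < 1"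
proof -
  show "0 \<le> cos \<alpha>"
    by (rule cos_ge_zero) (use \<alpha> pi_gt_zero in auto)
  have "cos \<alpha> < cos 0"
    by (rule cos_monotone_0_pi) (use \<alpha> pi_gt_zero in auto)
  then show "cos \<alpha> < 1"
    by simp
qed

lemma edge_const_ge_1: "1 \<le> edge_const \<alpha>"
  using cos_apex by (simp add: edge_const_def resolvent_const_def)

lemma Re_edge: "Q = apex \<alpha> \<or> Q = cnj (apex \<alpha>) \<Longrightarrow> 0 \<le> r \<Longrightarrow> Re (of_real r * Q) = cos \<alpha> * cmod (of_real r * Q)"
  using apex_polar(4)[OF \<alpha>] by (auto simp: norm_mult apex_def)

text \<open>On the edges at 0 the resolvent bound is of size \<open>1 / cmod w\<close>, and \<open>cmod (1 - w)\<close> is bounded below.\<close>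

lemma resolvent_edge_zero:
  assumes "Q = apex \<alpha> \<or> Q = cnj (apex \<alpha>)" and "0 < s" and "s \<le> 1" and "1 \<le> K"
  defines "v \<equiv> of_real s * Q"
  defines "w \<equiv> of_real (1 + 1 / real K) * v"
  shows "w \<noteq> 0" and "w \<noteq> 1" and "Re ((1 - w) / w) \<le> cos \<alpha> * cmod ((1 - w) / w)"
    and "edge_weight m K v * resolvent_weight \<alpha> w \<le> 2 * edge_const \<alpha> * s powr (-1/2)"
proof -
  note P = apex_polar[OF \<alpha>]
  define c where "c = 1 + 1 / real K"
  have c: "1 \<le> c"
    by (simp add: c_def)
  have normQ: "cmod Q = cmod (apex \<alpha>)"
    using assms(1) by auto
  have v: "cmod v = s * cmod Q" and wv: "cmod w = c * cmod v"
    using assms(2) by (simp_all add: v_def w_def c_def norm_mult abs_of_nonneg del: of_real_add)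
  have v_lower: "s / 2 \<le> cmod v"
    using P(2) assms(2) unfolding v normQ by simp
  then have v0: "0 < cmod v"
    using assms(2) by linarith
  have vw: "cmod v \<le> cmod w"
    unfolding wv using c v0 by simp
  show w0: "w \<noteq> 0"
    using v0 vw by auto
  have Rew: "Re w = cos \<alpha> * cmod w"
    using Re_edge[OF assms(1), of "c * s"] c assms(2) by (simp add: w_def v_def c_def mult.assoc)
  then have Rew': "Re w \<le> cos \<alpha> * cmod w"
    by simp
  have "(1 - cos \<alpha>) / 2 * (cmod w + 1) \<le> cmod (w - of_real 1)"
    by (rule norm_diff_sector) (use Rew' cos_apex in auto)
  moreover have "(1 - cos \<alpha>) / 2 * 1 \<le> (1 - cos \<alpha>) / 2 * (cmod w + 1)"
    using cos_apex by (intro mult_left_mono) auto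
  ultimately have w1: "(1 - cos \<alpha>) / 2 \<le> cmod (1 - w)"
    by (simp add: norm_minus_commute)
  then show "w \<noteq> 1"
    using cos_apex by auto
  have "Re (1 / w) \<le> cos \<alpha> * cmod (1 / w)"
    using Rew' by (simp only: sector_inverse)
  then have "Re (1 / w - of_real 1) \<le> cos \<alpha> * cmod (1 / w - of_real 1)"
    using cos_apex by (intro shift_left_sector) auto
  then show "Re ((1 - w) / w) \<le> cos \<alpha> * cmod ((1 - w) / w)"
    using w0 by (simp add: diff_divide_distrib)
  have R: "0 \<le> resolvent_const (cos \<alpha>)"
    by (simp add: resolvent_const_def)
  have "resolvent_const (cos \<alpha>) / cmod (1 - w) \<le> resolvent_const (cos \<alpha>) / ((1 - cos \<alpha>) / 2)"
    by (intro divide_left_mono w1 R mult_pos_pos) (use cos_apex w1 in \<open>auto intro: order_less_le_trans\<close>)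
  then have 1: "1 + resolvent_const (cos \<alpha>) / cmod (1 - w) \<le> edge_const \<alpha>"
    by (simp add: edge_const_def mult.commute)
  have "(1 + real K * cmod (1 - v)) powr (- (1 / (4 * real m))) \<le> 1 powr (- (1 / (4 * real m)))"
    by (rule powr_mono2') auto
  then have "edge_weight m K v \<le> cmod v powr (1/2) * 1"
    unfolding edge_weight_def by (intro mult_left_mono) auto
  then have ew: "edge_weight m K v \<le> cmod v powr (1/2)"
    by simp
  have "resolvent_weight \<alpha> w \<le> edge_const \<alpha> / cmod v"
    unfolding resolvent_weight_def by (rule frac_le[OF _ 1 v0 vw]) (use edge_const_ge_1 in simp)
  then have "edge_weight m K v * resolvent_weight \<alpha> w \<le>
      cmod v powr (1/2) * (edge_const \<alpha> / cmod v)"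
    by (rule mult_mono[OF ew]) (auto simp: resolvent_weight_nonneg)
  also have "\<dots> = edge_const \<alpha> * (cmod v powr (1/2) / cmod v powr 1)"
    using v0 by simp
  also have "cmod v powr (1/2) / cmod v powr 1 = cmod v powr (-1/2)"
    by (simp only: powr_diff[symmetric]) simp
  also have "edge_const \<alpha> * cmod v powr (-1/2) \<le> edge_const \<alpha> * (s / 2) powr (-1/2)"
    using v_lower assms(2) edge_const_ge_1 by (intro mult_left_mono powr_mono2') auto
  also have "(s / 2) powr (-1/2) \<le> 2 * s powr (-1/2)"
  proof -
    have "(s / 2) powr (-1/2) = s powr (-1/2) * 2 powr (1/2)"
      using assms(2) by (simp add: powr_divide powr_minus_divide)
    moreover have "2 powr (1/2) \<le> (2::real) powr 1"
      by (intro powr_mono) auto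
    then have "2 powr (1/2) * s powr (-1/2) \<le> 2 powr 1 * s powr (-1/2)"
      by (rule mult_right_mono) simp
    ultimately show ?thesis
      by (simp add: mult.commute)
  qed
  finally show "edge_weight m K v * resolvent_weight \<alpha> w \<le> 2 * edge_const \<alpha> * s powr (-1/2)"
    using edge_const_ge_1 by (simp add: mult_left_mono)
qed

text \<open>On the edges at 1 the resolvent bound is of size \<open>1 / cmod (1 - w)\<close>, and \<open>1 - w\<close> arises from a point on the
  boundary of the sector by the shift \<open>1 / K\<close> to the left. Its modulus is thus comparable to
  \<open>s / 2 + 1 / K = (1 + K * s / 2) / K\<close>.\<close>

lemma resolvent_edge_one:
  assumes "Q = apex \<alpha> \<or> Q = cnj (apex \<alpha>)" and "0 < s" and "s \<le> 1" and "1 \<le> K" and "1 \<le> m"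
  defines "v \<equiv> 1 - of_real s * Q"
  defines "w \<equiv> of_real (1 + 1 / real K) * v"
  shows "w \<noteq> 0" and "w \<noteq> 1" and "Re ((1 - w) / w) \<le> cos \<alpha> * cmod ((1 - w) / w)"
    and "edge_weight m K v * resolvent_weight \<alpha> w \<le>
      4 * edge_const \<alpha> * (real K * (1 + real K * s / 2) powr (- (1 / (4 * real m)) - 1))"
proof -
  note P = apex_polar[OF \<alpha>]
  define c where "c = 1 + 1 / real K"
  define Z where "Z = of_real (c * s) * Q"
  have c: "1 \<le> c" "c \<le> 2"
    using assms(4) by (simp_all add: c_def)
  have normQ: "cmod Q = cmod (apex \<alpha>)"
    using assms(1) by auto
  note edge = rhombus_edge_sector[OF \<alpha> less_imp_le[OF assms(2)] assms(3,1)]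
  have v: "1/2 \<le> cmod v" "cmod v \<le> 1"
    using edge(4,5) complex_Re_le_cmod[of v] by (auto simp: v_def)
  have "cmod w = c * cmod v"
    using c by (simp add: w_def c_def norm_mult del: of_real_add)
  then have w: "1/2 \<le> cmod w"
    using v(1) c(1) mult_mono[of 1 c "1/2" "cmod v"] by simp
  then show w0: "w \<noteq> 0"
    by auto
  have one_w: "1 - w = Z - of_real (1 / real K)"
    by (simp add: w_def v_def Z_def c_def algebra_simps)
  have ReZ: "Re Z \<le> cos \<alpha> * cmod Z"
    using Re_edge[OF assms(1), of "c * s"] c assms(2) by (simp add: Z_def)
  have "cmod Z = c * (s * cmod Q)"
    using c assms(2) by (simp add: Z_def norm_mult)
  moreover have "1 * (s * (1/2)) \<le> c * (s * cmod Q)"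
    using c P(2) assms(2) normQ by (intro mult_mono) auto
  ultimately have Zs: "s / 2 \<le> cmod Z"
    by simp
  define r where "r = s / 2 + 1 / real K"
  have r: "0 < r" "r \<le> 2"
  proof -
    have "1 / real K \<le> 1" and "0 \<le> 1 / real K"
      using assms(4) by simp_all
    then show "0 < r" "r \<le> 2"
      using assms(2,3) unfolding r_def by linarith+
  qed
  have "(1 - cos \<alpha>) / 2 * r \<le> (1 - cos \<alpha>) / 2 * (cmod Z + 1 / real K)"
    using Zs cos_apex by (intro mult_left_mono) (auto simp: r_def)
  also have "\<dots> \<le> cmod (1 - w)"
    unfolding one_w using ReZ cos_apex by (intro norm_diff_sector) auto
  finally have w1: "(1 - cos \<alpha>) / 2 * r \<le> cmod (1 - w)" .
  moreover have pos: "0 < (1 - cos \<alpha>) / 2 * r"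
    using cos_apex r by simp
  ultimately show w1': "w \<noteq> 1"
    by auto
  have "Re (1 - w) \<le> cos \<alpha> * cmod (1 - w)"
    unfolding one_w using ReZ cos_apex by (intro shift_left_sector) auto
  then have "Re (1 / (1 - w)) \<le> cos \<alpha> * cmod (1 / (1 - w))"
    by (simp only: sector_inverse)
  then have "Re (1 / (1 - w) - of_real 1) \<le> cos \<alpha> * cmod (1 / (1 - w) - of_real 1)"
    using cos_apex by (intro shift_left_sector) auto
  moreover have "1 / (1 - w) - of_real 1 = 1 / ((1 - w) / w)"
    using w0 w1' by (simp add: field_simps)
  ultimately show "Re ((1 - w) / w) \<le> cos \<alpha> * cmod ((1 - w) / w)"
    by (simp only: sector_inverse)
  have R: "0 \<le> resolvent_const (cos \<alpha>)"
    by (simp add: resolvent_const_def)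
  have "resolvent_const (cos \<alpha>) / cmod (1 - w) \<le> resolvent_const (cos \<alpha>) / ((1 - cos \<alpha>) / 2 * r)"
    by (rule divide_left_mono[OF w1 R mult_pos_pos[OF _ pos]]) (use pos w1 in linarith)
  also have "\<dots> = (edge_const \<alpha> - 1) / r"
    by (simp add: edge_const_def mult.commute)
  finally have "1 + resolvent_const (cos \<alpha>) / cmod (1 - w) \<le> (r + edge_const \<alpha> - 1) / r"
    using r by (simp add: add_divide_distrib diff_divide_distrib)
  also have "\<dots> \<le> 2 * edge_const \<alpha> / r"
    using r edge_const_ge_1 by (intro divide_right_mono) auto
  finally have "resolvent_weight \<alpha> w \<le> (2 * edge_const \<alpha> / r) / (1/2)"
    unfolding resolvent_weight_def using w R r edge_const_ge_1 by (intro frac_le) auto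
  also have "\<dots> = 4 * edge_const \<alpha> * (real K * (1 + real K * s / 2) powr (-1))"
  proof -
    have "r = (1 + real K * s / 2) / real K"
      using assms(4) by (simp add: r_def field_simps)
    moreover have "0 < 1 + real K * s / 2"
      using assms(2) by (intro add_pos_nonneg) auto
    ultimately show ?thesis
      by (simp add: powr_minus_divide)
  qed
  finally have 1: "resolvent_weight \<alpha> w \<le>
     4 * edge_const \<alpha> * (real K * (1 + real K * s / 2) powr (-1))" .
  have x: "s / 2 \<le> cmod (1 - v)"
    using P(2) normQ assms(2) by (simp add: v_def norm_mult)
  have "edge_weight m K v \<le> 1 * (1 + real K * s / 2) powr (- (1 / (4 * real m)))"
    unfolding edge_weight_def
  proof (rule mult_mono)
    show "cmod v powr (1/2) \<le> 1"
      using v powr_mono2[of "1/2" "cmod v" 1] by simp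
    have "1 + real K * s / 2 \<le> 1 + real K * cmod (1 - v)"
      using mult_left_mono[OF x, of "real K"] by simp
    then show "(1 + real K * cmod (1 - v)) powr (- (1 / (4 * real m))) \<le> (1 + real K * s / 2) powr (- (1 / (4 * real m)))"
      using assms(2) by (intro powr_mono2' add_pos_nonneg) auto
  qed auto
  then have "edge_weight m K v * resolvent_weight \<alpha> w \<le>
     (1 + real K * s / 2) powr (- (1 / (4 * real m))) * (4 * edge_const \<alpha> * (real K * (1 + real K * s / 2) powr (-1)))"
    by (intro mult_mono 1) (auto simp: resolvent_weight_nonneg)
  also have "\<dots> = 4 * edge_const \<alpha> * (real K * ((1 + real K * s / 2) powr (- (1 / (4 * real m))) * (1 + real K * s / 2) powr (-1)))"
    by (simp only: ac_simps)
  also have "\<dots> = 4 * edge_const \<alpha> * (real K * (1 + real K * s / 2) powr (- (1 / (4 * real m)) - 1))"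
    by (simp only: powr_add[symmetric]) simp
  finally show "edge_weight m K v * resolvent_weight \<alpha> w \<le>
      4 * edge_const \<alpha> * (real K * (1 + real K * s / 2) powr (- (1 / (4 * real m)) - 1))" .
qed


lemma multiplier_bound_on_edge:
  assumes "j \<in> {1..m}" and "0 < a"
    and "\<And>p. p \<in> mindices m N \<Longrightarrow> b p = 1 / (1 + a * (1 - cos (pi * real (p j) / (real (N j) + 1))))"
    and "w \<noteq> 0" and "w \<noteq> 1" and "Re ((1 - w) / w) \<le> cos \<alpha> * cmod ((1 - w) / w)"
    and "g * resolvent_weight \<alpha> w \<le> B" and "0 \<le> M"
    and "multiplier_bound m N (F w) (M * g)" and d: "\<forall>k\<in>mindices m N. cmod (d k) \<le> \<delta>" and k: "k \<in> mindices m N"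
  shows "cmod (dst m N (\<lambda>p. F w p * (1 / (w - of_real (b p))) * dst m N d p) k) \<le> M * \<delta> * B"
proof -
  have "0 \<le> \<delta>"
    using d k norm_ge_zero order_trans by blast
  have "multiplier_bound m N (\<lambda>p. 1 / (w - of_real (b p))) (resolvent_weight \<alpha> w)"
    unfolding resolvent_weight_def by (rule multiplier_bound_inverse_shift[OF assms(1,2,4,5,6)]) (use cos_apex assms(3) in auto)
  then have "multiplier_bound m N (\<lambda>p. F w p * (1 / (w - of_real (b p))))
      (M * g * resolvent_weight \<alpha> w)"
    using assms(9) by (intro multiplier_bound_mult)
  then have "cmod (dst m N (\<lambda>p. F w p * (1 / (w - of_real (b p))) * dst m N d p) k) \<le>
      M * g * resolvent_weight \<alpha> w * \<delta>"
    using d k unfolding multiplier_bound_def by blast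
  also have "\<dots> = M * \<delta> * (g * resolvent_weight \<alpha> w)"
    by (simp only: ac_simps)
  also have "\<dots> \<le> M * \<delta> * B"
    using assms(7,8) \<open>0 \<le> \<delta>\<close> by (intro mult_left_mono) auto
  finally show ?thesis .
qed

definition contour_const :: "nat \<Rightarrow> real" where
  "contour_const m = (8 + 64 * real m) * edge_const \<alpha>"

text \<open>Cauchy's formula, applied for each mode in one variable, writes the operator as an integral of operators with symbol
  \<open>F w p / (w - b p)\<close>. Both factors are bounded in the maximum norm, and the product of the bounds is
  integrable along the contour.\<close>

lemma multiplier_bound_cauchy:
  fixes F :: "complex \<Rightarrow> (nat \<Rightarrow> nat) \<Rightarrow> complex"
  assumes "j \<in> {1..m}" and "0 < a" and "1 \<le> K" and "0 \<le> M"
    and b: "\<And>p. p \<in> mindices m N \<Longrightarrow> b p = 1 / (1 + a * (1 - cos (pi * real (p j) / (real (N j) + 1))))"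
    and hol: "\<And>p. (\<lambda>w. F w p) holomorphic_on UNIV"
    and F: "\<And>v. v \<in> rhombus \<alpha> \<Longrightarrow> multiplier_bound m N (F (of_real (1 + 1 / real K) * v)) (M * edge_weight m K v)"
  shows "multiplier_bound m N (\<lambda>p. F (of_real (b p)) p) (contour_const m * M)"
  unfolding multiplier_bound_def
proof (intro allI impI ballI)
  fix d \<delta> k assume d: "\<forall>k\<in>mindices m N. cmod (d k) \<le> \<delta>" and k: "k \<in> mindices m N"
  note P = apex_polar[OF \<alpha>]
  define c where "c = 1 + 1 / real K"
  define P where "P = of_real c * apex \<alpha>"
  define H where "H w = dst m N (\<lambda>p. F w p * (1 / (w - of_real (b p))) * dst m N d p) k" for w
  define f where "f p w = F w p / (w - of_real (b p))" for p w
  define e where "e p = of_real (mode m N k p) * dst m N d p" for p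
  have H: "H w = (\<Sum>p\<in>mindices m N. e p * f p w)" for w
    unfolding H_def f_def e_def dst_def[of m N "\<lambda>p. F w p * (1 / (w - of_real (b p))) * dst m N d p"]
    by (rule sum.cong) simp_all
  have \<delta>: "0 \<le> \<delta>"
    using d k norm_ge_zero order_trans by blast
  have c: "1 < c" "c \<le> 2"
    using assms(3) by (simp_all add: c_def)
  have "0 < tan \<alpha>"
    by (rule tan_gt_zero) (use \<alpha> pi_gt_zero in auto)
  then have ImP: "0 < Im P"
    using c by (simp add: P_def apex_def)
  have b01: "0 < b p" "b p < c" if p: "p \<in> mindices m N" for p
  proof -
    have "p j \<in> {1..N j}"
      using mindices_component[OF p assms(1)] .
    then have "0 < pi * real (p j) / (real (N j) + 1)" "pi * real (p j) / (real (N j) + 1) \<le> pi"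
      by (auto simp: divide_le_eq)
    then have "cos (pi * real (p j) / (real (N j) + 1)) < cos 0"
      by (intro cos_monotone_0_pi) auto
    then have "0 < a * (1 - cos (pi * real (p j) / (real (N j) + 1)))"
      using assms(2) by simp
    then have "0 < b p" "b p < 1"
      using b[OF p] by auto
    then show "0 < b p" "b p < c"
      using c by auto
  qed
  have cauchy: "2 * of_real pi * \<i> * F (of_real (b p)) p =
      contour_integral (linepath 0 (cnj P)) (f p) - contour_integral (linepath (of_real c) (cnj P)) (f p)
      + contour_integral (linepath (of_real c) P) (f p) - contour_integral (linepath 0 P) (f p)"
    and int: "x \<in> {0, of_real c} \<Longrightarrow> Q \<in> {P, cnj P} \<Longrightarrow> f p contour_integrable_on linepath x Q"
    if "p \<in> mindices m N" for p x Q
    unfolding f_def by (fact cauchy_rhombus[OF ImP b01[OF that] hol[of p]])+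
  have sum_int: "contour_integral (linepath x Q) H = (\<Sum>p\<in>mindices m N. e p * contour_integral (linepath x Q) (f p))"
    and H_int: "H contour_integrable_on linepath x Q"
    if "x \<in> {0, of_real c}" "Q \<in> {P, cnj P}" for x Q
  proof -
    have "(H has_contour_integral (\<Sum>p\<in>mindices m N. e p * contour_integral (linepath x Q) (f p))) (linepath x Q)"
      unfolding H by (intro has_contour_integral_sum has_contour_integral_lmul has_contour_integral_integral int that) auto
    then show "contour_integral (linepath x Q) H = (\<Sum>p\<in>mindices m N. e p * contour_integral (linepath x Q) (f p))"
      and "H contour_integrable_on linepath x Q"
      by (auto simp: contour_integral_unique contour_integrable_on_def)
  qed
  \<comment> \<open>The sum over the modes is finite and commutes with the integrals.\<close>
  have rep: "2 * of_real pi * \<i> * dst m N (\<lambda>p. F (of_real (b p)) p * dst m N d p) k =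
      contour_integral (linepath 0 (cnj P)) H - contour_integral (linepath (of_real c) (cnj P)) H
      + contour_integral (linepath (of_real c) P) H - contour_integral (linepath 0 P) H"
  proof -
    have "2 * of_real pi * \<i> * dst m N (\<lambda>p. F (of_real (b p)) p * dst m N d p) k =
        (\<Sum>p\<in>mindices m N. e p * (2 * of_real pi * \<i> * F (of_real (b p)) p))"
      by (simp add: dst_def[of m N "\<lambda>p. F (of_real (b p)) p * _ p"] e_def sum_distrib_left ac_simps)
    also have "\<dots> = (\<Sum>p\<in>mindices m N. e p * (contour_integral (linepath 0 (cnj P)) (f p)
        - contour_integral (linepath (of_real c) (cnj P)) (f p)
        + contour_integral (linepath (of_real c) P) (f p) - contour_integral (linepath 0 P) (f p)))"
      by (rule sum.cong) (simp_all only: cauchy)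
    also have "\<dots> = contour_integral (linepath 0 (cnj P)) H - contour_integral (linepath (of_real c) (cnj P)) H
      + contour_integral (linepath (of_real c) P) H - contour_integral (linepath 0 P) H"
      by (simp add: sum_int sum.distrib sum_subtractf distrib_left right_diff_distrib)
    finally show ?thesis .
  qed
  have m: "1 \<le> m"
    using assms(1) by auto
  have Q: "Q = of_real c * apex \<alpha> \<or> Q = of_real c * cnj (apex \<alpha>)" if "Q \<in> {P, cnj P}" for Q
    using that by (auto simp: P_def)
  have zero: "cmod (contour_integral (linepath 0 Q) H) \<le> 8 * edge_const \<alpha> * (M * \<delta>)" if Qin: "Q \<in> {P, cnj P}" for Q
  proof -
    obtain R where R: "R = apex \<alpha> \<or> R = cnj (apex \<alpha>)" "Q = of_real c * R"
      using Q[OF Qin] by blast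
    have hI: "((\<lambda>s. M * \<delta> * (2 * edge_const \<alpha> * s powr (-1/2))) has_integral M * \<delta> * (2 * edge_const \<alpha> * (1 powr (-1/2 + 1) / (-1/2 + 1)))) {0..1}"
      by (intro has_integral_mult_right has_integral_powr_from_0) auto
    have hb: "cmod (H (linepath 0 Q s)) \<le> M * \<delta> * (2 * edge_const \<alpha> * s powr (-1/2))" if s: "0 < s" "s \<le> 1" for s
    proof -
      have eq: "linepath 0 Q s = of_real (1 + 1 / real K) * (of_real s * R)"
        by (simp add: linepath_def R(2) c_def scaleR_conv_of_real)
      have "of_real s * R \<in> rhombus \<alpha>"
        using R(1) s unfolding rhombus_def by force
      then have "multiplier_bound m N (F (of_real (1 + 1 / real K) * (of_real s * R))) (M * edge_weight m K (of_real s * R))"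
        by (rule F)
      then show ?thesis
        unfolding eq H_def
        by (intro multiplier_bound_on_edge[where g = "edge_weight m K (of_real s * R)" and F = F and b = b and a = a and j = j]
            resolvent_edge_zero[OF R(1) s assms(3)] assms(1,2,4) b d k)
    qed
    have "cmod (contour_integral (linepath 0 Q) H) \<le>
        M * \<delta> * (2 * edge_const \<alpha> * (1 powr (-1/2 + 1) / (-1/2 + 1))) * cmod (Q - 0)"
      by (rule norm_contour_integral_linepath_le[OF H_int[OF _ Qin] hb hI]) simp_all
    also have "\<dots> \<le> M * \<delta> * (2 * edge_const \<alpha> * (1 powr (-1/2 + 1) / (-1/2 + 1))) * 2"
    proof (rule mult_left_mono)
      have "cmod Q = c * cmod (apex \<alpha>)"
        using R c by (auto simp: norm_mult)
      also have "\<dots> \<le> 2 * 1"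
        using c P(3) by (intro mult_mono) auto
      finally show "cmod (Q - 0) \<le> 2"
        by simp
    qed (use assms(4) \<delta> edge_const_ge_1 in auto)
    finally show ?thesis
      by (simp add: ac_simps)
  qed
  have one: "cmod (contour_integral (linepath (of_real c) Q) H) \<le> 64 * real m * edge_const \<alpha> * (M * \<delta>)" if Qin: "Q \<in> {P, cnj P}" for Q
  proof -
    obtain R where R: "R = apex \<alpha> \<or> R = cnj (apex \<alpha>)" "of_real c * (1 - R) = Q"
      using Q[OF Qin] apex_cnj by metis
    obtain I where I: "((\<lambda>s. real K * (1 + real K * s / 2) powr (- (1 / (4 * real m)) - 1)) has_integral I) {0..1}"
      "I \<le> 2 / (1 / (4 * real m))"
      using has_integral_edge_weight[of "1 / (4 * real m)" K] m assms(3) by auto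
    have I0: "0 \<le> I"
      by (rule has_integral_nonneg[OF I(1)]) auto
    have hI: "((\<lambda>s. M * \<delta> * (4 * edge_const \<alpha> * (real K * (1 + real K * s / 2) powr (- (1 / (4 * real m)) - 1))))
        has_integral M * \<delta> * (4 * edge_const \<alpha> * I)) {0..1}"
      by (intro has_integral_mult_right I)
    have hb: "cmod (H (linepath (of_real c) Q s)) \<le>
        M * \<delta> * (4 * edge_const \<alpha> * (real K * (1 + real K * s / 2) powr (- (1 / (4 * real m)) - 1)))" if s: "0 < s" "s \<le> 1" for s
    proof -
      have eq: "linepath (of_real c) Q s = of_real (1 + 1 / real K) * (1 - of_real s * R)"
        unfolding linepath_def R(2)[symmetric] c_def[symmetric] scaleR_conv_of_real
        by (simp add: algebra_simps)
      have "1 - of_real s * R \<in> rhombus \<alpha>"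
        using R(1) s unfolding rhombus_def by force
      then have "multiplier_bound m N (F (of_real (1 + 1 / real K) * (1 - of_real s * R))) (M * edge_weight m K (1 - of_real s * R))"
        by (rule F)
      then show ?thesis
        unfolding eq H_def
        by (intro multiplier_bound_on_edge[where g = "edge_weight m K (1 - of_real s * R)" and F = F and b = b and a = a and j = j]
            resolvent_edge_one[OF R(1) s assms(3) m] assms(1,2,4) b d k)
    qed
    have "cmod (contour_integral (linepath (of_real c) Q) H) \<le>
        M * \<delta> * (4 * edge_const \<alpha> * I) * cmod (Q - of_real c)"
      by (rule norm_contour_integral_linepath_le[OF H_int[OF _ Qin] hb hI]) simp_all
    also have "\<dots> \<le> M * \<delta> * (4 * edge_const \<alpha> * (2 / (1 / (4 * real m)))) * 2"
    proof (intro mult_mono mult_left_mono I)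
      have "Q - of_real c = - (of_real c * R)"
        by (simp add: R(2)[symmetric] algebra_simps)
      then have "cmod (Q - of_real c) = c * cmod (apex \<alpha>)"
        using R(1) c by (auto simp: norm_mult)
      also have "\<dots> \<le> 2 * 1"
        using c P(3) by (intro mult_mono) auto
      finally show "cmod (Q - of_real c) \<le> 2"
        by simp
    qed (use assms(4) \<delta> edge_const_ge_1 I0 in auto)
    finally show ?thesis
      by (simp add: ac_simps)
  qed
  define A where "A = dst m N (\<lambda>p. F (of_real (b p)) p * dst m N d p) k"
  have "2 * cmod A \<le> 2 * pi * cmod A"
    using pi_ge_two by (simp add: mult_right_mono)
  also have "\<dots> = cmod (2 * of_real pi * \<i> * A)"
    by (simp add: norm_mult)
  also have "\<dots> \<le> (8 * edge_const \<alpha> * (M * \<delta>) + 64 * real m * edge_const \<alpha> * (M * \<delta>))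
      + 64 * real m * edge_const \<alpha> * (M * \<delta>) + 8 * edge_const \<alpha> * (M * \<delta>)"
    unfolding A_def rep
    by (intro order_trans[OF norm_triangle_ineq4] order_trans[OF norm_triangle_ineq] add_mono zero one) auto
  finally show "cmod (dst m N (\<lambda>p. F (of_real (b p)) p * dst m N d p) k) \<le> contour_const m * M * \<delta>"
    by (simp add: A_def contour_const_def algebra_simps)
qed

end

section \<open>Uniform bound for the stability matrix\<close>

text \<open>Products of \<open>m\<close> numbers of argument at most this angle have argument at most \<open>\<pi> / 6\<close>, so two such
  products enclose an angle of at most \<open>\<pi> / 3\<close>, as \<open>Re_sector_cnj\<close> requires.\<close>

definition amf_angle :: "nat \<Rightarrow> real" where
  "amf_angle m = pi / (6 * real m)"

definition amf_const :: "nat \<Rightarrow> real" where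
  "amf_const m = contour_const (amf_angle m) m ^ m * symbol_const m"

lemma amf_angle_bounds:
  assumes "1 \<le> m"
  shows "0 < amf_angle m" and "amf_angle m \<le> pi / 6" and "real m * amf_angle m \<le> pi / 6"
  using assms pi_gt_zero by (auto simp: amf_angle_def field_simps)

lemma contour_const_nonneg:
  assumes "1 \<le> m"
  shows "0 \<le> contour_const (amf_angle m) m"
  using edge_const_ge_1[OF amf_angle_bounds(1,2)[OF assms]]
  by (simp add: contour_const_def[OF amf_angle_bounds(1,2)[OF assms]])

lemma amf_const_nonneg: "1 \<le> m \<Longrightarrow> 0 \<le> amf_const m"
  by (simp add: amf_const_def contour_const_nonneg symbol_const_nonneg)

text \<open>Induction over the set \<open>J\<close> of variables that still are operators. For empty \<open>J\<close> the symbol is a constant, and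
  its modulus is its norm; each Cauchy integral then turns one number on the contour back into an operator.\<close>

lemma multiplier_bound_freeze:
  fixes m k :: nat and N :: "nat \<Rightarrow> nat" and a :: "nat \<Rightarrow> real" and b :: "nat \<Rightarrow> (nat \<Rightarrow> nat) \<Rightarrow> real"
  defines "I \<equiv> {1..m}" and "S \<equiv> \<lambda>c. stability_symbol {1..m} c ^ k * (\<Prod>i=1..m. c i)"
  assumes "1 \<le> m" and a: "\<And>i. i \<in> {1..m} \<Longrightarrow> 0 < a i"
    and b: "\<And>i p. i \<in> {1..m} \<Longrightarrow> p \<in> mindices m N \<Longrightarrow>
      b i p = 1 / (1 + a i * (1 - cos (pi * real (p i) / (real (N i) + 1))))"
    and "J \<subseteq> I" and "\<And>i. i \<in> I - J \<Longrightarrow> v i \<in> rhombus (amf_angle m)"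
  shows "multiplier_bound m N
    (\<lambda>p. S (\<lambda>i. if i \<in> J then of_real (b i p) else of_real (1 + 1 / real (k + 1)) * v i))
    (contour_const (amf_angle m) m ^ card J * (symbol_const m * (\<Prod>i\<in>I - J. edge_weight m (k + 1) (v i))))"
proof -
  define \<alpha> where "\<alpha> = amf_angle m"
  define K where "K = k + 1"
  have \<alpha>: "0 < \<alpha>" "\<alpha> \<le> pi / 6" "real m * \<alpha> \<le> pi / 6"
    using amf_angle_bounds[OF assms(3)] by (simp_all add: \<alpha>_def)
  have "finite J"
    using assms(6) by (auto simp: I_def intro: finite_subset)
  then show ?thesis
    unfolding \<alpha>_def[symmetric] K_def[symmetric]
    using assms(6,7)
  proof (induction J arbitrary: v rule: finite_induct)
    case empty
    let ?w = "\<lambda>i. of_real (1 + 1 / real K) * v i"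
    have v: "v i \<in> rhombus \<alpha>" if "i \<in> {1..m}" for i
      using empty that by (auto simp: I_def \<alpha>_def)
    have "cmod (S ?w) \<le> symbol_const (card {1..m}) * (\<Prod>i=1..m. edge_weight (card {1..m}) K (v i))"
      unfolding S_def K_def
      by (rule symbol_le_edge_weights[where \<alpha> = \<alpha>]) (use rhombus_sector[OF \<alpha>(1,2) v] \<alpha>(3) assms(3) in auto)
    then show ?case
      using multiplier_bound_mono[OF multiplier_bound_const[of m N "S ?w"]] by (simp add: I_def)
  next
    case (insert j J)
    have j: "j \<in> {1..m}" "j \<notin> J" "J \<subseteq> I"
      using insert by (auto simp: I_def)
    define F where "F w p = S (\<lambda>i. if i = j then w else if i \<in> J then of_real (b i p) else of_real (1 + 1 / real K) * v i)" for w p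
    define M where "M = contour_const \<alpha> m ^ card J * (symbol_const m * (\<Prod>i\<in>I - insert j J. edge_weight m K (v i)))"
    have pos: "0 \<le> contour_const \<alpha> m"
      using contour_const_nonneg[OF assms(3)] by (simp add: \<alpha>_def)
    then have "0 \<le> M"
      by (auto simp: M_def edge_weight_def intro!: mult_nonneg_nonneg prod_nonneg symbol_const_nonneg)
    have "multiplier_bound m N (\<lambda>p. F (of_real (b j p)) p) (contour_const \<alpha> m * M)"
    proof (rule multiplier_bound_cauchy[where F = F and b = "b j" and a = "a j" and j = j and K = K])
      show "0 < \<alpha>" "\<alpha> \<le> pi / 6" "j \<in> {1..m}" "0 < a j" "1 \<le> K" "0 \<le> M"
        using \<alpha> j(1) a \<open>0 \<le> M\<close> by (auto simp: K_def)
      show "b j p = 1 / (1 + a j * (1 - cos (pi * real (p j) / (real (N j) + 1))))" if "p \<in> mindices m N" for p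
        by (rule b[OF j(1) that])
      show "(\<lambda>w. F w p) holomorphic_on UNIV" for p
      proof -
        have "(\<lambda>w. if i = j then w else x i) holomorphic_on UNIV" for i and x :: "nat \<Rightarrow> complex"
          by (cases "i = j") auto
        then show ?thesis
          unfolding F_def S_def stability_symbol_def by (intro holomorphic_intros)
      qed
    next
      fix u assume u: "u \<in> rhombus \<alpha>"
      let ?v = "v(j := u)"
      have "multiplier_bound m N (\<lambda>p. S (\<lambda>i. if i \<in> J then of_real (b i p) else of_real (1 + 1 / real K) * ?v i))
        (contour_const \<alpha> m ^ card J * (symbol_const m * (\<Prod>i\<in>I - J. edge_weight m K (?v i))))"
        using insert.prems u j by (intro insert.IH) (auto simp: \<alpha>_def)
      moreover have "(\<Prod>i\<in>I - J. edge_weight m K (?v i)) =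
          edge_weight m K u * (\<Prod>i\<in>I - insert j J. edge_weight m K (v i))"
      proof -
        have "I - J = insert j (I - insert j J)"
          using j by (auto simp: I_def)
        then have "(\<Prod>i\<in>I - J. edge_weight m K (?v i)) = (\<Prod>i\<in>insert j (I - insert j J). edge_weight m K (?v i))"
          by (rule arg_cong)
        also have "\<dots> = edge_weight m K u * (\<Prod>i\<in>I - insert j J. edge_weight m K (?v i))"
          by (subst prod.insert) (auto simp: I_def)
        also have "(\<Prod>i\<in>I - insert j J. edge_weight m K (?v i)) = (\<Prod>i\<in>I - insert j J. edge_weight m K (v i))"
          by (rule prod.cong) auto
        finally show ?thesis .
      qed
      moreover have "(\<lambda>p. S (\<lambda>i. if i \<in> J then of_real (b i p) else of_real (1 + 1 / real K) * ?v i)) = F (of_real (1 + 1 / real K) * u)"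
        using j(2) unfolding F_def by (intro ext arg_cong[of _ _ S]) auto
      ultimately show "multiplier_bound m N (F (of_real (1 + 1 / real K) * u)) (M * edge_weight m K u)"
        by (simp only: M_def ac_simps)
    qed
    moreover have "(\<lambda>p. F (of_real (b j p)) p) =
        (\<lambda>p. S (\<lambda>i. if i \<in> insert j J then of_real (b i p) else of_real (1 + 1 / real K) * v i))"
      unfolding F_def by (intro ext arg_cong[of _ _ S]) auto
    ultimately show ?case
      using insert.hyps by (simp add: M_def ac_simps)
  qed
qed

text \<open>The maximum norm of \<open>R\<^sup>k Q\<^sup>-\<^sup>1\<close> is bounded by a constant that depends on \<open>m\<close> only.\<close>

lemma multiplier_bound_amf:
  assumes "1 \<le> m" and "\<And>i. i \<in> {1..m} \<Longrightarrow> 0 < a i"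
    and "\<And>i p. i \<in> {1..m} \<Longrightarrow> p \<in> mindices m N \<Longrightarrow>
      b i p = 1 / (1 + a i * (1 - cos (pi * real (p i) / (real (N i) + 1))))"
  shows "multiplier_bound m N
    (\<lambda>p. stability_symbol {1..m} (\<lambda>i. of_real (b i p)) ^ k * (\<Prod>i=1..m. of_real (b i p))) (amf_const m)"
proof -
  have "stability_symbol {1..m} (\<lambda>i. if i \<in> {1..m} then c i else d i) = stability_symbol {1..m} c" for c d
    unfolding stability_symbol_def by (intro arg_cong2[of _ _ _ _ "(-)"] arg_cong2[of _ _ _ _ "(*)"] sum.cong prod.cong refl) auto
  moreover have "(\<Prod>i=1..m. if i \<in> {1..m} then c i else d i) = (\<Prod>i=1..m. c i)" for c d :: "nat \<Rightarrow> complex"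
    by (rule prod.cong) auto
  ultimately show ?thesis
    using multiplier_bound_freeze[of m a N b "{1..m}" "\<lambda>_. 0" k] assms by (simp add: amf_const_def)
qed

section \<open>The discrete maximum principle\<close>

lemma mindices_nonempty:
  assumes "\<And>j. j \<in> {1..m} \<Longrightarrow> 1 \<le> N j"
  shows "mindices m N \<noteq> {}"
  unfolding mindices_def using assms by (simp add: PiE_eq_empty_iff)

lemma D_mat_apply: "mat_vec m N (D_mat m \<beta> N) v k = (\<Sum>j=1..m. mat_vec m N (D_dir m \<beta> N j) v k)"
  unfolding mat_vec_def D_mat_def sum_distrib_right by (rule sum.swap)

lemma L_mat_row_sum: "k \<in> {1..N j} \<Longrightarrow> (\<Sum>l=1..N j. L_mat N j k l) \<le> 0"
  using L_mat_apply[of k N j "\<lambda>_. 1"] by (auto simp: divide_nonpos_nonneg)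

lemma D_dir_row_sum:
  assumes "j \<in> {1..m}" and "0 \<le> \<beta> j" and "k \<in> mindices m N"
  shows "(\<Sum>l\<in>mindices m N. D_dir m \<beta> N j k l) \<le> 0"
proof -
  have "(\<Sum>l\<in>mindices m N. D_dir m \<beta> N j k l) =
      \<beta> j * (\<Prod>i=1..m. if i = j then (\<Sum>l=1..N j. L_mat N j (k j) l) else (\<Sum>l=1..N i. id_mat (k i) l))"
    using D_dir_prod[where N = N and \<beta> = \<beta> and k = k and f = "\<lambda>_ _. 1", OF assms(1)]
    by (simp only: prod.neutral_const mult_1_right)
  also have "\<dots> = \<beta> j * (\<Prod>i=1..m. if i = j then (\<Sum>l=1..N j. L_mat N j (k j) l) else 1)"
    using id_mat_apply[of _ _ "\<lambda>_. 1"] mindices_component[OF assms(3)]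
    by (intro arg_cong[of _ _ "(*) (\<beta> j)"] prod.cong refl if_cong) auto
  also have "\<dots> = \<beta> j * (\<Sum>l=1..N j. L_mat N j (k j) l)"
    using assms(1) by simp
  also have "\<dots> \<le> 0"
    using L_mat_row_sum[where j = j and N = N and k = "k j", OF mindices_component[OF assms(3,1)]] assms(2) by (simp add: mult_nonneg_nonpos)
  finally show ?thesis .
qed

lemma D_dir_off_diagonal:
  assumes "j \<in> {1..m}" and "0 \<le> \<beta> j" and "k \<in> mindices m N" and "l \<in> mindices m N" and "k \<noteq> l"
  shows "0 \<le> D_dir m \<beta> N j k l"
proof (cases "k j = l j")
  case True
  obtain i where "i \<in> {1..m}" "k i \<noteq> l i"
    using mindices_eq_iff[OF assms(3,4)] assms(5) by blast
  then show ?thesis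
    using True unfolding D_dir_def kronecker_def
    by (subst prod_zero) (auto simp: id_mat_def intro!: bexI[of _ i])
next
  case False
  then have "0 \<le> kronecker m (\<lambda>i. if i = j then L_mat N j else id_mat) k l"
    unfolding kronecker_def by (intro prod_nonneg) (auto simp: L_mat_def id_mat_def)
  then show ?thesis
    using assms(2) by (simp add: D_dir_def)
qed

text \<open>At a positive maximum the value of the matrix would be at most the maximum times the row sum, since the
  off-diagonal entries are nonnegative, and row sums are nonpositive.\<close>

lemma discrete_maximum_principle:
  assumes "\<And>j. j \<in> {1..m} \<Longrightarrow> 0 < \<beta> j"
    and "\<And>k. k \<in> mindices m N \<Longrightarrow> 0 < mat_vec m N (D_mat m \<beta> N) s k" and "k \<in> mindices m N"
  shows "s k \<le> 0"
proof (rule ccontr)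
  assume "\<not> s k \<le> 0"
  have "Max (s ` mindices m N) \<in> s ` mindices m N"
    using assms(3) by (intro Max_in) auto
  then obtain k' where "k' \<in> mindices m N" and "s k' = Max (s ` mindices m N)"
    by auto
  then have k': "k' \<in> mindices m N" "\<And>l. l \<in> mindices m N \<Longrightarrow> s l \<le> s k'"
    by simp_all
  have pos: "0 < s k'"
    using k'(2)[OF assms(3)] \<open>\<not> s k \<le> 0\<close> by simp
  have "D_mat m \<beta> N k' l * s l \<le> D_mat m \<beta> N k' l * s k'" if l: "l \<in> mindices m N" for l
  proof (cases "l = k'")
    case False
    have "0 \<le> D_dir m \<beta> N j k' l" if "j \<in> {1..m}" for j
      using D_dir_off_diagonal[OF that _ k'(1) l] assms(1)[OF that] False by auto
    then have "0 \<le> D_mat m \<beta> N k' l"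
      unfolding D_mat_def by (rule sum_nonneg)
    then show ?thesis
      using k'(2)[OF l] by (rule mult_left_mono[rotated])
  qed simp
  then have "mat_vec m N (D_mat m \<beta> N) s k' \<le> (\<Sum>l\<in>mindices m N. D_mat m \<beta> N k' l * s k')"
    unfolding mat_vec_def by (rule sum_mono)
  also have "\<dots> = (\<Sum>j=1..m. \<Sum>l\<in>mindices m N. D_dir m \<beta> N j k' l) * s k'"
    unfolding D_mat_def sum_distrib_right[symmetric] by (subst sum.swap) simp
  also have "\<dots> \<le> 0"
    using pos assms(1) k'(1) by (intro mult_nonpos_nonneg sum_nonpos D_dir_row_sum) (auto intro: less_imp_le)
  finally show False
    using assms(2)[OF k'(1)] by simp
qed

text \<open>The parabola \<open>x (1 - x) / (2 \<beta>\<^sub>1)\<close> in the first coordinate, on which central differences are exact.\<close>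

definition barrier :: "(nat \<Rightarrow> real) \<Rightarrow> (nat \<Rightarrow> nat) \<Rightarrow> nat \<Rightarrow> real" where
  "barrier \<beta> N l = (dx N 1)\<^sup>2 * (real l * (real (N 1) + 1 - real l)) / (2 * \<beta> 1)"

lemma barrier_bounds:
  assumes "0 < \<beta> 1" and "l \<le> N 1 + 1"
  shows "0 \<le> barrier \<beta> N l" and "barrier \<beta> N l \<le> 1 / (8 * \<beta> 1)"
proof -
  have "real l \<le> real (N 1) + 1"
    using assms(2) by linarith
  then show "0 \<le> barrier \<beta> N l"
    using assms(1) by (auto simp: barrier_def intro!: divide_nonneg_pos mult_nonneg_nonneg)
  define M where "M = real (N 1) + 1"
  have M: "0 < M"
    by (simp add: M_def)
  have "4 * (real l * (M - real l)) \<le> M\<^sup>2"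
    using zero_le_power2[of "M - 2 * real l"] by (simp add: power2_eq_square algebra_simps)
  then have "(1 / M)\<^sup>2 * (4 * (real l * (M - real l))) \<le> (1 / M)\<^sup>2 * M\<^sup>2"
    by (intro mult_left_mono) auto
  also have "(1 / M)\<^sup>2 * M\<^sup>2 = 1"
    using M by (simp add: power_divide)
  finally have "(1 / M)\<^sup>2 * (real l * (M - real l)) / (2 * \<beta> 1) \<le> (1/4) / (2 * \<beta> 1)"
    using assms(1) by (intro divide_right_mono) auto
  then show "barrier \<beta> N l \<le> 1 / (8 * \<beta> 1)"
    by (simp add: barrier_def dx_def M_def)
qed

lemma L_mat_barrier:
  assumes "0 < \<beta> 1" and "k \<in> {1..N 1}"
  shows "(\<Sum>l=1..N 1. L_mat N 1 k l * barrier \<beta> N l) = - 1 / \<beta> 1"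
proof -
  define f where "f x = (dx N 1)\<^sup>2 * (x * (real (N 1) + 1 - x)) / (2 * \<beta> 1)" for x :: real
  have b: "barrier \<beta> N l = f (real l)" for l
    by (simp add: barrier_def f_def)
  have up: "(if k < N 1 then f (real (k + 1)) else 0) = f (real k + 1)"
  proof (cases "k < N 1")
    case False
    then have "real k = real (N 1)"
      using assms(2) by simp
    then show ?thesis
      using False by (simp add: f_def)
  qed (simp add: add.commute)
  have down: "(if 1 < k then f (real (k - 1)) else 0) = f (real k - 1)"
  proof (cases "1 < k")
    case False
    then have "real k = 1"
      using assms(2) by simp
    then show ?thesis
      using False by (simp add: f_def)
  qed (simp add: of_nat_diff)
  have "f (real k + 1) + f (real k - 1) - 2 * f (real k) = (dx N 1)\<^sup>2 * (- 2) / (2 * \<beta> 1)"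
    unfolding f_def add_divide_distrib[symmetric] times_divide_eq_right diff_divide_distrib[symmetric]
    by (rule arg_cong[of _ _ "\<lambda>x. x / _"]) (simp add: algebra_simps)
  moreover have "dx N 1 \<noteq> 0"
    by (simp add: dx_def add_nonneg_eq_0_iff)
  ultimately show ?thesis
    unfolding b L_mat_apply[where j = 1 and N = N and k = k, OF assms(2)] up down by simp
qed

text \<open>Only an inequality holds, because the barrier does not vanish on the boundary in the other directions; there the missing
  neighbours decrease the value.\<close>

lemma D_mat_barrier:
  assumes "1 \<le> m" and "\<And>j. j \<in> {1..m} \<Longrightarrow> 0 < \<beta> j" and k: "k \<in> mindices m N"
  shows "mat_vec m N (D_mat m \<beta> N) (\<lambda>l. barrier \<beta> N (l 1)) k \<le> - 1"
proof -
  have one: "1 \<in> {1..m}"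
    using assms(1) by simp
  define f where "f i = (if i = 1 then barrier \<beta> N else (\<lambda>_. 1))" for i :: nat
  have prod: "(\<Prod>i=1..m. f i (l i)) = barrier \<beta> N (l 1)" for l
    using one by (simp add: f_def if_distrib[of "\<lambda>h. h _"] cong: if_cong)
  have dir: "mat_vec m N (D_dir m \<beta> N j) (\<lambda>l. barrier \<beta> N (l 1)) k =
      \<beta> j * (\<Prod>i=1..m. if i = j then (\<Sum>l=1..N j. L_mat N j (k j) l * f j l) else f i (k i))"
    if "j \<in> {1..m}" for j
  proof -
    have "(\<Prod>i=1..m. if i = j then (\<Sum>l=1..N j. L_mat N j (k j) l * f j l) else (\<Sum>l=1..N i. id_mat (k i) l * f i l))
      = (\<Prod>i=1..m. if i = j then (\<Sum>l=1..N j. L_mat N j (k j) l * f j l) else f i (k i))"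
      using id_mat_apply mindices_component[OF k] by (intro prod.cong refl if_cong) auto
    then show ?thesis
      using D_dir_prod[where N = N and \<beta> = \<beta> and k = k and f = f, OF that] by (simp only: mat_vec_def prod)
  qed
  have "mat_vec m N (D_dir m \<beta> N j) (\<lambda>l. barrier \<beta> N (l 1)) k \<le> (if j = 1 then - 1 else 0)" if j: "j \<in> {1..m}" for j
  proof (cases "j = 1")
    case True
    have "(\<Prod>i=1..m. if i = 1 then (\<Sum>l=1..N 1. L_mat N 1 (k 1) l * f 1 l) else f i (k i))
       = (\<Prod>i=1..m. if i = 1 then (\<Sum>l=1..N 1. L_mat N 1 (k 1) l * barrier \<beta> N l) else 1)"
      by (rule prod.cong) (auto simp: f_def)
    also have "\<dots> = - 1 / \<beta> 1"
      using one L_mat_barrier[where N = N and \<beta> = \<beta> and k = "k 1", OF assms(2)[OF one] mindices_component[OF k one]] by simp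
    finally show ?thesis
      unfolding True dir[OF one] using assms(2)[OF one] by simp
  next
    case False
    have "(\<Prod>i=1..m. if i = j then (\<Sum>l=1..N j. L_mat N j (k j) l * f j l) else f i (k i)) =
       (\<Sum>l=1..N j. L_mat N j (k j) l) * (\<Prod>i\<in>{1..m} - {j}. f i (k i))"
      using j False by (subst prod.remove[of _ j]) (auto simp: f_def intro!: prod.cong)
    moreover have "0 \<le> (\<Prod>i\<in>{1..m} - {j}. f i (k i))"
      using barrier_bounds(1)[where \<beta> = \<beta> and N = N, OF assms(2)[OF one]] mindices_component[OF k one]
      by (intro prod_nonneg) (auto simp: f_def)
    ultimately have "(\<Prod>i=1..m. if i = j then (\<Sum>l=1..N j. L_mat N j (k j) l * f j l) else f i (k i)) \<le> 0"
      using L_mat_row_sum[where j = j and N = N and k = "k j", OF mindices_component[OF k j]] by (simp add: mult_nonpos_nonneg)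
    then show ?thesis
      using dir[OF j] False assms(2)[OF j] by (simp add: mult_nonneg_nonpos)
  qed
  then have "mat_vec m N (D_mat m \<beta> N) (\<lambda>l. barrier \<beta> N (l 1)) k \<le> (\<Sum>j=1..m. if j = 1 then - 1 else 0)"
    unfolding D_mat_apply by (rule sum_mono)
  then show ?thesis
    using one by simp
qed

lemma D_mat_inverse_bound:
  assumes "1 \<le> m" and \<beta>: "\<And>j. j \<in> {1..m} \<Longrightarrow> 0 < \<beta> j" and k: "k \<in> mindices m N"
    and v: "\<And>k. k \<in> mindices m N \<Longrightarrow> \<bar>mat_vec m N (D_mat m \<beta> N) v k\<bar> \<le> \<delta>"
  shows "\<bar>v k\<bar> \<le> \<delta> / (8 * \<beta> 1)"
proof -
  have \<beta>1: "0 < \<beta> 1"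
    using assms(1) \<beta> by simp
  have \<delta>: "0 \<le> \<delta>"
    using v[OF k] by simp
  have one_sided: "w k \<le> \<delta> / (8 * \<beta> 1)"
    if w: "\<And>k. k \<in> mindices m N \<Longrightarrow> - \<delta> \<le> mat_vec m N (D_mat m \<beta> N) w k" for w
  proof (rule dense_ge)
    fix y assume y: "\<delta> / (8 * \<beta> 1) < y"
    \<comment> \<open>A multiple slightly larger than \<delta> makes the inequality of the maximum principle strict.\<close>
    define M where "M = 8 * \<beta> 1 * y"
    have M: "\<delta> < M"
      using y \<beta>1 by (simp add: M_def divide_less_eq mult.commute)
    have "w k - M * barrier \<beta> N (k 1) \<le> 0"
    proof (rule discrete_maximum_principle[OF \<beta> _ k])
      fix l assume l: "l \<in> mindices m N"
      have "mat_vec m N (D_mat m \<beta> N) (\<lambda>l. w l - M * barrier \<beta> N (l 1)) l =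
          mat_vec m N (D_mat m \<beta> N) w l - M * mat_vec m N (D_mat m \<beta> N) (\<lambda>l. barrier \<beta> N (l 1)) l"
        by (simp add: mat_vec_def right_diff_distrib sum_subtractf sum_distrib_left ac_simps)
      moreover have "M * mat_vec m N (D_mat m \<beta> N) (\<lambda>l. barrier \<beta> N (l 1)) l \<le> M * (- 1)"
        using M \<delta> by (intro mult_left_mono D_mat_barrier assms(1) \<beta> l) auto
      ultimately show "0 < mat_vec m N (D_mat m \<beta> N) (\<lambda>l. w l - M * barrier \<beta> N (l 1)) l"
        using w[OF l] M by linarith
    qed
    moreover have "M * barrier \<beta> N (k 1) \<le> M * (1 / (8 * \<beta> 1))"
      using M \<delta> mindices_component[OF k, of 1] assms(1) by (intro mult_left_mono barrier_bounds \<beta>1) auto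
    moreover have "M * (1 / (8 * \<beta> 1)) = y"
      using \<beta>1 by (simp add: M_def)
    ultimately show "w k \<le> y"
      by linarith
  qed
  have "mat_vec m N (D_mat m \<beta> N) (\<lambda>l. - v l) l = - mat_vec m N (D_mat m \<beta> N) v l" for l
    by (simp add: mat_vec_def sum_negf)
  then have "- v k \<le> \<delta> / (8 * \<beta> 1)"
    using v by (intro one_sided) (fastforce simp: abs_le_iff)
  moreover have "v k \<le> \<delta> / (8 * \<beta> 1)"
    using v by (intro one_sided) (fastforce simp: abs_le_iff)
  ultimately show ?thesis
    by linarith
qed

section \<open>Derivatives in time and smoothness on the grid\<close>

text \<open>The value of \<open>tderiv\<close> is meaningful only where the derivative within the interval exists and is unique; uniqueness needs
  \<open>T > 0\<close>.\<close>

lemma tderivI: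
  assumes "0 < T" and "t \<in> {0..T}" and "((\<lambda>s. F s x) has_real_derivative y) (at t within {0..T})"
  shows "tderiv T F t x = y"
  unfolding tderiv_def
  by (rule vector_derivative_within_closed_interval)
    (use assms in \<open>auto simp flip: has_real_derivative_iff_has_vector_derivative\<close>)

text \<open>The derivatives are one-sided at the ends of the interval, so both Taylor estimates follow from the mean value inequality on a
  convex set; the constants are not optimal.\<close>

lemma first_order_expansion:
  fixes f f' f'' :: "real \<Rightarrow> real"
  assumes "\<And>s. s \<in> {0..T} \<Longrightarrow> (f has_real_derivative f' s) (at s within {0..T})"
    and "\<And>s. s \<in> {0..T} \<Longrightarrow> (f' has_real_derivative f'' s) (at s within {0..T})"
    and "\<And>s. s \<in> {0..T} \<Longrightarrow> \<bar>f'' s\<bar> \<le> C" and "t \<in> {0..T}" and "t + h \<in> {0..T}" and "0 \<le> h"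
  shows "\<bar>f (t + h) - f t - h * f' t\<bar> \<le> C * h\<^sup>2"
proof -
  have sub: "{t..t + h} \<subseteq> {0..T}"
    using assms(4,5) by auto
  have C: "0 \<le> C"
    using assms(3)[OF assms(4)] by linarith
  have mvt: "\<bar>g y - g x\<bar> \<le> B * \<bar>y - x\<bar>"
    if "\<And>s. s \<in> {t..t + h} \<Longrightarrow> (g has_real_derivative g' s) (at s within {t..t + h})"
      "\<And>s. s \<in> {t..t + h} \<Longrightarrow> \<bar>g' s\<bar> \<le> B" "x \<in> {t..t + h}" "y \<in> {t..t + h}" for g g' x y B
    using field_differentiable_bound[of "{t..t + h}" g g' B y x] that by (auto simp: real_norm_def)
  have f': "\<bar>f' s - f' t\<bar> \<le> C * h" if s: "s \<in> {t..t + h}" for s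
  proof -
    have "\<bar>f' s - f' t\<bar> \<le> C * \<bar>s - t\<bar>"
    proof (rule mvt[of f' f''])
      fix r assume "r \<in> {t..t + h}"
      then have r: "r \<in> {0..T}"
        using sub by blast
      show "(f' has_real_derivative f'' r) (at r within {t..t + h})"
        by (rule DERIV_subset[OF assms(2)[OF r] sub])
      show "\<bar>f'' r\<bar> \<le> C"
        by (rule assms(3)[OF r])
    qed (use assms(6) s in auto)
    also have "\<dots> \<le> C * h"
      using s C by (intro mult_left_mono) auto
    finally show ?thesis .
  qed
  have "\<bar>(f (t + h) - (t + h) * f' t) - (f t - t * f' t)\<bar> \<le> C * h * \<bar>t + h - t\<bar>"
    by (rule mvt[of "\<lambda>s. f s - s * f' t" "\<lambda>s. f' s - f' t"])
      (use assms(6) f' sub in \<open>auto intro!: derivative_eq_intros DERIV_subset[OF assms(1)]\<close>)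
  then show ?thesis
    using assms(6) by (simp add: power2_eq_square algebra_simps)
qed

lemma second_order_expansion:
  fixes f f' f'' f''' :: "real \<Rightarrow> real"
  assumes "\<And>s. s \<in> {0..T} \<Longrightarrow> (f has_real_derivative f' s) (at s within {0..T})"
    and "\<And>s. s \<in> {0..T} \<Longrightarrow> (f' has_real_derivative f'' s) (at s within {0..T})"
    and "\<And>s. s \<in> {0..T} \<Longrightarrow> (f'' has_real_derivative f''' s) (at s within {0..T})"
    and "\<And>s. s \<in> {0..T} \<Longrightarrow> \<bar>f''' s\<bar> \<le> C" and "t \<in> {0..T}" and "t + h \<in> {0..T}" and "0 \<le> h"
  shows "\<bar>f (t + h) - f t - h * f' t - h\<^sup>2 / 2 * f'' t\<bar> \<le> C * h ^ 3"
proof -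
  have sub: "{t..t + h} \<subseteq> {0..T}"
    using assms(5,6) by auto
  have C: "0 \<le> C"
    using assms(4)[OF assms(5)] by linarith
  let ?G = "\<lambda>s. f s - s * f' t - (s - t)\<^sup>2 / 2 * f'' t"
  have "\<bar>f' s - f' t - (s - t) * f'' t\<bar> \<le> C * h\<^sup>2" if s: "s \<in> {t..t + h}" for s
  proof -
    have "\<bar>f' (t + (s - t)) - f' t - (s - t) * f'' t\<bar> \<le> C * (s - t)\<^sup>2"
      by (rule first_order_expansion[OF assms(2,3,4,5)]) (use s sub in auto)
    also have "\<dots> \<le> C * h\<^sup>2"
      using s C by (intro mult_left_mono power_mono) auto
    finally show ?thesis
      by simp
  qed
  then have "norm (?G (t + h) - ?G t) \<le> C * h\<^sup>2 * norm (t + h - t)"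
    by (intro field_differentiable_bound[of "{t..t + h}" ?G "\<lambda>s. f' s - f' t - (s - t) * f'' t"])
      (use assms(7) sub in \<open>auto intro!: derivative_eq_intros DERIV_subset[OF assms(1)]\<close>)
  then show ?thesis
    using assms(7) by (simp add: power2_eq_square power3_eq_cube algebra_simps)
qed

lemma grid_point_in_cube:
  assumes "k \<in> mindices m N"
  shows "grid_point m N k \<in> cube m"
proof -
  have "real (k j) * dx N j \<le> 1" if "j \<in> {1..m}" for j
    using mindices_component[OF assms that] by (simp add: dx_def divide_le_eq)
  then show ?thesis
    by (auto simp: grid_point_def cube_def dx_def)
qed

lemma tderiv_on_grid: "(tderiv T ^^ i) (on_grid m N u) = on_grid m N ((tderiv T ^^ i) u)"
  by (induction i) (auto simp: on_grid_def tderiv_def fun_eq_iff)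

lemma foldr_replicate_0: "foldr (pderivative T) (replicate i 0) u = (tderiv T ^^ i) u"
  by (induction i) (auto simp: pderivative_def)

lemma smooth_time_derivative:
  assumes "smooth_upto p m T u" and "0 < T" and "i < p" and "t \<in> {0..T}" and "k \<in> mindices m N"
  shows "((\<lambda>s. (tderiv T ^^ i) (on_grid m N u) s k) has_real_derivative
    (tderiv T ^^ Suc i) (on_grid m N u) t k) (at t within {0..T})"
proof -
  have "set (replicate i 0) \<subseteq> {0..m} \<and> length (replicate i (0::nat)) \<le> p"
    using assms(3) by auto
  then have "partially_differentiable m T 0 (foldr (pderivative T) (replicate i 0) u)"
    using assms(1,3) unfolding smooth_upto_def Let_def
    by (metis atLeastAtMost_iff length_replicate zero_le)
  then have "(\<lambda>s. (tderiv T ^^ i) u s (grid_point m N k)) differentiable (at t within {0..T})"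
    using assms(4) grid_point_in_cube[OF assms(5)]
    unfolding foldr_replicate_0 partially_differentiable_def by auto
  then obtain y where y: "((\<lambda>s. (tderiv T ^^ i) u s (grid_point m N k)) has_real_derivative y) (at t within {0..T})"
    by (auto simp: real_differentiable_def)
  then have "tderiv T ((tderiv T ^^ i) u) t (grid_point m N k) = y"
    using assms(2,4) by (intro tderivI)
  then show ?thesis
    using y unfolding tderiv_on_grid by (simp add: on_grid_def)
qed

text \<open>One bound serves all mixed derivatives, because there are only finitely many lists of coordinates of bounded length.\<close>

lemma xderiv2_prod_bounded:
  assumes "smooth_upto p m T u"
  obtains B where "0 \<le> B" and "\<And>js t x. set js \<subseteq> {1..m} \<Longrightarrow> 2 * length js + 1 \<le> p \<Longrightarrow> t \<in> {0..T} \<Longrightarrow> x \<in> cube m \<Longrightarrow>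
    \<bar>xderiv2_prod js (tderiv T u t) x\<bar> \<le> B"
proof -
  have "\<exists>B. \<forall>t\<in>{0..T}. \<forall>x\<in>cube m. \<bar>foldr (pderivative T) js u t x\<bar> \<le> B"
    if "set js \<subseteq> {0..m}" "length js \<le> p" for js
  proof -
    have "bounded ((\<lambda>(t, x). foldr (pderivative T) js u t x) ` ({0..T} \<times> cube m))"
      using assms that unfolding smooth_upto_def Let_def by blast
    then show ?thesis
      by (fastforce simp: bounded_iff)
  qed
  then obtain B where B: "\<And>js t x. set js \<subseteq> {0..m} \<Longrightarrow> length js \<le> p \<Longrightarrow> t \<in> {0..T} \<Longrightarrow> x \<in> cube m \<Longrightarrow>
      \<bar>foldr (pderivative T) js u t x\<bar> \<le> B js"
    by metis
  define L where "L = {js. set js \<subseteq> {0..m} \<and> length js \<le> p}"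
  have L: "finite L"
    unfolding L_def by (rule finite_lists_length_le) simp
  define M where "M = (\<Sum>js\<in>L. \<bar>B js\<bar>)"
  have M: "B js \<le> M" if "js \<in> L" for js
    using member_le_sum[of js L "\<lambda>js. \<bar>B js\<bar>"] L that by (simp add: M_def)
  have fold: "foldr (pderivative T) (concat (map (\<lambda>i. [i, i]) js) @ [0]) u t = xderiv2_prod js (tderiv T u t)"
    if "set js \<subseteq> {1..m}" for js t
    using that by (induction js arbitrary: t) (auto simp: xderiv2_prod_def pderivative_def)
  have len: "length (concat (map (\<lambda>i. [i, i]) js)) = 2 * length js" for js :: "nat list"
    by (induction js) auto
  show thesis
  proof (rule that[of M])
    show "0 \<le> M"
      by (simp add: M_def sum_nonneg)
    fix js t x assume *: "set js \<subseteq> {1..m}" "2 * length js + 1 \<le> p" "t \<in> {0..T}" "x \<in> cube m"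
    let ?js = "concat (map (\<lambda>i. [i, i]) js) @ [0]"
    have "set ?js \<subseteq> {0..m}" "length ?js \<le> p"
      using * len[of js] by auto
    then have "\<bar>foldr (pderivative T) ?js u t x\<bar> \<le> M"
      using B[of ?js t x] M[of ?js] * by (force simp: L_def)
    then show "\<bar>xderiv2_prod js (tderiv T u t) x\<bar> \<le> M"
      using fold[OF *(1)] by simp
  qed
qed

lemma has_derivative_mat_vec:
  assumes "\<And>l. l \<in> mindices m N \<Longrightarrow> ((\<lambda>s. F s l) has_real_derivative F' l) (at t within S)"
  shows "((\<lambda>s. mat_vec m N A (F s) k) has_real_derivative mat_vec m N A F' k) (at t within S)"
  unfolding mat_vec_def by (intro DERIV_sum DERIV_cmult assms)

lemma has_derivative_D_prod:
  assumes "\<And>l. l \<in> mindices m N \<Longrightarrow> ((\<lambda>s. F s l) has_real_derivative F' l) (at t within S)" and "k \<in> mindices m N"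
  shows "((\<lambda>s. D_prod m \<beta> N js (F s) k) has_real_derivative D_prod m \<beta> N js F' k) (at t within S)"
  using assms(2)
proof (induction js arbitrary: k)
  case Nil
  then show ?case
    using assms(1) by (simp add: D_prod_def)
next
  case (Cons j js)
  then have "((\<lambda>s. mat_vec m N (D_dir m \<beta> N j) (D_prod m \<beta> N js (F s)) k) has_real_derivative
      mat_vec m N (D_dir m \<beta> N j) (D_prod m \<beta> N js F') k) (at t within S)"
    by (intro has_derivative_mat_vec)
  then show ?case
    by (simp add: D_prod_def)
qed

lemma D_prod_cong:
  assumes "\<And>l. l \<in> mindices m N \<Longrightarrow> v l = w l" and "k \<in> mindices m N"
  shows "D_prod m \<beta> N js v k = D_prod m \<beta> N js w k"
  using assms(2)
proof (induction js arbitrary: k)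
  case (Cons j js)
  then have "mat_vec m N (D_dir m \<beta> N j) (D_prod m \<beta> N js v) k = mat_vec m N (D_dir m \<beta> N j) (D_prod m \<beta> N js w) k"
    unfolding mat_vec_def by simp
  then show ?case
    by (simp add: D_prod_def)
qed (use assms(1) in \<open>simp add: D_prod_def\<close>)

lemma dst_D_prod:
  assumes "set js \<subseteq> {1..m}" and "p \<in> mindices m N"
  shows "dst m N (\<lambda>k. of_real (D_prod m \<beta> N js v k)) p =
    (\<Prod>j\<leftarrow>js. - of_real (\<beta> j * dirichlet_eig N j (p j))) * dst m N (\<lambda>k. of_real (v k)) p"
  using assms(1)
proof (induction js)
  case (Cons j js)
  have "D_prod m \<beta> N (j # js) v = mat_vec m N (D_dir m \<beta> N j) (D_prod m \<beta> N js v)"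
    by (simp add: D_prod_def)
  then show ?case
    using Cons dst_D_dir[of j m p N \<beta> "D_prod m \<beta> N js v"] assms(2) by simp
qed (simp add: D_prod_def)

lemma abs_le_max_norm: "k \<in> mindices m N \<Longrightarrow> \<bar>v k\<bar> \<le> max_norm m N v"
  unfolding max_norm_def by (intro Max_ge) auto

lemma max_norm_le:
  assumes "mindices m N \<noteq> {}" and "\<And>k. k \<in> mindices m N \<Longrightarrow> \<bar>v k\<bar> \<le> B"
  shows "max_norm m N v \<le> B"
  unfolding max_norm_def using assms by (intro Max.boundedI) auto

section \<open>The local defect\<close>

lemma has_real_derivative_transform:
  assumes "(f has_real_derivative y) (at x within S)" and "x \<in> S" and "\<And>s. s \<in> S \<Longrightarrow> g s = f s"
  shows "(g has_real_derivative y) (at x within S)"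
  using assms unfolding has_field_derivative_def by (blast intro: has_derivative_transform)

lemma D_prod_snoc: "D_prod m \<beta> N (js @ [j]) v = D_prod m \<beta> N js (mat_vec m N (D_dir m \<beta> N j) v)"
  by (simp add: D_prod_def)

text \<open>The first term comes from the Taylor expansions, the second one from the at most \<open>2 ^ m\<close> mixed products; powers of
  \<open>\<tau> \<le> T\<close> beyond the third are absorbed into \<open>max 1 T ^ m\<close>.\<close>

definition defect_const :: "nat \<Rightarrow> (nat \<Rightarrow> real) \<Rightarrow> real \<Rightarrow> real \<Rightarrow> real \<Rightarrow> real \<Rightarrow> real" where
  "defect_const m \<beta> T C K B =
    2 * \<bar>C\<bar> + 2 ^ m * (max 1 T ^ m * ((\<Prod>i=1..m. max 1 (\<beta> i)) * B + \<bar>K\<bar> * real m))"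

text \<open>The hypotheses of the theorem on which the defect depends, for one fixed grid.\<close>

locale semidiscrete_solution =
  fixes m :: nat and \<beta> :: "nat \<Rightarrow> real" and T C K Kc B :: real
    and c u :: "real \<Rightarrow> (nat \<Rightarrow> real) \<Rightarrow> real" and b :: "(nat \<Rightarrow> real) \<Rightarrow> real"
    and N :: "nat \<Rightarrow> nat" and g :: "nat \<Rightarrow> real \<Rightarrow> (nat \<Rightarrow> nat) \<Rightarrow> real"
  assumes m: "1 \<le> m" and T: "0 < T" and \<beta>: "\<And>j. j \<in> {1..m} \<Longrightarrow> 0 < \<beta> j"
    and smooth: "smooth_upto (2 * m + 2) m T u"
    and sd: "semidiscretization m \<beta> T N Kc c b u g"
    and U_bound: "\<And>t k. t \<in> {0..T} \<Longrightarrow> k \<in> mindices m N \<Longrightarrow> \<bar>(tderiv T ^^ 3) (on_grid m N u) t k\<bar> \<le> C"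
    and g_bound: "\<And>t k. t \<in> {0..T} \<Longrightarrow> k \<in> mindices m N \<Longrightarrow>
      \<bar>(tderiv T ^^ 2) (\<lambda>s k. \<Sum>j=1..m. g j s k) t k\<bar> \<le> C"
    and mixed: "\<And>t j js k. t \<in> {0..T} \<Longrightarrow> j \<in> {1..m} \<Longrightarrow> js \<noteq> [] \<Longrightarrow> sorted_wrt (<) js \<Longrightarrow> set js \<subseteq> {1..<j} \<Longrightarrow>
      k \<in> mindices m N \<Longrightarrow>
      \<bar>D_prod m \<beta> N js (tderiv T (\<phi> m \<beta> N u g j) t) k -
        prod_list (map \<beta> js) * \<beta> j * xderiv2_prod (js @ [j]) (tderiv T u t) (grid_point m N k)\<bar>
      \<le> K * ((\<Sum>l\<leftarrow>js. (dx N l)\<^sup>2) + (dx N j)\<^sup>2)"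
    and B: "0 \<le> B" "\<And>js t x. set js \<subseteq> {1..m} \<Longrightarrow> 2 * length js + 1 \<le> 2 * m + 2 \<Longrightarrow> t \<in> {0..T} \<Longrightarrow>
      x \<in> cube m \<Longrightarrow> \<bar>xderiv2_prod js (tderiv T u t) x\<bar> \<le> B"
begin

definition U :: "nat \<Rightarrow> real \<Rightarrow> (nat \<Rightarrow> nat) \<Rightarrow> real" where
  "U i = (tderiv T ^^ i) (on_grid m N u)"

lemma has_derivative_U:
  assumes "i \<le> 3" and "t \<in> {0..T}" and "k \<in> mindices m N"
  shows "((\<lambda>s. U i s k) has_real_derivative U (Suc i) t k) (at t within {0..T})"
  unfolding U_def by (rule smooth_time_derivative[OF smooth T _ assms(2,3)]) (use assms(1) m in simp)

lemma ode:
  assumes "s \<in> {0..T}" and "k \<in> mindices m N"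
  shows "U 1 s k = mat_vec m N (D_mat m \<beta> N) (U 0 s) k + (\<Sum>j=1..m. g j s k)"
  using sd assms by (simp add: semidiscretization_def U_def)

lemma g_boundary:
  assumes "s \<in> {0..T}" and "k \<in> mindices m N" and "j \<in> {2..m}"
  shows "g j s k = boundary_part m \<beta> N b j k"
  using sd assms unfolding semidiscretization_def by blast

lemma has_derivative_DU:
  assumes "i \<le> 3" and "t \<in> {0..T}"
  shows "((\<lambda>s. mat_vec m N A (U i s) k) has_real_derivative mat_vec m N A (U (Suc i) t) k) (at t within {0..T})"
  by (intro has_derivative_mat_vec has_derivative_U assms)

lemma has_derivative_g:
  assumes "t \<in> {0..T}" and "k \<in> mindices m N"
  shows "((\<lambda>s. \<Sum>j=1..m. g j s k) has_real_derivative U 2 t k - mat_vec m N (D_mat m \<beta> N) (U 1 t) k) (at t within {0..T})"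
proof (rule has_real_derivative_transform)
  show "((\<lambda>s. U 1 s k - mat_vec m N (D_mat m \<beta> N) (U 0 s) k) has_real_derivative
      U 2 t k - mat_vec m N (D_mat m \<beta> N) (U 1 t) k) (at t within {0..T})"
    using has_derivative_U[of 1 t k] has_derivative_DU[of 0 t "D_mat m \<beta> N" k] assms
    by (intro DERIV_diff) (simp_all add: numeral_2_eq_2)
  show "(\<Sum>j=1..m. g j s k) = U 1 s k - mat_vec m N (D_mat m \<beta> N) (U 0 s) k" if "s \<in> {0..T}" for s
    using ode[OF that assms(2)] by simp
qed (use assms in simp)

text \<open>The other parts of the inhomogeneity are constant in time, so \<open>g 1\<close> carries the derivative of the whole sum.\<close>

lemma tderiv_g1:
  assumes "t \<in> {0..T}" and "k \<in> mindices m N"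
  shows "tderiv T (g 1) t k = U 2 t k - mat_vec m N (D_mat m \<beta> N) (U 1 t) k"
proof (rule tderivI[OF T assms(1)])
  have split: "(\<Sum>j=1..m. f j) = f 1 + (\<Sum>j=2..m. f j)" for f :: "nat \<Rightarrow> real"
    using m by (simp add: sum.atLeast_Suc_atMost numeral_2_eq_2)
  have "((\<lambda>s. (\<Sum>j=1..m. g j s k) - (\<Sum>j=2..m. boundary_part m \<beta> N b j k)) has_real_derivative
      U 2 t k - mat_vec m N (D_mat m \<beta> N) (U 1 t) k - 0) (at t within {0..T})"
    by (intro DERIV_diff has_derivative_g assms DERIV_const)
  then show "((\<lambda>s. g 1 s k) has_real_derivative U 2 t k - mat_vec m N (D_mat m \<beta> N) (U 1 t) k) (at t within {0..T})"
    unfolding diff_0_right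
  proof (rule has_real_derivative_transform)
    show "g 1 s k = (\<Sum>j=1..m. g j s k) - (\<Sum>j=2..m. boundary_part m \<beta> N b j k)" if "s \<in> {0..T}" for s
      using g_boundary[OF that assms(2)] split[of "\<lambda>j. g j s k"] by simp
  qed (use assms in simp)
qed

text \<open>Differentiating \<open>U' = D U + g\<close> twice expresses \<open>D U''\<close> by bounded quantities. This is the remainder of the
  first-order expansion of \<open>D U\<close>.\<close>

lemma D_mat_U2_bound:
  assumes "t \<in> {0..T}" and "k \<in> mindices m N"
  shows "\<bar>mat_vec m N (D_mat m \<beta> N) (U 2 t) k\<bar> \<le> 2 * C"
proof -
  let ?G = "\<lambda>s k. \<Sum>j=1..m. g j s k"
  have 1: "tderiv T ?G s k = U 2 s k - mat_vec m N (D_mat m \<beta> N) (U 1 s) k" if "s \<in> {0..T}" for s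
    by (intro tderivI T that has_derivative_g assms)
  have "tderiv T (tderiv T ?G) t k = U 3 t k - mat_vec m N (D_mat m \<beta> N) (U 2 t) k"
  proof (rule tderivI[OF T assms(1)], rule has_real_derivative_transform)
    show "((\<lambda>s. U 2 s k - mat_vec m N (D_mat m \<beta> N) (U 1 s) k) has_real_derivative
        U 3 t k - mat_vec m N (D_mat m \<beta> N) (U 2 t) k) (at t within {0..T})"
      using has_derivative_U[of 2 t k] has_derivative_DU[of 1 t "D_mat m \<beta> N" k] assms
      by (intro DERIV_diff) (simp_all add: numeral_2_eq_2 numeral_3_eq_3)
  qed (use 1 assms in auto)
  then have "mat_vec m N (D_mat m \<beta> N) (U 2 t) k = U 3 t k - (tderiv T ^^ 2) ?G t k"
    by (simp add: numeral_2_eq_2)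
  then show ?thesis
    using U_bound[OF assms] g_bound[OF assms] unfolding U_def by linarith
qed

text \<open>The largest direction \<open>j\<close> in \<open>S\<close> is at least 2, so \<open>g j\<close> is constant in time and \<open>D\<^sub>j U'\<close> is the time
  derivative of \<open>\<phi> j\<close>. The remaining directions are smaller than \<open>j\<close>, and the assumption on mixed
  operators applies; it compares with a bounded derivative of \<open>u\<close>.\<close>

lemma D_prod_U1_bound:
  assumes "t \<in> {0..T}" and "k \<in> mindices m N" and "S \<subseteq> {1..m}" and "2 \<le> card S"
  shows "\<bar>D_prod m \<beta> N (sorted_list_of_set S) (U 1 t) k\<bar> \<le> (\<Prod>i=1..m. max 1 (\<beta> i)) * B + \<bar>K\<bar> * real m"
proof -
  have fin: "finite S"
    using assms(3) finite_subset by blast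
  define L where "L = sorted_list_of_set S"
  define js where "js = butlast L"
  define j where "j = last L"
  have L: "sorted_wrt (<) L" "set L = S" "length L = card S" "distinct L"
    using fin by (simp_all add: L_def)
  have "L \<noteq> []"
    using L(3) assms(4) by auto
  then have Ljs: "L = js @ [j]"
    by (simp add: js_def j_def)
  have js: "js \<noteq> []"
    using L(3) assms(4) Ljs by auto
  have ord: "sorted_wrt (<) js" "\<And>i. i \<in> set js \<Longrightarrow> i < j"
    using L(1) unfolding Ljs by (auto simp: sorted_wrt_append)
  have sub: "set L \<subseteq> {1..m}"
    using L(2) assms(3) by simp
  then have set_js: "set js \<subseteq> {1..<j}" and j: "j \<in> {1..m}"
    using ord(2) unfolding Ljs by auto
  have j2: "j \<in> {2..m}"
    using js set_js j by (cases js) auto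
  have lenL: "length L \<le> m"
    using card_mono[OF _ assms(3)] L(3) by simp
  have td: "tderiv T (\<phi> m \<beta> N u g j) t l = mat_vec m N (D_dir m \<beta> N j) (U 1 t) l" if l: "l \<in> mindices m N" for l
  proof (rule tderivI[OF T assms(1)], rule has_real_derivative_transform)
    have "((\<lambda>s. mat_vec m N (D_dir m \<beta> N j) (U 0 s) l + boundary_part m \<beta> N b j l) has_real_derivative
        mat_vec m N (D_dir m \<beta> N j) (U 1 t) l + 0) (at t within {0..T})"
      using has_derivative_DU[of 0 t "D_dir m \<beta> N j" l] assms(1) by (intro DERIV_add DERIV_const) simp
    then show "((\<lambda>s. mat_vec m N (D_dir m \<beta> N j) (U 0 s) l + boundary_part m \<beta> N b j l) has_real_derivative
        mat_vec m N (D_dir m \<beta> N j) (U 1 t) l) (at t within {0..T})"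
      by simp
    show "\<phi> m \<beta> N u g j s l = mat_vec m N (D_dir m \<beta> N j) (U 0 s) l + boundary_part m \<beta> N b j l" if "s \<in> {0..T}" for s
      using g_boundary[OF that l j2] by (simp add: \<phi>_def U_def)
  qed (use assms in auto)
  let ?X = "xderiv2_prod L (tderiv T u t) (grid_point m N k)"
  let ?p = "prod_list (map \<beta> L)"
  have "D_prod m \<beta> N L (U 1 t) k = D_prod m \<beta> N js (tderiv T (\<phi> m \<beta> N u g j) t) k"
    unfolding Ljs D_prod_snoc by (rule D_prod_cong) (use td assms(2) in auto)
  then have "\<bar>D_prod m \<beta> N L (U 1 t) k - ?p * ?X\<bar> \<le> K * ((\<Sum>l\<leftarrow>js. (dx N l)\<^sup>2) + (dx N j)\<^sup>2)"
    using mixed[OF assms(1) j js ord(1) set_js assms(2)] by (simp add: Ljs)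
  also have "\<dots> = K * (\<Sum>l\<leftarrow>L. (dx N l)\<^sup>2)"
    by (simp add: Ljs)
  also have "\<dots> \<le> \<bar>K\<bar> * real m"
  proof -
    have dx: "(dx N l)\<^sup>2 \<le> 1" for l
      by (simp add: dx_def power_le_one)
    have "(\<Sum>l\<leftarrow>L. (dx N l)\<^sup>2) \<le> real (length L)"
      using sum_list_mono[of L "\<lambda>l. (dx N l)\<^sup>2" "\<lambda>_. 1"] dx by (simp add: sum_list_triv)
    then have "(\<Sum>l\<leftarrow>L. (dx N l)\<^sup>2) \<le> real m"
      using lenL by linarith
    moreover have "0 \<le> (\<Sum>l\<leftarrow>L. (dx N l)\<^sup>2)"
      by (intro sum_list_nonneg) auto
    ultimately show ?thesis
      by (intro mult_mono) auto
  qed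
  finally have 1: "\<bar>D_prod m \<beta> N L (U 1 t) k - ?p * ?X\<bar> \<le> \<bar>K\<bar> * real m" .
  have X: "\<bar>?X\<bar> \<le> B"
    using lenL sub assms by (intro B(2) grid_point_in_cube) auto
  have p: "?p = (\<Prod>i\<in>S. \<beta> i)"
    using prod.distinct_set_conv_list[OF L(4), of \<beta>] L(2) by simp
  have "\<bar>?p\<bar> \<le> (\<Prod>i\<in>S. max 1 (\<beta> i))"
    unfolding p abs_prod by (intro prod_mono) (use \<beta> assms(3) in fastforce)
  also have "\<dots> \<le> (\<Prod>i=1..m. max 1 (\<beta> i))"
    using assms(3) by (intro prod_mono2) auto
  finally have "\<bar>?p * ?X\<bar> \<le> (\<Prod>i=1..m. max 1 (\<beta> i)) * B"
    unfolding abs_mult using X by (intro mult_mono) (auto intro!: prod_nonneg)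
  then show ?thesis
    using 1 unfolding L_def[symmetric] by linarith
qed

definition mode_eig :: "real \<Rightarrow> nat \<Rightarrow> (nat \<Rightarrow> nat) \<Rightarrow> real" where
  "mode_eig \<tau> j p = \<tau> / 2 * (\<beta> j * dirichlet_eig N j (p j))"

text \<open>The second condition defines \<open>d = \<tau> U' + (\<tau>\<^sup>2/2) g\<^sub>1' - Q (U(t + \<tau>) - U(t))\<close> through its sine transform, where
  the operator \<open>Q\<close> is a number.\<close>

definition is_local_defect :: "real \<Rightarrow> real \<Rightarrow> ((nat \<Rightarrow> nat) \<Rightarrow> real) \<Rightarrow> bool" where
  "is_local_defect \<tau> t d \<longleftrightarrow>
    (\<forall>k\<in>mindices m N. \<bar>d k\<bar> \<le> defect_const m \<beta> T C K B * \<tau> ^ 3) \<and>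
    (\<forall>p\<in>mindices m N. dst m N (\<lambda>k. of_real (d k)) p =
      of_real \<tau> * dst m N (\<lambda>k. of_real (U 1 t k)) p + of_real (\<tau>\<^sup>2 / 2) * dst m N (\<lambda>k. of_real (tderiv T (g 1) t k)) p -
      (\<Prod>j=1..m. of_real (1 + mode_eig \<tau> j p)) * dst m N (\<lambda>k. of_real (U 0 (t + \<tau>) k - U 0 t k)) p)"

lemma local_defect:
  assumes \<tau>: "0 < \<tau>" and t: "t \<in> {0..T}" "t + \<tau> \<in> {0..T}"
  obtains d where "is_local_defect \<tau> t d"
proof -
  define I where "I = {1..m}"
  \<comment> \<open>The subsets whose products of difference operators are not covered by Taylor expansion.\<close>
  define P2 where "P2 = {S \<in> Pow I. 2 \<le> card S}"
  define D where "D = mat_vec m N (D_mat m \<beta> N)"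
  define w where "w S k = D_prod m \<beta> N (sorted_list_of_set S) (U 0 (t + \<tau>)) k - D_prod m \<beta> N (sorted_list_of_set S) (U 0 t) k" for S k
  define A where "A k = \<tau> * U 1 t k + \<tau>\<^sup>2 / 2 * tderiv T (g 1) t k - (U 0 (t + \<tau>) k - U 0 t k)
      + \<tau> / 2 * (D (U 0 (t + \<tau>)) k - D (U 0 t) k)" for k
  define d where "d k = A k - (\<Sum>S\<in>P2. (- \<tau> / 2) ^ card S * w S k)" for k
  define M where "M = (\<Prod>i=1..m. max 1 (\<beta> i)) * B + \<bar>K\<bar> * real m"
  have finI: "finite I" "finite P2"
    by (simp_all add: I_def P2_def)
  have \<tau>T: "\<tau> \<le> T"
    using t by auto
  have M: "0 \<le> M"
    using B(1) by (auto simp: M_def intro!: mult_nonneg_nonneg add_nonneg_nonneg prod_nonneg)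
  have w: "\<bar>w S k\<bar> \<le> M * \<tau>" if S: "S \<in> P2" and k: "k \<in> mindices m N" for S k
  proof -
    have "norm (D_prod m \<beta> N (sorted_list_of_set S) (U 0 (t + \<tau>)) k - D_prod m \<beta> N (sorted_list_of_set S) (U 0 t) k)
        \<le> M * norm (t + \<tau> - t)"
    proof (rule field_differentiable_bound[of "{0..T}" _ "\<lambda>s. D_prod m \<beta> N (sorted_list_of_set S) (U 1 s) k"])
      fix s assume s: "s \<in> {0..T}"
      show "((\<lambda>s. D_prod m \<beta> N (sorted_list_of_set S) (U 0 s) k) has_real_derivative
          D_prod m \<beta> N (sorted_list_of_set S) (U 1 s) k) (at s within {0..T})"
        using has_derivative_U[of 0 s] s k by (intro has_derivative_D_prod) simp_all
      show "norm (D_prod m \<beta> N (sorted_list_of_set S) (U 1 s) k) \<le> M"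
        using D_prod_U1_bound[OF s k] S by (simp add: M_def P2_def I_def)
    qed (use t in auto)
    then show ?thesis
      using \<tau> by (simp add: w_def)
  qed
  have A: "\<bar>A k\<bar> \<le> 2 * \<bar>C\<bar> * \<tau> ^ 3" if k: "k \<in> mindices m N" for k
  proof -
    have R1: "\<bar>U 0 (t + \<tau>) k - U 0 t k - \<tau> * U 1 t k - \<tau>\<^sup>2 / 2 * U 2 t k\<bar> \<le> C * \<tau> ^ 3"
      by (rule second_order_expansion[of T "\<lambda>s. U 0 s k" "\<lambda>s. U 1 s k" "\<lambda>s. U 2 s k" "\<lambda>s. U 3 s k"])
        (use has_derivative_U[of 0 _ k] has_derivative_U[of 1 _ k] has_derivative_U[of 2 _ k] k t \<tau> U_bound in
          \<open>simp_all add: numeral_2_eq_2 numeral_3_eq_3 U_def\<close>)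
    have "\<bar>D (U 0 (t + \<tau>)) k - D (U 0 t) k - \<tau> * D (U 1 t) k\<bar> \<le> 2 * C * \<tau>\<^sup>2"
      by (rule first_order_expansion[of T "\<lambda>s. D (U 0 s) k" "\<lambda>s. D (U 1 s) k" "\<lambda>s. D (U 2 s) k"])
        (use has_derivative_DU[of 0 _ "D_mat m \<beta> N" k] has_derivative_DU[of 1 _ "D_mat m \<beta> N" k] D_mat_U2_bound[OF _ k] t \<tau> in
          \<open>simp_all add: numeral_2_eq_2 D_def\<close>)
    then have "\<tau> / 2 * \<bar>D (U 0 (t + \<tau>)) k - D (U 0 t) k - \<tau> * D (U 1 t) k\<bar> \<le> \<tau> / 2 * (2 * C * \<tau>\<^sup>2)"
      using \<tau> by (intro mult_left_mono) auto
    then have R2: "\<bar>\<tau> / 2 * (D (U 0 (t + \<tau>)) k - D (U 0 t) k - \<tau> * D (U 1 t) k)\<bar> \<le> C * \<tau> ^ 3"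
      using \<tau> by (simp add: abs_mult power2_eq_square power3_eq_cube)
    have "A k = \<tau> / 2 * (D (U 0 (t + \<tau>)) k - D (U 0 t) k - \<tau> * D (U 1 t) k)
        - (U 0 (t + \<tau>) k - U 0 t k - \<tau> * U 1 t k - \<tau>\<^sup>2 / 2 * U 2 t k)"
      unfolding A_def tderiv_g1[OF t(1) k] D_def[symmetric] by (simp add: power2_eq_square algebra_simps)
    then have "\<bar>A k\<bar> \<le> 2 * (C * \<tau> ^ 3)"
      using R1 R2 by linarith
    also have "\<dots> \<le> 2 * (\<bar>C\<bar> * \<tau> ^ 3)"
      using \<tau> by (intro mult_left_mono mult_right_mono) auto
    finally show ?thesis
      by simp
  qed
  have "is_local_defect \<tau> t d"
    unfolding is_local_defect_def
  proof (intro conjI ballI)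
    fix k assume k: "k \<in> mindices m N"
    have summand: "\<bar>(- \<tau> / 2) ^ card S * w S k\<bar> \<le> max 1 T ^ m * M * \<tau> ^ 3" if S: "S \<in> P2" for S
    proof -
      have cS: "2 \<le> card S" "card S \<le> m"
        using S card_mono[of "{1..m}" S] by (auto simp: P2_def I_def)
      have "\<bar>(- \<tau> / 2) ^ card S\<bar> \<le> \<tau> ^ card S"
        unfolding power_abs using \<tau> by (intro power_mono) auto
      also have "\<dots> = \<tau> ^ (card S - 2) * \<tau>\<^sup>2"
        using cS(1) by (metis le_add_diff_inverse2 power_add)
      also have "\<dots> \<le> max 1 T ^ m * \<tau>\<^sup>2"
      proof (rule mult_right_mono)
        have "\<tau> ^ (card S - 2) \<le> max 1 T ^ (card S - 2)"
          using \<tau> \<tau>T by (intro power_mono) auto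
        also have "\<dots> \<le> max 1 T ^ m"
          using cS by (intro power_increasing) auto
        finally show "\<tau> ^ (card S - 2) \<le> max 1 T ^ m" .
      qed simp
      finally have "\<bar>(- \<tau> / 2) ^ card S * w S k\<bar> \<le> max 1 T ^ m * \<tau>\<^sup>2 * (M * \<tau>)"
        unfolding abs_mult by (rule mult_mono) (use w[OF S k] in auto)
      then show ?thesis
        by (simp add: power2_eq_square power3_eq_cube ac_simps)
    qed
    have "\<bar>\<Sum>S\<in>P2. (- \<tau> / 2) ^ card S * w S k\<bar> \<le> (\<Sum>S\<in>P2. max 1 T ^ m * M * \<tau> ^ 3)"
      by (rule order_trans[OF sum_abs sum_mono[OF summand]])
    also have "\<dots> = real (card P2) * (max 1 T ^ m * M * \<tau> ^ 3)"
      by simp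
    also have "\<dots> \<le> 2 ^ m * (max 1 T ^ m * M * \<tau> ^ 3)"
    proof (rule mult_right_mono)
      have "card P2 \<le> card (Pow I)"
        by (intro card_mono) (auto simp: P2_def I_def)
      also have "\<dots> = 2 ^ m"
        by (simp add: card_Pow I_def)
      finally show "real (card P2) \<le> 2 ^ m"
        by (metis of_nat_le_iff of_nat_numeral of_nat_power)
    qed (use M \<tau> in auto)
    finally have "\<bar>d k\<bar> \<le> 2 * \<bar>C\<bar> * \<tau> ^ 3 + 2 ^ m * (max 1 T ^ m * M * \<tau> ^ 3)"
      unfolding d_def using A[OF k] by linarith
    then show "\<bar>d k\<bar> \<le> defect_const m \<beta> T C K B * \<tau> ^ 3"
      by (simp add: defect_const_def M_def algebra_simps)
  next
    fix p assume p: "p \<in> mindices m N"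
    define X where "X = dst m N (\<lambda>k. of_real (U 0 (t + \<tau>) k - U 0 t k)) p"
    define l where "l j = complex_of_real (mode_eig \<tau> j p)" for j
    have hat_w: "dst m N (\<lambda>k. of_real ((- \<tau> / 2) ^ card S * w S k)) p = (\<Prod>j\<in>S. l j) * X" if S: "S \<in> P2" for S
    proof -
      have fS: "finite S" "S \<subseteq> {1..m}"
        using S finI(1) by (auto simp: P2_def I_def intro: finite_subset)
      define e where "e j = - complex_of_real (\<beta> j * dirichlet_eig N j (p j))" for j
      have "dst m N (\<lambda>k. of_real (w S k)) p =
          (\<Prod>j\<leftarrow>sorted_list_of_set S. e j) * dst m N (\<lambda>k. of_real (U 0 (t + \<tau>) k)) p -
          (\<Prod>j\<leftarrow>sorted_list_of_set S. e j) * dst m N (\<lambda>k. of_real (U 0 t k)) p"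
        unfolding w_def of_real_diff dst_diff e_def using fS p by (simp only: dst_D_prod set_sorted_list_of_set)
      also have "(\<Prod>j\<leftarrow>sorted_list_of_set S. e j) = (\<Prod>j\<in>S. e j)"
        using prod.distinct_set_conv_list[OF distinct_sorted_list_of_set, of e S] fS by simp
      also have "(\<Prod>j\<in>S. e j) * dst m N (\<lambda>k. of_real (U 0 (t + \<tau>) k)) p -
          (\<Prod>j\<in>S. e j) * dst m N (\<lambda>k. of_real (U 0 t k)) p = (\<Prod>j\<in>S. e j) * X"
        by (simp add: X_def dst_diff right_diff_distrib)
      finally have "dst m N (\<lambda>k. of_real (w S k)) p = (\<Prod>j\<in>S. e j) * X" .
      moreover have "of_real ((- \<tau> / 2) ^ card S) * (\<Prod>j\<in>S. e j) = (\<Prod>j\<in>S. l j)"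
      proof -
        have "of_real ((- \<tau> / 2) ^ card S) * (\<Prod>j\<in>S. e j) = (\<Prod>j\<in>S. of_real (- \<tau> / 2) * e j)"
          by (simp only: prod.distrib prod_constant of_real_power)
        also have "\<dots> = (\<Prod>j\<in>S. l j)"
          by (rule prod.cong) (simp_all add: e_def l_def mode_eig_def)
        finally show ?thesis .
      qed
      ultimately show ?thesis
        by (simp only: of_real_mult dst_scale mult.assoc[symmetric])
    qed
    have hat_A: "dst m N (\<lambda>k. of_real (A k)) p = of_real \<tau> * dst m N (\<lambda>k. of_real (U 1 t k)) p
        + of_real (\<tau>\<^sup>2 / 2) * dst m N (\<lambda>k. of_real (tderiv T (g 1) t k)) p - X - (\<Sum>j\<in>I. l j) * X"
    proof -
      have DD: "dst m N (\<lambda>k. of_real (D v k)) p =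
          - (\<Sum>j\<in>I. of_real (\<beta> j * dirichlet_eig N j (p j))) * dst m N (\<lambda>k. of_real (v k)) p" for v
        unfolding D_def D_mat_apply of_real_sum dst_sum sum_negf[symmetric] sum_distrib_right
        by (rule sum.cong) (use p in \<open>simp_all only: I_def dst_D_dir\<close>)
      have l: "(\<Sum>j\<in>I. l j) = of_real (\<tau> / 2) * (\<Sum>j\<in>I. of_real (\<beta> j * dirichlet_eig N j (p j)))"
        by (simp add: l_def mode_eig_def sum_distrib_left)
      have "of_real (\<tau> / 2) * (dst m N (\<lambda>k. of_real (D (U 0 (t + \<tau>)) k)) p - dst m N (\<lambda>k. of_real (D (U 0 t) k)) p)
          = - (\<Sum>j\<in>I. l j) * X"
        unfolding DD l X_def of_real_diff dst_diff by (simp only: right_diff_distrib mult_minus_left mult_minus_right mult.assoc)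
      then show ?thesis
        unfolding A_def of_real_add of_real_diff of_real_mult dst_add dst_diff dst_scale
        by (simp add: X_def dst_diff)
    qed
    have "dst m N (\<lambda>k. of_real (d k)) p = dst m N (\<lambda>k. of_real (A k)) p - (\<Sum>S\<in>P2. (\<Prod>j\<in>S. l j) * X)"
      unfolding d_def of_real_diff of_real_sum dst_diff dst_sum by (simp only: hat_w cong: sum.cong)
    moreover have "(\<Prod>j\<in>I. 1 + l j) = 1 + (\<Sum>j\<in>I. l j) + (\<Sum>S\<in>P2. \<Prod>j\<in>S. l j)"
    proof -
      have Pow: "Pow I = insert {} ((\<lambda>j. {j}) ` I \<union> P2)"
      proof -
        have "S = {} \<or> S \<in> (\<lambda>j. {j}) ` I \<or> S \<in> P2" if "S \<subseteq> I" for S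
        proof -
          have "finite S"
            using that finI(1) finite_subset by blast
          consider "card S = 0" | "card S = 1" | "2 \<le> card S"
            by linarith
          then show ?thesis
          proof cases
            case 2
            then show ?thesis
              using that by (auto simp: card_1_singleton_iff)
          qed (use that \<open>finite S\<close> in \<open>auto simp: P2_def\<close>)
        qed
        then show ?thesis
          by (auto simp: P2_def)
      qed
      have "(\<Prod>j\<in>I. l j + 1) = (\<Sum>S\<in>Pow I. \<Prod>j\<in>S. l j)"
        using prod_add[OF finI(1), of l "\<lambda>_. 1"] by simp
      also have "\<dots> = 1 + ((\<Sum>S\<in>(\<lambda>j. {j}) ` I. \<Prod>j\<in>S. l j) + (\<Sum>S\<in>P2. \<Prod>j\<in>S. l j))"
        unfolding Pow using finI by (subst sum.insert; (subst sum.union_disjoint)?) (auto simp: P2_def)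
      also have "(\<Sum>S\<in>(\<lambda>j. {j}) ` I. \<Prod>j\<in>S. l j) = (\<Sum>j\<in>I. l j)"
        by (subst sum.reindex) auto
      finally show ?thesis
        by (simp add: add.commute add.assoc)
    qed
    then have "(\<Prod>j\<in>I. of_real (1 + mode_eig \<tau> j p)) * X = X + (\<Sum>j\<in>I. l j) * X + (\<Sum>S\<in>P2. (\<Prod>j\<in>S. l j) * X)"
      by (simp add: l_def distrib_right sum_distrib_right)
    ultimately show "dst m N (\<lambda>k. of_real (d k)) p =
      of_real \<tau> * dst m N (\<lambda>k. of_real (U 1 t k)) p + of_real (\<tau>\<^sup>2 / 2) * dst m N (\<lambda>k. of_real (tderiv T (g 1) t k)) p -
      (\<Prod>j=1..m. of_real (1 + mode_eig \<tau> j p)) * dst m N (\<lambda>k. of_real (U 0 (t + \<tau>) k - U 0 t k)) p"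
      unfolding hat_A X_def[symmetric] I_def[symmetric] by simp
  qed
  then show thesis
    by (rule that)
qed

end

section \<open>Error recursion and convergence\<close>

lemma mat_vec_id_minus:
  assumes "k \<in> mindices m N"
  shows "mat_vec m N (\<lambda>k l. id_mat k l - c * A k l) v k = v k - c * mat_vec m N A v k"
proof -
  have "(\<Sum>l\<in>mindices m N. id_mat k l * v l) = (\<Sum>l\<in>mindices m N. if k = l then v l else 0)"
    by (rule sum.cong) (simp_all add: id_mat_def)
  then show ?thesis
    using assms by (simp add: mat_vec_def left_diff_distrib sum_subtractf sum_distrib_left mult.assoc)
qed

text \<open>The discrete variation-of-constants formula.\<close>

lemma accumulated_multiplier_bound:
  assumes "\<And>k. k \<in> mindices m N \<Longrightarrow> W 0 k = 0"
    and step: "\<And>n p. n < M \<Longrightarrow> p \<in> mindices m N \<Longrightarrow>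
      dst m N (W (Suc n)) p = r p * dst m N (W n) p + Q p * dst m N (e n) p"
    and mult: "\<And>i. multiplier_bound m N (\<lambda>p. r p ^ i * Q p) A"
    and e: "\<And>n k. n < M \<Longrightarrow> k \<in> mindices m N \<Longrightarrow> cmod (e n k) \<le> \<delta>"
    and "n \<le> M" and k: "k \<in> mindices m N"
  shows "cmod (W n k) \<le> real n * (A * \<delta>)"
proof -
  have rep: "dst m N (W n) p = (\<Sum>i<n. r p ^ (n - Suc i) * Q p * dst m N (e i) p)"
    if "n \<le> M" "p \<in> mindices m N" for n p
    using that(1)
  proof (induction n)
    case 0
    show ?case
      using assms(1) by (simp add: dst_def)
  next
    case (Suc n)
    have "r p * (\<Sum>i<n. r p ^ (n - Suc i) * Q p * dst m N (e i) p) = (\<Sum>i<n. r p ^ (Suc n - Suc i) * Q p * dst m N (e i) p)"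
      unfolding sum_distrib_left
    proof (rule sum.cong)
      fix i assume "i \<in> {..<n}"
      then have "Suc n - Suc i = Suc (n - Suc i)"
        by auto
      then show "r p * (r p ^ (n - Suc i) * Q p * dst m N (e i) p) = r p ^ (Suc n - Suc i) * Q p * dst m N (e i) p"
        by (simp only: power_Suc mult.assoc)
    qed simp
    then show ?case
      using Suc step[of n p] that(2) by simp
  qed
  have "W n k = dst m N (dst m N (W n)) k"
    using dst_dst[OF k, of "W n"] by simp
  also have "\<dots> = dst m N (\<lambda>p. \<Sum>i<n. r p ^ (n - Suc i) * Q p * dst m N (e i) p) k"
    by (rule dst_cong) (rule rep[OF assms(5)])
  also have "\<dots> = (\<Sum>i<n. dst m N (\<lambda>p. r p ^ (n - Suc i) * Q p * dst m N (e i) p) k)"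
    by (rule dst_sum)
  also have "cmod \<dots> \<le> (\<Sum>i<n. A * \<delta>)"
  proof (rule order_trans[OF norm_sum sum_mono])
    fix i assume "i \<in> {..<n}"
    then have "\<forall>k\<in>mindices m N. cmod (e i k) \<le> \<delta>"
      using e assms(5) by auto
    then show "cmod (dst m N (\<lambda>p. r p ^ (n - Suc i) * Q p * dst m N (e i) p) k) \<le> A * \<delta>"
      using mult k unfolding multiplier_bound_def by blast
  qed
  finally show ?thesis
    by simp
qed

context semidiscrete_solution
begin

text \<open>The stages telescope: each one removes a factor \<open>1 + \<lambda>\<^sub>j\<close>, and \<open>g j\<close> contributes only for \<open>j = 1\<close>.\<close>

lemma amf_step_transform:
  assumes step: "amf_w_step m \<beta> T N g (1/2) \<tau> t v w"
    and g0: "\<And>j k. j \<in> {2..m} \<Longrightarrow> k \<in> mindices m N \<Longrightarrow> tderiv T (g j) t k = 0"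
    and p: "p \<in> mindices m N"
  shows "(\<Prod>j=1..m. of_real (1 + mode_eig \<tau> j p)) * dst m N (\<lambda>k. of_real (w k - v k)) p =
    of_real \<tau> * dst m N (\<lambda>k. of_real (mat_vec m N (D_mat m \<beta> N) v k + (\<Sum>j=1..m. g j t k))) p
    + of_real (\<tau>\<^sup>2 / 2) * dst m N (\<lambda>k. of_real (tderiv T (g 1) t k)) p"
proof -
  obtain K where K: "\<And>k. k \<in> mindices m N \<Longrightarrow> K 0 k = \<tau> * mat_vec m N (D_mat m \<beta> N) v k + \<tau> * (\<Sum>j=1..m. g j t k)"
    "\<And>j k. j \<in> {1..m} \<Longrightarrow> k \<in> mindices m N \<Longrightarrow>
      mat_vec m N (\<lambda>k l. id_mat k l - 1/2 * \<tau> * D_dir m \<beta> N j k l) (K j) k = K (j - 1) k + 1/2 * \<tau>\<^sup>2 * tderiv T (g j) t k"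
    "\<And>k. k \<in> mindices m N \<Longrightarrow> w k = v k + K m k"
    using step unfolding amf_w_step_def by blast
  define x where "x j = dst m N (\<lambda>k. of_real (K j k)) p" for j
  define G where "G = of_real (\<tau>\<^sup>2 / 2) * dst m N (\<lambda>k. of_real (tderiv T (g 1) t k)) p"
  have stage: "of_real (1 + mode_eig \<tau> j p) * x j = x (j - 1) + (if j = 1 then G else 0)" if j: "j \<in> {1..m}" for j
  proof -
    have "K j k - \<tau> / 2 * mat_vec m N (D_dir m \<beta> N j) (K j) k = K (j - 1) k + \<tau>\<^sup>2 / 2 * (if j = 1 then tderiv T (g 1) t k else 0)"
      if k: "k \<in> mindices m N" for k
      using K(2)[OF j k] g0[of j k] j k unfolding mat_vec_id_minus[OF k] by auto
    then have "dst m N (\<lambda>k. of_real (K j k - \<tau> / 2 * mat_vec m N (D_dir m \<beta> N j) (K j) k)) p =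
        dst m N (\<lambda>k. of_real (K (j - 1) k + \<tau>\<^sup>2 / 2 * (if j = 1 then tderiv T (g 1) t k else 0))) p"
      by (intro dst_cong) simp
    moreover have "dst m N (\<lambda>k. of_real (K j k - \<tau> / 2 * mat_vec m N (D_dir m \<beta> N j) (K j) k)) p =
        of_real (1 + mode_eig \<tau> j p) * x j"
      unfolding of_real_diff of_real_mult[of "\<tau> / 2" "mat_vec _ _ _ _ _"] dst_diff dst_scale dst_D_dir[OF j p]
      by (simp add: x_def mode_eig_def distrib_right)
    moreover have "dst m N (\<lambda>k. of_real (K (j - 1) k + \<tau>\<^sup>2 / 2 * (if j = 1 then tderiv T (g 1) t k else 0))) p =
        x (j - 1) + (if j = 1 then G else 0)"
      unfolding of_real_add of_real_mult[of "\<tau>\<^sup>2 / 2" "if _ then _ else _"] dst_add dst_scale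
      by (simp add: x_def G_def dst_def)
    ultimately show ?thesis
      by simp
  qed
  have "(\<Prod>j=1..n. of_real (1 + mode_eig \<tau> j p)) * x n = x 0 + (if 1 \<le> n then G else 0)" if "n \<le> m" for n
    using that
  proof (induction n)
    case (Suc n)
    have "(\<Prod>j=1..Suc n. of_real (1 + mode_eig \<tau> j p)) * x (Suc n) =
        (\<Prod>j=1..n. of_real (1 + mode_eig \<tau> j p)) * (of_real (1 + mode_eig \<tau> (Suc n) p) * x (Suc n))"
      by (simp add: mult.assoc)
    also have "\<dots> = (\<Prod>j=1..n. of_real (1 + mode_eig \<tau> j p)) * (x n + (if n = 0 then G else 0))"
      using stage[of "Suc n"] Suc.prems by simp
    also have "\<dots> = x 0 + G"
      using Suc by (cases "n = 0") simp_all
    finally show ?case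
      by simp
  qed simp
  then have "(\<Prod>j=1..m. of_real (1 + mode_eig \<tau> j p)) * x m = x 0 + G"
    using m by simp
  moreover have "x m = dst m N (\<lambda>k. of_real (w k - v k)) p"
    unfolding x_def by (rule dst_cong) (simp add: K(3))
  moreover have "x 0 = of_real \<tau> * dst m N (\<lambda>k. of_real (mat_vec m N (D_mat m \<beta> N) v k + (\<Sum>j=1..m. g j t k))) p"
    unfolding x_def dst_scale[symmetric] by (rule dst_cong) (simp add: K(1) distrib_left)
  ultimately show ?thesis
    by (simp add: G_def)
qed

lemma dst_D_mat:
  assumes "p \<in> mindices m N"
  shows "of_real \<tau> * dst m N (\<lambda>k. of_real (mat_vec m N (D_mat m \<beta> N) v k)) p =
    - 2 * (\<Sum>j=1..m. of_real (mode_eig \<tau> j p)) * dst m N (\<lambda>k. of_real (v k)) p"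
proof -
  have "dst m N (\<lambda>k. of_real (mat_vec m N (D_mat m \<beta> N) v k)) p =
      (\<Sum>j=1..m. - of_real (\<beta> j * dirichlet_eig N j (p j)) * dst m N (\<lambda>k. of_real (v k)) p)"
    unfolding D_mat_apply of_real_sum dst_sum by (rule sum.cong) (use assms in \<open>simp_all only: dst_D_dir\<close>)
  then show ?thesis
    by (simp add: mode_eig_def sum_distrib_left sum_distrib_right sum_negf[symmetric] mult.assoc)
qed

lemma mode_eig_eq: "mode_eig \<tau> j p = \<tau> * \<beta> j / (dx N j)\<^sup>2 * (1 - cos (pi * real (p j) / (real (N j) + 1)))"
proof -
  have "\<tau> / 2 * (\<beta> j * (2 * x / y)) = \<tau> * \<beta> j / y * x" for x y :: real
    by simp
  then show ?thesis
    by (simp only: mode_eig_def dirichlet_eig_def)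
qed

lemma mode_eig_nonneg:
  assumes "0 \<le> \<tau>" and "j \<in> {1..m}"
  shows "0 \<le> mode_eig \<tau> j p"
  using assms \<beta>[OF assms(2)] by (simp add: mode_eig_eq)

lemma stability_symbol_mode:
  assumes "0 \<le> \<tau>"
  shows "stability_symbol {1..m} (\<lambda>j. of_real (1 / (1 + mode_eig \<tau> j p))) =
    1 - 2 * (\<Sum>j=1..m. of_real (mode_eig \<tau> j p)) * (\<Prod>j=1..m. of_real (1 / (1 + mode_eig \<tau> j p)))"
proof -
  define y where "y j = complex_of_real (1 / (1 + mode_eig \<tau> j p))" for j
  have "(1 - y j) * (\<Prod>i\<in>{1..m} - {j}. y i) = of_real (mode_eig \<tau> j p) * (\<Prod>j=1..m. y j)" if j: "j \<in> {1..m}" for j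
  proof -
    have "1 / (1 + mode_eig \<tau> j p) * mode_eig \<tau> j p = 1 - 1 / (1 + mode_eig \<tau> j p)"
      using mode_eig_nonneg[OF assms j, of p] by (simp add: field_simps)
    then have "1 - y j = of_real (mode_eig \<tau> j p) * y j"
      by (metis y_def mult.commute of_real_1 of_real_diff of_real_mult)
    then show ?thesis
      using j by (subst prod.remove[of "{1..m}" j]) simp_all
  qed
  then show ?thesis
    unfolding stability_symbol_def y_def[symmetric] by (simp add: sum_distrib_right mult.assoc)
qed

text \<open>The recursion is applied to \<open>E\<^sub>n - E\<^sub>0\<close>, which starts at zero. This turns the initial error into the
  additional inhomogeneity \<open>\<tau> D E\<^sub>0\<close>, of size \<open>\<tau>\<^sup>3\<close> like the defect.\<close>

lemma global_error:
  assumes N: "\<And>j. j \<in> {1..m} \<Longrightarrow> 1 \<le> N j" and \<tau>: "0 < \<tau>" and M: "T = real M * \<tau>"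
    and g0: "\<And>t j k. t \<in> {0..T} \<Longrightarrow> j \<in> {2..m} \<Longrightarrow> k \<in> mindices m N \<Longrightarrow> tderiv T (g j) t k = 0"
    and step: "\<And>n. n < M \<Longrightarrow> amf_w_step m \<beta> T N g (1/2) \<tau> (real n * \<tau>) (V n) (V (Suc n))"
    and E0: "\<And>k. k \<in> mindices m N \<Longrightarrow> \<bar>mat_vec m N (D_mat m \<beta> N) (\<lambda>k. V 0 k - U 0 0 k) k\<bar> \<le> K0 * \<tau>\<^sup>2"
    and n: "n \<in> {1..M}" and k: "k \<in> mindices m N"
  shows "\<bar>V n k - U 0 (real n * \<tau>) k\<bar> \<le>
    (K0 / (8 * \<beta> 1) + T * (amf_const m * (defect_const m \<beta> T C K B + K0))) * \<tau>\<^sup>2"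
proof -
  define D where "D = mat_vec m N (D_mat m \<beta> N)"
  define E where "E n k = V n k - U 0 (real n * \<tau>) k" for n k
  define X where "X = defect_const m \<beta> T C K B + K0"
  define r where "r p = stability_symbol {1..m} (\<lambda>j. of_real (1 / (1 + mode_eig \<tau> j p)))" for p
  define Q where "Q p = (\<Prod>j=1..m. complex_of_real (1 / (1 + mode_eig \<tau> j p)))" for p
  have time: "real i * \<tau> \<in> {0..T}" if "i \<le> M" for i
    using that \<tau> by (simp add: M mult_right_mono)
  have "\<exists>d. is_local_defect \<tau> (real i * \<tau>) d" if i: "i < M" for i
  proof -
    have "real (Suc i) * \<tau> = real i * \<tau> + \<tau>"
      by (simp add: distrib_right)
    then have "real i * \<tau> \<in> {0..T}" and "real i * \<tau> + \<tau> \<in> {0..T}"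
      using time[of i] time[of "Suc i"] i by auto
    then show ?thesis
      by (rule local_defect[OF \<tau>]) blast
  qed
  then obtain d where d: "\<And>i. i < M \<Longrightarrow> is_local_defect \<tau> (real i * \<tau>) (d i)"
    by metis
  define e where "e i k = d i k + \<tau> * D (E 0) k" for i k
  have E0': "\<bar>D (E 0) k\<bar> \<le> K0 * \<tau>\<^sup>2" if "k \<in> mindices m N" for k
    using E0[OF that] unfolding D_def E_def by simp
  have e: "\<bar>e i k\<bar> \<le> X * \<tau> ^ 3" if "i < M" "k \<in> mindices m N" for i k
  proof -
    have "\<tau> * \<bar>D (E 0) k\<bar> \<le> \<tau> * (K0 * \<tau>\<^sup>2)"
      using E0'[OF that(2)] \<tau> by (intro mult_left_mono) auto
    then have "\<bar>\<tau> * D (E 0) k\<bar> \<le> K0 * \<tau> ^ 3"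
      using \<tau> by (simp add: abs_mult power2_eq_square power3_eq_cube)
    moreover have "\<bar>d i k\<bar> \<le> defect_const m \<beta> T C K B * \<tau> ^ 3"
      using d[OF that(1)] that(2) by (simp add: is_local_defect_def)
    ultimately show ?thesis
      unfolding e_def X_def distrib_right by linarith
  qed
  define W where "W n k = complex_of_real (E n k - E 0 k)" for n k
  have "cmod (W n k) \<le> real n * (amf_const m * (X * \<tau> ^ 3))"
  proof (rule accumulated_multiplier_bound[where W = W and r = r and Q = Q and e = "\<lambda>i k. of_real (e i k)" and M = M])
    fix i p assume i: "i < M" and p: "p \<in> mindices m N"
    let ?q = "\<Prod>j=1..m. complex_of_real (1 + mode_eig \<tau> j p)"
    let ?s = "\<Sum>j=1..m. complex_of_real (mode_eig \<tau> j p)"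
    have qQ: "?q * Q p = 1"
    proof -
      have "complex_of_real (1 + mode_eig \<tau> j p) * of_real (1 / (1 + mode_eig \<tau> j p)) = 1" if "j \<in> {1..m}" for j
      proof -
        have "(1 + mode_eig \<tau> j p) * (1 / (1 + mode_eig \<tau> j p)) = 1"
          using mode_eig_nonneg[OF less_imp_le[OF \<tau>] that, of p] by simp
        then show ?thesis
          by (simp only: of_real_mult[symmetric] of_real_1)
      qed
      then show ?thesis
        unfolding Q_def prod.distrib[symmetric] by (intro prod.neutral) blast
    qed
    have lin: "D (V i) k + (\<Sum>j=1..m. g j (real i * \<tau>) k) = D (E i) k + U 1 (real i * \<tau>) k" if "k \<in> mindices m N" for k
    proof -
      have "D (E i) k = D (V i) k - D (U 0 (real i * \<tau>)) k"
        by (simp add: D_def E_def mat_vec_def right_diff_distrib sum_subtractf)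
      then show ?thesis
        using ode[OF time[of i] that] i by (simp add: D_def)
    qed
    have "?q * dst m N (\<lambda>k. of_real (V (Suc i) k - V i k)) p =
        of_real \<tau> * dst m N (\<lambda>k. of_real (D (V i) k + (\<Sum>j=1..m. g j (real i * \<tau>) k))) p
        + of_real (\<tau>\<^sup>2 / 2) * dst m N (\<lambda>k. of_real (tderiv T (g 1) (real i * \<tau>) k)) p"
      unfolding D_def by (rule amf_step_transform[OF step[OF i] g0[OF time] p]) (use i in auto)
    also have "dst m N (\<lambda>k. of_real (D (V i) k + (\<Sum>j=1..m. g j (real i * \<tau>) k))) p =
        dst m N (\<lambda>k. of_real (D (E i) k + U 1 (real i * \<tau>) k)) p"
      by (rule dst_cong) (simp only: lin)
    also have "\<dots> = dst m N (\<lambda>k. of_real (D (E i) k)) p + dst m N (\<lambda>k. of_real (U 1 (real i * \<tau>) k)) p"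
      by (simp only: of_real_add dst_add)
    finally have V: "?q * dst m N (\<lambda>k. of_real (V (Suc i) k - V i k)) p =
        of_real \<tau> * dst m N (\<lambda>k. of_real (D (E i) k)) p + of_real \<tau> * dst m N (\<lambda>k. of_real (U 1 (real i * \<tau>) k)) p
        + of_real (\<tau>\<^sup>2 / 2) * dst m N (\<lambda>k. of_real (tderiv T (g 1) (real i * \<tau>) k)) p"
      by (simp only: distrib_left)
    have suc: "real (Suc i) * \<tau> = real i * \<tau> + \<tau>"
      by (simp add: distrib_right)
    have hat_d: "dst m N (\<lambda>k. of_real (d i k)) p = of_real \<tau> * dst m N (\<lambda>k. of_real (U 1 (real i * \<tau>) k)) p
        + of_real (\<tau>\<^sup>2 / 2) * dst m N (\<lambda>k. of_real (tderiv T (g 1) (real i * \<tau>) k)) p -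
        ?q * dst m N (\<lambda>k. of_real (U 0 (real (Suc i) * \<tau>) k - U 0 (real i * \<tau>) k)) p"
      using d[OF i] p unfolding is_local_defect_def suc by blast
    have "dst m N (W (Suc i)) p - dst m N (W i) p =
        dst m N (\<lambda>k. of_real (V (Suc i) k - V i k)) p
        - dst m N (\<lambda>k. of_real (U 0 (real (Suc i) * \<tau>) k - U 0 (real i * \<tau>) k)) p"
      unfolding dst_diff[symmetric] by (rule dst_cong) (simp add: W_def E_def)
    then have "?q * (dst m N (W (Suc i)) p - dst m N (W i) p) =
        of_real \<tau> * dst m N (\<lambda>k. of_real (D (E i) k)) p + dst m N (\<lambda>k. of_real (d i k)) p"
      using V hat_d by (simp add: right_diff_distrib)
    moreover have "of_real \<tau> * dst m N (\<lambda>k. of_real (D (E i) k)) p =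
        - 2 * ?s * dst m N (W i) p + of_real \<tau> * dst m N (\<lambda>k. of_real (D (E 0) k)) p"
    proof -
      have "dst m N (\<lambda>k. of_real (E i k)) p = dst m N (W i) p + dst m N (\<lambda>k. of_real (E 0 k)) p"
        unfolding dst_add[symmetric] by (rule dst_cong) (simp add: W_def)
      then show ?thesis
        unfolding D_def dst_D_mat[OF p] by (simp only: distrib_left)
    qed
    moreover have "dst m N (\<lambda>k. of_real (e i k)) p =
        dst m N (\<lambda>k. of_real (d i k)) p + of_real \<tau> * dst m N (\<lambda>k. of_real (D (E 0) k)) p"
      by (simp only: e_def of_real_add of_real_mult dst_add dst_scale)
    ultimately have "?q * (dst m N (W (Suc i)) p - dst m N (W i) p) =
        - 2 * ?s * dst m N (W i) p + dst m N (\<lambda>k. of_real (e i k)) p"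
      by simp
    then have "Q p * ?q * (dst m N (W (Suc i)) p - dst m N (W i) p) =
        Q p * (- 2 * ?s * dst m N (W i) p + dst m N (\<lambda>k. of_real (e i k)) p)"
      by (simp only: mult.assoc)
    then have W: "dst m N (W (Suc i)) p = dst m N (W i) p + Q p * (- 2 * ?s * dst m N (W i) p + dst m N (\<lambda>k. of_real (e i k)) p)"
      unfolding mult.commute[of "Q p" ?q] qQ mult_1 by (simp only: diff_eq_eq add.commute)
    have r: "r p = 1 - 2 * ?s * Q p"
      unfolding r_def Q_def by (rule stability_symbol_mode) (use \<tau> in simp)
    show "dst m N (W (Suc i)) p = r p * dst m N (W i) p + Q p * dst m N (\<lambda>k. of_real (e i k)) p"
      unfolding W r by (simp add: algebra_simps)
  next
    fix i
    show "multiplier_bound m N (\<lambda>p. r p ^ i * Q p) (amf_const m)"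
      unfolding r_def Q_def
      by (rule multiplier_bound_amf[OF m, of "\<lambda>i. \<tau> * \<beta> i / (dx N i)\<^sup>2"])
        (use \<tau> \<beta> in \<open>auto simp: mode_eig_eq dx_def intro!: divide_pos_pos mult_pos_pos\<close>)
  next
    show "cmod (complex_of_real (e i k)) \<le> X * \<tau> ^ 3" if "i < M" "k \<in> mindices m N" for i k
      unfolding norm_of_real by (rule e[OF that])
  qed (use n k in \<open>auto simp: W_def\<close>)
  then have "\<bar>E n k - E 0 k\<bar> \<le> (real n * \<tau>) * (amf_const m * X) * \<tau>\<^sup>2"
    unfolding W_def norm_of_real by (simp add: power2_eq_square power3_eq_cube ac_simps)
  also have "\<dots> \<le> T * (amf_const m * X) * \<tau>\<^sup>2"
  proof (intro mult_right_mono mult_nonneg_nonneg)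
    show "real n * \<tau> \<le> T"
      using time[of n] n by simp
    have "0 \<le> X * \<tau> ^ 3"
      using e[of 0 k] n k by (meson abs_ge_zero atLeastAtMost_iff less_le_trans order_trans zero_less_one)
    then show "0 \<le> X"
      using \<tau> by (simp add: zero_le_mult_iff)
    show "0 \<le> amf_const m"
      by (rule amf_const_nonneg[OF m])
  qed simp
  finally have "\<bar>E n k - E 0 k\<bar> \<le> T * (amf_const m * X) * \<tau>\<^sup>2" .
  moreover have "\<bar>E 0 k\<bar> \<le> K0 * \<tau>\<^sup>2 / (8 * \<beta> 1)"
    by (rule D_mat_inverse_bound[OF m \<beta> k]) (use E0' in \<open>auto simp: D_def\<close>)
  ultimately have "\<bar>E n k\<bar> \<le> K0 * \<tau>\<^sup>2 / (8 * \<beta> 1) + T * (amf_const m * X) * \<tau>\<^sup>2"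
    by linarith
  then show ?thesis
    by (simp add: E_def X_def distrib_right)
qed

end

theorem theorem2:
  fixes m :: nat and \<beta> :: "nat \<Rightarrow> real" and T C Cphi K Kc K0 :: real
    and c u :: "real \<Rightarrow> (nat \<Rightarrow> real) \<Rightarrow> real" and u0 b :: "(nat \<Rightarrow> real) \<Rightarrow> real"
  assumes "m \<ge> 1" and "T > 0" and "\<And>j. j \<in> {1..m} \<Longrightarrow> \<beta> j > 0"
    and "solves_pde m \<beta> T c u0 b u"
    and "smooth_upto (2 * m + 2) m T u"
  shows "\<exists>C'. \<forall>(N :: nat \<Rightarrow> nat) (g :: nat \<Rightarrow> real \<Rightarrow> (nat \<Rightarrow> nat) \<Rightarrow> real)
             (\<tau> :: real) (nstar :: nat) (V :: nat \<Rightarrow> (nat \<Rightarrow> nat) \<Rightarrow> real).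
    (\<forall>j\<in>{1..m}. N j \<ge> 1) \<and>
    semidiscretization m \<beta> T N Kc c b u g \<and>
    (\<forall>t\<in>{0..T}. \<forall>j\<in>{1..m}. \<forall>i\<in>{1, 2}.
       max_norm m N ((tderiv T ^^ i) (\<phi> m \<beta> N u g j) t) \<le> Cphi) \<and>
    (\<forall>t\<in>{0..T}. \<forall>j\<in>{0..4}. max_norm m N ((tderiv T ^^ j) (on_grid m N u) t) \<le> C) \<and>
    (\<forall>t\<in>{0..T}. \<forall>i\<in>{0..3}.
       max_norm m N ((tderiv T ^^ i) (\<lambda>s k. \<Sum>j=1..m. g j s k) t) \<le> C) \<and>
    (\<forall>t\<in>{0..T}. \<forall>j\<in>{2..m}. \<forall>k\<in>mindices m N. tderiv T (g j) t k = 0) \<and>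
    (\<forall>t\<in>{0..T}. \<forall>j\<in>{1..m}. \<forall>js. js \<noteq> [] \<and> sorted_wrt (<) js \<and> set js \<subseteq> {1..<j} \<longrightarrow>
       (\<forall>i\<in>{1, 2}.
          max_norm m N (\<lambda>k.
            D_prod m \<beta> N js ((tderiv T ^^ i) (\<phi> m \<beta> N u g j) t) k -
            prod_list (map \<beta> js) * \<beta> j *
              xderiv2_prod (js @ [j]) ((tderiv T ^^ i) u t) (grid_point m N k))
          \<le> K * ((\<Sum>l\<leftarrow>js. (dx N l)\<^sup>2) + (dx N j)\<^sup>2))) \<and>
    \<tau> > 0 \<and> T / \<tau> = real nstar \<and>
    (\<forall>n<nstar. amf_w_step m \<beta> T N g (1 / 2) \<tau> (real n * \<tau>) (V n) (V (Suc n))) \<and>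
    max_norm m N (mat_vec m N (D_mat m \<beta> N) (\<lambda>k. V 0 k - on_grid m N u 0 k)) \<le> K0 * \<tau>\<^sup>2
    \<longrightarrow> (\<forall>n\<in>{1..nstar}.
           max_norm m N (\<lambda>k. V n k - on_grid m N u (real n * \<tau>) k) \<le> C' * \<tau>\<^sup>2)"
proof -
  obtain B where B: "0 \<le> B"
    "\<And>js t x. set js \<subseteq> {1..m} \<Longrightarrow> 2 * length js + 1 \<le> 2 * m + 2 \<Longrightarrow> t \<in> {0..T} \<Longrightarrow> x \<in> cube m \<Longrightarrow>
      \<bar>xderiv2_prod js (tderiv T u t) x\<bar> \<le> B"
    using xderiv2_prod_bounded[OF assms(5)] by blast
  let ?C' = "K0 / (8 * \<beta> 1) + T * (amf_const m * (defect_const m \<beta> T C K B + K0))"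
  show ?thesis
  proof (intro exI[of _ ?C'] allI impI ballI, elim conjE)
    fix N :: "nat \<Rightarrow> nat" and g :: "nat \<Rightarrow> real \<Rightarrow> (nat \<Rightarrow> nat) \<Rightarrow> real" and \<tau> :: real and nstar n :: nat
      and V :: "nat \<Rightarrow> (nat \<Rightarrow> nat) \<Rightarrow> real"
    assume N: "\<forall>j\<in>{1..m}. N j \<ge> 1" and sd: "semidiscretization m \<beta> T N Kc c b u g"
      and U_bound: "\<forall>t\<in>{0..T}. \<forall>j\<in>{0..4}. max_norm m N ((tderiv T ^^ j) (on_grid m N u) t) \<le> C"
      and g_bound: "\<forall>t\<in>{0..T}. \<forall>i\<in>{0..3}. max_norm m N ((tderiv T ^^ i) (\<lambda>s k. \<Sum>j=1..m. g j s k) t) \<le> C"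
      and g0: "\<forall>t\<in>{0..T}. \<forall>j\<in>{2..m}. \<forall>k\<in>mindices m N. tderiv T (g j) t k = 0"
      and mixed: "\<forall>t\<in>{0..T}. \<forall>j\<in>{1..m}. \<forall>js. js \<noteq> [] \<and> sorted_wrt (<) js \<and> set js \<subseteq> {1..<j} \<longrightarrow>
       (\<forall>i\<in>{1, 2}.
          max_norm m N (\<lambda>k.
            D_prod m \<beta> N js ((tderiv T ^^ i) (\<phi> m \<beta> N u g j) t) k -
            prod_list (map \<beta> js) * \<beta> j *
              xderiv2_prod (js @ [j]) ((tderiv T ^^ i) u t) (grid_point m N k))
          \<le> K * ((\<Sum>l\<leftarrow>js. (dx N l)\<^sup>2) + (dx N j)\<^sup>2))"
      and \<tau>: "\<tau> > 0" and nstar: "T / \<tau> = real nstar"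
      and step: "\<forall>n<nstar. amf_w_step m \<beta> T N g (1 / 2) \<tau> (real n * \<tau>) (V n) (V (Suc n))"
      and E0: "max_norm m N (mat_vec m N (D_mat m \<beta> N) (\<lambda>k. V 0 k - on_grid m N u 0 k)) \<le> K0 * \<tau>\<^sup>2"
      and n: "n \<in> {1..nstar}"
    have mixed1: "max_norm m N (\<lambda>k.
            D_prod m \<beta> N js (tderiv T (\<phi> m \<beta> N u g j) t) k -
            prod_list (map \<beta> js) * \<beta> j * xderiv2_prod (js @ [j]) (tderiv T u t) (grid_point m N k))
          \<le> K * ((\<Sum>l\<leftarrow>js. (dx N l)\<^sup>2) + (dx N j)\<^sup>2)"
      if "t \<in> {0..T}" "j \<in> {1..m}" "js \<noteq> []" "sorted_wrt (<) js" "set js \<subseteq> {1..<j}" for t j js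
      using mixed[rule_format, OF that(1,2), of js 1] that(3-5) by simp
    interpret semidiscrete_solution m \<beta> T C K Kc B c u b N g
    proof
      show "\<bar>(tderiv T ^^ 3) (on_grid m N u) t k\<bar> \<le> C" if "t \<in> {0..T}" "k \<in> mindices m N" for t k
        using order_trans[OF abs_le_max_norm[OF that(2)] U_bound[rule_format, OF that(1), of 3]] by simp
      show "\<bar>(tderiv T ^^ 2) (\<lambda>s k. \<Sum>j=1..m. g j s k) t k\<bar> \<le> C" if "t \<in> {0..T}" "k \<in> mindices m N" for t k
        using order_trans[OF abs_le_max_norm[OF that(2)] g_bound[rule_format, OF that(1), of 2]] by simp
      show "\<bar>D_prod m \<beta> N js (tderiv T (\<phi> m \<beta> N u g j) t) k -
          prod_list (map \<beta> js) * \<beta> j * xderiv2_prod (js @ [j]) (tderiv T u t) (grid_point m N k)\<bar>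
        \<le> K * ((\<Sum>l\<leftarrow>js. (dx N l)\<^sup>2) + (dx N j)\<^sup>2)"
        if "t \<in> {0..T}" "j \<in> {1..m}" "js \<noteq> []" "sorted_wrt (<) js" "set js \<subseteq> {1..<j}" "k \<in> mindices m N" for t j js k
        using order_trans[OF abs_le_max_norm[OF that(6)] mixed1[OF that(1-5)]] .
    qed (use assms sd B in auto)
    have U0: "U 0 = on_grid m N u"
      by (simp add: U_def)
    show "max_norm m N (\<lambda>k. V n k - on_grid m N u (real n * \<tau>) k) \<le> ?C' * \<tau>\<^sup>2"
    proof (rule max_norm_le)
      show "mindices m N \<noteq> {}"
        using N by (intro mindices_nonempty) auto
      fix k assume k: "k \<in> mindices m N"
      have "\<bar>V n k - U 0 (real n * \<tau>) k\<bar> \<le> ?C' * \<tau>\<^sup>2"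
      proof (rule global_error[OF _ \<tau> _ _ _ _ n k])
        show "T = real nstar * \<tau>"
          using nstar \<tau> by (simp add: field_simps)
        show "\<bar>mat_vec m N (D_mat m \<beta> N) (\<lambda>k. V 0 k - U 0 0 k) k\<bar> \<le> K0 * \<tau>\<^sup>2" if "k \<in> mindices m N" for k
          unfolding U0 by (rule order_trans[OF abs_le_max_norm[OF that] E0])
      qed (use N g0 step in auto)
      then show "\<bar>V n k - on_grid m N u (real n * \<tau>) k\<bar> \<le> ?C' * \<tau>\<^sup>2"
        by (simp only: U0)
    qed
  qed
qed

end
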